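(* Let $n\in\mathbb{N}\cup\{\infty\}$, let $m\ge1$, and let $f\colon(L,\ell)\to(L',\ell')$ be a strict $L_\infty$-epimorphism in $\mathsf{Lie}_n\mathsf{Alg}$ such that the induced map in homology $H(f_1)\colon H_m\to H'_m$ is surjective in degree $m$, where $H_m:=H_m(L,\ell_1)$ and $H'_m:=H_m(L',\ell'_1)$. Then there exist $L_\infty$-structures $\hat\ell$ and $\hat\ell'$ on the graded vector spaces $\tau_{<m}L\oplus H_m$ and $\tau_{<m}L'\oplus H'_m$, respectively, and $L_\infty$-isomorphisms $$\hat q\colon(\tau_{\le m}L,\tau_{\le m}\ell)\xrightarrow{\cong}(\tau_{<m}L\oplus H_m,\hat\ell),\qquad \hat q'\colon(\tau_{\le m}L',\tau_{\le m}\ell')\xrightarrow{\cong}(\tau_{<m}L'\oplus H'_m,\hat\ell')$$ such that the following diagram of strict $L_\infty$-morphisms commutes: $$\begin{array}{ccc}(\tau_{\le m}L,\tau_{\le m}\ell)&\xrightarrow{\ \hat q\ }&(\tau_{<m}L\oplus H_m,\hat\ell)\\ {\scriptstyle\tau_{\le m}f}\downarrow&&\downarrow{\scriptstyle\tau_{<m}f\,\oplus\,H(f)}\\ (\tau_{\le m}L',\tau_{\le m}\ell')&\xrightarrow{\ \hat q'\ }&(\tau_{<m}L'\oplus H'_m,\hat\ell')\end{array}$$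
   Context: Conventions: $\Bbbk$ is a field of characteristic zero and gradings are homological. For a $\mathbb{Z}$-graded vector space $V$, $\mathbf{s}V$ denotes the suspension, $(\mathbf{s}V)_i = V_{i-1}$, and $\bar S(V)=\bigoplus_{k\ge 1}S^k(V)$ is the reduced symmetric coalgebra, with $\bar\Delta(v_1\vee\cdots\vee v_m)=\sum_{p=1}^{m-1}\sum_{\sigma}\epsilon(\sigma)(v_{\sigma(1)}\vee\cdots\vee v_{\sigma(p)})\otimes(v_{\sigma(p+1)}\vee\cdots\vee v_{\sigma(m)})$, the inner sum over $(p,m-p)$-shuffles and $\epsilon(\sigma)$ the Koszul sign. Coderivations of, and coalgebra morphisms between, such coalgebras are uniquely determined by their components $\bar S(V)\to V$, resp. $\bar S(V)\to V'$. An $L_\infty$-algebra $(L,\ell)$ is a $\mathbb{Z}$-graded vector space $L$ with graded skew-symmetric maps $\ell_k\colon \Lambda^kL\to L$ of degree $k-2$ ($k\ge 1$) such that the degree $-1$ coderivation $\delta$ of $\bar S(\mathbf{s}L)$ with components $\delta^1_k=(-1)^{k(k-1)/2}\,\mathbf{s}\circ\ell_k\circ(\mathbf{s}^{-1})^{\otimes k}$ satisfies $\delta^2=0$. A (weak) $L_\infty$-morphism $f\colon(L,\ell)\to(L',\ell')$ is a collection of graded skew-symmetric maps $f_k\colon\Lambda^kL\to L'$ of degree $k-1$ ($k\ge1$) such that the coalgebra morphism $F\colon\bar S(\mathbf{s}L)\to\bar S(\mathbf{s}L')$ with components $F^1_k=(-1)^{k(k-1)/2}\,\mathbf{s}\circ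 f_k\circ(\mathbf{s}^{-1})^{\otimes k}$ satisfies $F\delta=\delta'F$. Composition is composition of coalgebra morphisms; $f_1$ is always a chain map $(L,\ell_1)\to(L',\ell'_1)$. $f$ is strict if $f_k=0$ for $k\ge2$; an $L_\infty$-isomorphism if $f_1$ is an isomorphism; an $L_\infty$-epimorphism if $f_1$ is surjective in every degree. A Lie $n$-algebra is an $L_\infty$-algebra concentrated in degrees $0,1,\dots,n-1$ (in all degrees $\geq 0$ if $n=\infty$); $\mathsf{Lie}_n\mathsf{Alg}$ is the category of Lie $n$-algebras and weak $L_\infty$-morphisms. Truncations: write $d=\ell_1$, $d_m\colon L_m\to L_{m-1}$. $\tau_{\le m}L$ is the complex with $L_i$ for $i<m$, $\mathrm{coker}(d_{m+1})$ in degree $m$, $0$ above, with top differential induced by $d_m$. $\tau_{<m}L$ is the complex with $L_i$ for $i<m$, $\mathrm{im}(d_m)$ in degree $m$, $0$ above, with top differential the inclusion $\mathrm{im}(d_m)\hookrightarrow L_{m-1}$. The surjective chain maps $p_{\le m}\colon L\to\tau_{\le m}L$ and $p_{<m}\colon L\to\tau_{<m}L$ are the identity in degrees $<m$, zero in degrees $>m$, and in degree $m$ are the quotient map, resp. $d_m$. The brackets $\tau_{\le m}\ell_k(p_{\le m}x_1,\dots,p_{\le m}x_k)=p_{\le m}\ell_k(x_1,\dots,x_k)$ and $\tau_{<m}\ell_k(p_{<m}x_1,\dots,p_{<m}x_k)=p_{<m}\ell_k(x_1,\dots,x_k)$ are well defined and make these Lie $n$-algebras; a morphism $\phi\colon(L,\ell)\to(L',\ell')$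 induces $\tau_{\le m}\phi$, $\tau_{<m}\phi$ by $\tau_{\le m}\phi_k(p_{\le m}x_1,\dots)=p'_{\le m}\phi_k(x_1,\dots)$ and likewise for $\tau_{<m}$ (so these are strict if $\phi$ is). $H_m$ and $H'_m$ are regarded as graded vector spaces concentrated in degree $m$, and $H(f)=H_m(f_1)\colon H_m\to H'_m$ in the diagram. *)

theory Defs
  imports
    "HOL-Algebra.Module"
    "HOL-Algebra.AbelCoset"
    "HOL-Algebra.Algebraic_Closure_Type"
    "HOL-Combinatorics.Permutations"
    "HOL-Library.Poly_Mapping"
    "HOL-Library.Extended_Nat"
begin

section \<open>Vector spaces, quotients, presentations, tensor products\<close>

text \<open>
  The ground field is a type \<open>'k\<close> of class \<^class>\<open>field_char_0\<close>.  Vector spaces are carrier-based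
  (quotients are needed), i.e. modules in the sense of HOL-Algebra over \<open>'k\<close> regarded as a ring record.
  The ring multiplication and unit that a module record formally carries are irrelevant.
\<close>

abbreviation is_vs :: "('k::field_char_0, 'v) module \<Rightarrow> bool" where
  "is_vs M \<equiv> module (ring_of_type_algebra :: 'k ring) M"

definition linear_on ::
    "('k::field_char_0, 'v) module \<Rightarrow> ('k, 'w) module \<Rightarrow> ('v \<Rightarrow> 'w) \<Rightarrow> bool" where
  "linear_on M N f \<longleftrightarrow>
     (\<forall>x\<in>carrier M. f x \<in> carrier N) \<and>
     (\<forall>x\<in>carrier M. \<forall>y\<in>carrier M. f (x \<oplus>\<^bsub>M\<^esub> y) = f x \<oplus>\<^bsub>N\<^esub> f y) \<and>
     (\<forall>a. \<forall>x\<in>carrier M. f (a \<odot>\<^bsub>M\<^esub> x) = a \<odot>\<^bsub>N\<^esub> f x)"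

definition quot_module :: "('k, 'v) module \<Rightarrow> 'v set \<Rightarrow> ('k, 'v set) module" where
  "quot_module M H =
     \<lparr>carrier = a_rcosets\<^bsub>M\<^esub> H, monoid.mult = (\<lambda>_ _. undefined), monoid.one = undefined,
      ring.zero = H, ring.add = set_add M, module.smult = (\<lambda>a Z. (\<Union>x\<in>Z. H +>\<^bsub>M\<^esub> (a \<odot>\<^bsub>M\<^esub> x)))\<rparr>"

definition dsum_module :: "('k, 'v) module \<Rightarrow> ('k, 'w) module \<Rightarrow> ('k, 'v \<times> 'w) module" where
  "dsum_module M N =
     \<lparr>carrier = carrier M \<times> carrier N, monoid.mult = (\<lambda>_ _. undefined), monoid.one = undefined,
      ring.zero = (\<zero>\<^bsub>M\<^esub>, \<zero>\<^bsub>N\<^esub>),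
      ring.add = (\<lambda>(x, y) (x', y'). (x \<oplus>\<^bsub>M\<^esub> x', y \<oplus>\<^bsub>N\<^esub> y')),
      module.smult = (\<lambda>a (x, y). (a \<odot>\<^bsub>M\<^esub> x, a \<odot>\<^bsub>N\<^esub> y))\<rparr>"

definition free_module :: "'x set \<Rightarrow> ('k::field_char_0, 'x \<Rightarrow>\<^sub>0 'k) module" where
  "free_module Z =
     \<lparr>carrier = {c. Poly_Mapping.keys c \<subseteq> Z}, monoid.mult = (\<lambda>_ _. undefined), monoid.one = undefined,
      ring.zero = 0, ring.add = (+), module.smult = (\<lambda>a c. Poly_Mapping.map ((*) a) c)\<rparr>"

definition vspan :: "('k::field_char_0, 'v) module \<Rightarrow> 'v set \<Rightarrow> 'v set" where
  "vspan M G = (\<lambda>H. submodule H ring_of_type_algebra M) hull G"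

text \<open>The vector space with generators \<open>Z\<close> and relations \<open>R\<close>, and the class of a generator.\<close>

definition presented :: "'x set \<Rightarrow> ('x \<Rightarrow>\<^sub>0 'k) set \<Rightarrow> ('k::field_char_0, ('x \<Rightarrow>\<^sub>0 'k) set) module" where
  "presented Z R = quot_module (free_module Z) (vspan (free_module Z) R)"

definition gen_class ::
    "'x set \<Rightarrow> ('x \<Rightarrow>\<^sub>0 'k::field_char_0) set \<Rightarrow> 'x \<Rightarrow> ('x \<Rightarrow>\<^sub>0 'k) set" where
  "gen_class Z R x = vspan (free_module Z) R +>\<^bsub>free_module Z\<^esub> Poly_Mapping.single x 1"

text \<open>
  The linear map out of a space with presentation that is prescribed by \<open>\<phi>\<close> on generators.
  It is well defined only if \<open>\<phi>\<close> respects the relations, which is the case in all uses below.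
\<close>

definition ext_gen ::
    "('k::field_char_0, 'z) module \<Rightarrow> ('x \<Rightarrow> 'z) \<Rightarrow> ('x \<Rightarrow>\<^sub>0 'k) set \<Rightarrow> 'z" where
  "ext_gen N \<phi> C =
     (let c = (SOME c. c \<in> C)
      in \<Oplus>\<^bsub>N\<^esub>x\<in>Poly_Mapping.keys c. Poly_Mapping.lookup c x \<odot>\<^bsub>N\<^esub> \<phi> x)"

definition tensor_rels ::
    "('k::field_char_0, 'v) module \<Rightarrow> ('k, 'w) module \<Rightarrow> ('v \<times> 'w \<Rightarrow>\<^sub>0 'k) set" where
  "tensor_rels M N =
     {Poly_Mapping.single (x \<oplus>\<^bsub>M\<^esub> x', y) 1 - Poly_Mapping.single (x, y) 1
        - Poly_Mapping.single (x', y) 1 | x x' y.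
        x \<in> carrier M \<and> x' \<in> carrier M \<and> y \<in> carrier N} \<union>
     {Poly_Mapping.single (x, y \<oplus>\<^bsub>N\<^esub> y') 1 - Poly_Mapping.single (x, y) 1
        - Poly_Mapping.single (x, y') 1 | x y y'.
        x \<in> carrier M \<and> y \<in> carrier N \<and> y' \<in> carrier N} \<union>
     {Poly_Mapping.single (a \<odot>\<^bsub>M\<^esub> x, y) 1 - Poly_Mapping.single (x, y) a | a x y.
        x \<in> carrier M \<and> y \<in> carrier N} \<union>
     {Poly_Mapping.single (x, a \<odot>\<^bsub>N\<^esub> y) 1 - Poly_Mapping.single (x, y) a | a x y.
        x \<in> carrier M \<and> y \<in> carrier N}"

definition tensor_module ::
    "('k::field_char_0, 'v) module \<Rightarrow> ('k, 'w) module \<Rightarrow> ('k, ('v \<times> 'w \<Rightarrow>\<^sub>0 'k) set) module" where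
  "tensor_module M N = presented (carrier M \<times> carrier N) (tensor_rels M N)"

definition tens ::
    "('k::field_char_0, 'v) module \<Rightarrow> ('k, 'w) module \<Rightarrow> 'v \<Rightarrow> 'w \<Rightarrow> ('v \<times> 'w \<Rightarrow>\<^sub>0 'k) set" where
  "tens M N x y = gen_class (carrier M \<times> carrier N) (tensor_rels M N) (x, y)"

text \<open>The ungraded tensor product of linear maps \<open>f\<close> and \<open>g\<close>, with values in \<open>M' \<otimes> N'\<close>.\<close>

definition tens_map ::
    "('k::field_char_0, 'v') module \<Rightarrow> ('k, 'w') module \<Rightarrow> ('v \<Rightarrow> 'v') \<Rightarrow> ('w \<Rightarrow> 'w') \<Rightarrow>
     ('v \<times> 'w \<Rightarrow>\<^sub>0 'k) set \<Rightarrow> ('v' \<times> 'w' \<Rightarrow>\<^sub>0 'k) set" where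
  "tens_map M' N' f g = ext_gen (tensor_module M' N') (\<lambda>(x, y). tens M' N' (f x) (g y))"


section \<open>Graded vector spaces and the reduced symmetric coalgebra\<close>

text \<open>
  A \<open>\<int>\<close>-graded vector space is a family of vector spaces.  A homogeneous element is
  represented together with its degree, as a pair \<open>(i, v)\<close> with \<open>v \<in> carrier (V i)\<close>; lists of such pairs
  stand for (non-empty) products of homogeneous elements.
\<close>

type_synonym ('k, 'v) graded = "int \<Rightarrow> ('k, 'v) module"
type_synonym 'v word = "(int \<times> 'v) list"

definition graded_vs :: "('k::field_char_0, 'v) graded \<Rightarrow> bool" where
  "graded_vs V \<longleftrightarrow> (\<forall>i. is_vs (V i))"

definition words :: "('k, 'v) graded \<Rightarrow> 'v word set" where
  "words V = {w. w \<noteq> [] \<and> (\<forall>(i, v)\<in>set w. v \<in> carrier (V i))}"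

definition wdeg :: "'v word \<Rightarrow> int" where
  "wdeg w = sum_list (map fst w)"

definition susp :: "('k, 'v) graded \<Rightarrow> ('k, 'v) graded" where
  "susp V i = V (i - 1)"

definition sym_rels :: "('k::field_char_0, 'v) graded \<Rightarrow> ('v word \<Rightarrow>\<^sub>0 'k) set" where
  "sym_rels V =
     {Poly_Mapping.single (u @ (i, x \<oplus>\<^bsub>V i\<^esub> y) # t) 1 - Poly_Mapping.single (u @ (i, x) # t) 1
        - Poly_Mapping.single (u @ (i, y) # t) 1 | u i x y t.
        u @ (i, x) # t \<in> words V \<and> u @ (i, y) # t \<in> words V} \<union>
     {Poly_Mapping.single (u @ (i, a \<odot>\<^bsub>V i\<^esub> x) # t) 1
        - Poly_Mapping.single (u @ (i, x) # t) a | u i a x t.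
        u @ (i, x) # t \<in> words V} \<union>
     {Poly_Mapping.single (u @ x # y # t) 1
        - Poly_Mapping.single (u @ y # x # t) ((-1) powi (fst x * fst y)) | u x y t.
        u @ x # y # t \<in> words V}"

text \<open>The space \<open>S\<^sup>1(V) \<oplus> S\<^sup>2(V) \<oplus> \<dots>\<close>; \<open>sym_class V [v\<^sub>1, \<dots>, v\<^sub>k]\<close> is \<open>v\<^sub>1 \<or> \<dots> \<or> v\<^sub>k\<close>.\<close>

definition Sym :: "('k::field_char_0, 'v) graded \<Rightarrow> ('k, ('v word \<Rightarrow>\<^sub>0 'k) set) module" where
  "Sym V = presented (words V) (sym_rels V)"

definition sym_class :: "('k::field_char_0, 'v) graded \<Rightarrow> 'v word \<Rightarrow> ('v word \<Rightarrow>\<^sub>0 'k) set" where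
  "sym_class V w = gen_class (words V) (sym_rels V) w"

definition Sym_deg :: "('k::field_char_0, 'v) graded \<Rightarrow> int \<Rightarrow> ('v word \<Rightarrow>\<^sub>0 'k) set set" where
  "Sym_deg V j = vspan (Sym V) (sym_class V ` {w \<in> words V. wdeg w = j})"

text \<open>The projection onto \<open>S\<^sup>1(V) = V\<close>, as an endomorphism.\<close>

definition Sym_pr1 ::
    "('k::field_char_0, 'v) graded \<Rightarrow> ('v word \<Rightarrow>\<^sub>0 'k) set \<Rightarrow> ('v word \<Rightarrow>\<^sub>0 'k) set" where
  "Sym_pr1 V = ext_gen (Sym V) (\<lambda>w. if length w = 1 then sym_class V w else \<zero>\<^bsub>Sym V\<^esub>)"

text \<open>\<open>Z \<mapsto> (-1)\<^bsup>|Z|\<^esup> Z\<close>\<close>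

definition Sym_sign ::
    "('k::field_char_0, 'v) graded \<Rightarrow> ('v word \<Rightarrow>\<^sub>0 'k) set \<Rightarrow> ('v word \<Rightarrow>\<^sub>0 'k) set" where
  "Sym_sign V = ext_gen (Sym V) (\<lambda>w. ((-1) powi wdeg w) \<odot>\<^bsub>Sym V\<^esub> sym_class V w)"

text \<open>Shuffles permute the positions \<open>0, \<dots>, m - 1\<close>.\<close>

definition shuffles_perm :: "nat \<Rightarrow> nat \<Rightarrow> (nat \<Rightarrow> nat) set" where
  "shuffles_perm p m =
     {\<sigma>. \<sigma> permutes {..<m} \<and> strict_mono_on {..<p} \<sigma> \<and> strict_mono_on {p..<m} \<sigma>}"

definition koszul :: "(nat \<Rightarrow> nat) \<Rightarrow> 'v word \<Rightarrow> 'k::field_char_0" where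
  "koszul \<sigma> w =
     (\<Prod>(i, j)\<in>{(i, j). i < j \<and> j < length w \<and> \<sigma> j < \<sigma> i}.
        (-1) powi (fst (w ! \<sigma> i) * fst (w ! \<sigma> j)))"

abbreviation Sym2 ::
    "('k::field_char_0, 'v) graded \<Rightarrow>
     ('k, (('v word \<Rightarrow>\<^sub>0 'k) set \<times> ('v word \<Rightarrow>\<^sub>0 'k) set \<Rightarrow>\<^sub>0 'k) set) module" where
  "Sym2 V \<equiv> tensor_module (Sym V) (Sym V)"

definition comult ::
    "('k::field_char_0, 'v) graded \<Rightarrow> ('v word \<Rightarrow>\<^sub>0 'k) set \<Rightarrow>
     (('v word \<Rightarrow>\<^sub>0 'k) set \<times> ('v word \<Rightarrow>\<^sub>0 'k) set \<Rightarrow>\<^sub>0 'k) set" where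
  "comult V = ext_gen (Sym2 V) (\<lambda>w.
     \<Oplus>\<^bsub>Sym2 V\<^esub>p\<in>{1..<length w}. \<Oplus>\<^bsub>Sym2 V\<^esub>\<sigma>\<in>shuffles_perm p (length w).
       koszul \<sigma> w \<odot>\<^bsub>Sym2 V\<^esub>
         tens (Sym V) (Sym V)
           (sym_class V (map (\<lambda>i. w ! \<sigma> i) [0..<p]))
           (sym_class V (map (\<lambda>i. w ! \<sigma> i) [p..<length w])))"

text \<open>
  Coderivations of degree \<open>-1\<close>.  By the Koszul rule \<open>(1 \<otimes> \<delta>)(Z \<otimes> Y) = (-1)\<^bsup>|Z|\<^esup> Z \<otimes> \<delta> Y\<close>, which is
  the ungraded tensor product of \<^const>\<open>Sym_sign\<close> and \<open>\<delta>\<close>.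
\<close>

definition coderivation ::
    "('k::field_char_0, 'v) graded \<Rightarrow> (('v word \<Rightarrow>\<^sub>0 'k) set \<Rightarrow> ('v word \<Rightarrow>\<^sub>0 'k) set) \<Rightarrow> bool" where
  "coderivation V \<delta> \<longleftrightarrow>
     linear_on (Sym V) (Sym V) \<delta> \<and>
     (\<forall>j. \<forall>Z\<in>Sym_deg V j. \<delta> Z \<in> Sym_deg V (j - 1)) \<and>
     (\<forall>Z\<in>carrier (Sym V).
        comult V (\<delta> Z) =
          tens_map (Sym V) (Sym V) \<delta> (\<lambda>Y. Y) (comult V Z) \<oplus>\<^bsub>Sym2 V\<^esub>
          tens_map (Sym V) (Sym V) (Sym_sign V) \<delta> (comult V Z))"

definition coalg_morphism ::
    "('k::field_char_0, 'v) graded \<Rightarrow> ('k, 'w) graded \<Rightarrow>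
     (('v word \<Rightarrow>\<^sub>0 'k) set \<Rightarrow> ('w word \<Rightarrow>\<^sub>0 'k) set) \<Rightarrow> bool" where
  "coalg_morphism V W F \<longleftrightarrow>
     linear_on (Sym V) (Sym W) F \<and>
     (\<forall>j. \<forall>Z\<in>Sym_deg V j. F Z \<in> Sym_deg W j) \<and>
     (\<forall>Z\<in>carrier (Sym V). comult W (F Z) = tens_map (Sym W) (Sym W) F F (comult V Z))"

text \<open>
  The composite of \<open>F\<close> (of degree \<open>r\<close>) with the projection to \<open>W\<close> is given by \<open>c\<close>: on \<open>S\<^sup>k(V)\<close> it is
  \<open>v\<^sub>1 \<or> \<dots> \<or> v\<^sub>k \<mapsto> c [v\<^sub>1, \<dots>, v\<^sub>k]\<close>, an element of degree \<open>|v\<^sub>1| + \<dots> + |v\<^sub>k| + r\<close>.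
\<close>

definition has_components ::
    "('k::field_char_0, 'v) graded \<Rightarrow> ('k, 'w) graded \<Rightarrow> int \<Rightarrow>
     (('v word \<Rightarrow>\<^sub>0 'k) set \<Rightarrow> ('w word \<Rightarrow>\<^sub>0 'k) set) \<Rightarrow> ('v word \<Rightarrow> 'w) \<Rightarrow> bool" where
  "has_components V W r F c \<longleftrightarrow>
     (\<forall>w\<in>words V. Sym_pr1 W (F (sym_class V w)) = sym_class W [(wdeg w + r, c w)])"


section \<open>\<open>L\<^sub>\<infinity>\<close>-algebras and their morphisms\<close>

text \<open>
  A family of maps \<open>\<phi>\<^sub>k : \<Lambda>\<^sup>k L \<rightarrow> L'\<close> of degree \<open>k + r\<close> (\<open>k \<ge> 1\<close>) is encoded as one function on words,
  \<open>\<phi>\<^sub>k(x\<^sub>1, \<dots>, x\<^sub>k)\<close> being \<open>\<phi> [x\<^sub>1, \<dots>, x\<^sub>k]\<close>.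
\<close>

definition out_deg :: "int \<Rightarrow> 'v word \<Rightarrow> int" where
  "out_deg r w = wdeg w + int (length w) + r"

definition skew_family ::
    "('k::field_char_0, 'v) graded \<Rightarrow> ('k, 'w) graded \<Rightarrow> int \<Rightarrow> ('v word \<Rightarrow> 'w) \<Rightarrow> bool" where
  "skew_family L L' r \<phi> \<longleftrightarrow>
     (\<forall>w\<in>words L. \<phi> w \<in> carrier (L' (out_deg r w))) \<and>
     (\<forall>u i x y t. u @ (i, x) # t \<in> words L \<longrightarrow> u @ (i, y) # t \<in> words L \<longrightarrow>
        \<phi> (u @ (i, x \<oplus>\<^bsub>L i\<^esub> y) # t) =
          \<phi> (u @ (i, x) # t) \<oplus>\<^bsub>L' (out_deg r (u @ (i, x) # t))\<^esub> \<phi> (u @ (i, y) # t)) \<and>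
     (\<forall>u i a x t. u @ (i, x) # t \<in> words L \<longrightarrow>
        \<phi> (u @ (i, a \<odot>\<^bsub>L i\<^esub> x) # t) =
          a \<odot>\<^bsub>L' (out_deg r (u @ (i, x) # t))\<^esub> \<phi> (u @ (i, x) # t)) \<and>
     (\<forall>u x y t. u @ x # y # t \<in> words L \<longrightarrow>
        \<phi> (u @ x # y # t) =
          (- ((-1) powi (fst x * fst y))) \<odot>\<^bsub>L' (out_deg r (u @ x # y # t))\<^esub>
            \<phi> (u @ y # x # t))"

text \<open>
  The map \<open>(-1)\<^bsup>k(k-1)/2\<^esup> s \<circ> \<phi>\<^sub>k \<circ> (s\<^sup>-\<^sup>1)\<^bsup>\<otimes>k\<^esup>\<close> on \<open>sL\<close>.  By the Koszul rule,
  \<open>(s\<^sup>-\<^sup>1)\<^bsup>\<otimes>k\<^esup>(v\<^sub>0, \<dots>, v\<^bsub>k-1\<^esub>)\<close> involves the sign with exponent the sum over all \<open>j\<close> of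
  \<open>(k - 1 - j) |v\<^sub>j|\<close>, because \<open>v\<^sub>j\<close> is passed by \<open>k - 1 - j\<close> copies of \<open>s\<^sup>-\<^sup>1\<close>; here \<open>|v\<^sub>j|\<close> is the
  degree in \<open>sL\<close>.
\<close>

definition desusp :: "'v word \<Rightarrow> 'v word" where
  "desusp w = map (\<lambda>(i, v). (i - 1, v)) w"

definition susp_family ::
    "('k::field_char_0, 'w) graded \<Rightarrow> int \<Rightarrow> ('v word \<Rightarrow> 'w) \<Rightarrow> 'v word \<Rightarrow> 'w" where
  "susp_family L' r \<phi> w =
     (let k = length w in
      ((-1) ^ (k * (k - 1) div 2) *
       (-1) powi (\<Sum>j<k. int (k - 1 - j) * fst (w ! j)))
      \<odot>\<^bsub>L' (out_deg r (desusp w))\<^esub> \<phi> (desusp w))"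

definition Linf_coder ::
    "('k::field_char_0, 'v) graded \<Rightarrow> ('v word \<Rightarrow> 'v) \<Rightarrow>
     (('v word \<Rightarrow>\<^sub>0 'k) set \<Rightarrow> ('v word \<Rightarrow>\<^sub>0 'k) set) \<Rightarrow> bool" where
  "Linf_coder L br \<delta> \<longleftrightarrow>
     coderivation (susp L) \<delta> \<and>
     has_components (susp L) (susp L) (-1) \<delta> (susp_family L (-2) br)"

definition Linf_algebra :: "('k::field_char_0, 'v) graded \<Rightarrow> ('v word \<Rightarrow> 'v) \<Rightarrow> bool" where
  "Linf_algebra L br \<longleftrightarrow>
     graded_vs L \<and> skew_family L L (-2) br \<and>
     (\<exists>\<delta>. Linf_coder L br \<delta> \<and> (\<forall>Z\<in>carrier (Sym (susp L)). \<delta> (\<delta> Z) = \<zero>\<^bsub>Sym (susp L)\<^esub>))"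

definition Linf_comor ::
    "('k::field_char_0, 'v) graded \<Rightarrow> ('k, 'w) graded \<Rightarrow> ('v word \<Rightarrow> 'w) \<Rightarrow>
     (('v word \<Rightarrow>\<^sub>0 'k) set \<Rightarrow> ('w word \<Rightarrow>\<^sub>0 'k) set) \<Rightarrow> bool" where
  "Linf_comor L L' f F \<longleftrightarrow>
     coalg_morphism (susp L) (susp L') F \<and>
     has_components (susp L) (susp L') 0 F (susp_family L' (-1) f)"

definition Linf_morphism ::
    "('k::field_char_0, 'v) graded \<Rightarrow> ('v word \<Rightarrow> 'v) \<Rightarrow> ('k, 'w) graded \<Rightarrow> ('w word \<Rightarrow> 'w) \<Rightarrow>
     ('v word \<Rightarrow> 'w) \<Rightarrow> bool" where
  "Linf_morphism L br L' br' f \<longleftrightarrow>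
     Linf_algebra L br \<and> Linf_algebra L' br' \<and> skew_family L L' (-1) f \<and>
     (\<exists>F \<delta> \<delta>'. Linf_comor L L' f F \<and> Linf_coder L br \<delta> \<and> Linf_coder L' br' \<delta>' \<and>
        (\<forall>Z\<in>carrier (Sym (susp L)). F (\<delta> Z) = \<delta>' (F Z)))"

text \<open>
  The coalgebra morphism of an \<open>L\<^sub>\<infinity>\<close>-morphism.  It exists for every \<^const>\<open>Linf_morphism\<close>, and on the
  carrier of the symmetric coalgebra it is unique.
\<close>

definition comor_of ::
    "('k::field_char_0, 'v) graded \<Rightarrow> ('k, 'w) graded \<Rightarrow> ('v word \<Rightarrow> 'w) \<Rightarrow>
     ('v word \<Rightarrow>\<^sub>0 'k) set \<Rightarrow> ('w word \<Rightarrow>\<^sub>0 'k) set" where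
  "comor_of L L' f = (SOME F. Linf_comor L L' f F)"

definition strict_family ::
    "('k, 'v) graded \<Rightarrow> ('k, 'w) graded \<Rightarrow> ('v word \<Rightarrow> 'w) \<Rightarrow> bool" where
  "strict_family L L' f \<longleftrightarrow>
     (\<forall>w\<in>words L. length w \<ge> 2 \<longrightarrow> f w = \<zero>\<^bsub>L' (out_deg (-1) w)\<^esub>)"

definition Linf_iso ::
    "('k::field_char_0, 'v) graded \<Rightarrow> ('v word \<Rightarrow> 'v) \<Rightarrow> ('k, 'w) graded \<Rightarrow> ('w word \<Rightarrow> 'w) \<Rightarrow>
     ('v word \<Rightarrow> 'w) \<Rightarrow> bool" where
  "Linf_iso L br L' br' f \<longleftrightarrow>
     Linf_morphism L br L' br' f \<and>
     (\<forall>i. bij_betw (\<lambda>x. f [(i, x)]) (carrier (L i)) (carrier (L' i)))"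

definition Linf_epi ::
    "('k::field_char_0, 'v) graded \<Rightarrow> ('v word \<Rightarrow> 'v) \<Rightarrow> ('k, 'w) graded \<Rightarrow> ('w word \<Rightarrow> 'w) \<Rightarrow>
     ('v word \<Rightarrow> 'w) \<Rightarrow> bool" where
  "Linf_epi L br L' br' f \<longleftrightarrow>
     Linf_morphism L br L' br' f \<and>
     (\<forall>i. (\<lambda>x. f [(i, x)]) ` carrier (L i) = carrier (L' i))"

definition Lie_n_algebra ::
    "enat \<Rightarrow> ('k::field_char_0, 'v) graded \<Rightarrow> ('v word \<Rightarrow> 'v) \<Rightarrow> bool" where
  "Lie_n_algebra n L br \<longleftrightarrow>
     Linf_algebra L br \<and>
     (\<forall>i. \<not> (0 \<le> i \<and> enat (nat i) < n) \<longrightarrow> carrier (L i) = {\<zero>\<^bsub>L i\<^esub>})"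


section \<open>Homology and truncations\<close>

definition cycles :: "('k, 'v) graded \<Rightarrow> ('v word \<Rightarrow> 'v) \<Rightarrow> int \<Rightarrow> 'v set" where
  "cycles L br i = {x \<in> carrier (L i). br [(i, x)] = \<zero>\<^bsub>L (i - 1)\<^esub>}"

definition boundaries :: "('k, 'v) graded \<Rightarrow> ('v word \<Rightarrow> 'v) \<Rightarrow> int \<Rightarrow> 'v set" where
  "boundaries L br i = (\<lambda>x. br [(i + 1, x)]) ` carrier (L (i + 1))"

definition homology :: "('k, 'v) graded \<Rightarrow> ('v word \<Rightarrow> 'v) \<Rightarrow> ('k, 'v set) graded" where
  "homology L br i = quot_module ((L i)\<lparr>carrier := cycles L br i\<rparr>) (boundaries L br i)"

definition homology_map ::
    "('k, 'w) graded \<Rightarrow> ('w word \<Rightarrow> 'w) \<Rightarrow> ('v word \<Rightarrow> 'w) \<Rightarrow> int \<Rightarrow> 'v set \<Rightarrow> 'w set" where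
  "homology_map L' br' f i Z = (\<Union>x\<in>Z. boundaries L' br' i +>\<^bsub>L' i\<^esub> f [(i, x)])"

text \<open>\<open>V\<^sub>m\<close> regarded as a graded vector space concentrated in degree \<open>m\<close>.\<close>

definition conc :: "int \<Rightarrow> ('k, 'v) graded \<Rightarrow> ('k, 'v) graded" where
  "conc m V i = (if i = m then V i else (V i)\<lparr>carrier := {\<zero>\<^bsub>V i\<^esub>}\<rparr>)"

text \<open>
  \<open>\<tau>\<^bsub>\<le>m\<^esub> L\<close> is the quotient of \<open>L\<close> by the kernel of the projection: \<open>0\<close> below degree \<open>m\<close>, the boundaries in
  degree \<open>m\<close>, everything above.  In degrees \<open>i < m\<close> this identifies \<open>L\<^sub>i\<close> with the singletons in \<open>L\<^sub>i / 0\<close>,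
  so that all degrees have the same type of elements.
\<close>

definition trunc_le_ker :: "('k, 'v) graded \<Rightarrow> ('v word \<Rightarrow> 'v) \<Rightarrow> int \<Rightarrow> int \<Rightarrow> 'v set" where
  "trunc_le_ker L br m i =
     (if i < m then {\<zero>\<^bsub>L i\<^esub>} else if i = m then boundaries L br m else carrier (L i))"

definition trunc_le :: "('k, 'v) graded \<Rightarrow> ('v word \<Rightarrow> 'v) \<Rightarrow> int \<Rightarrow> ('k, 'v set) graded" where
  "trunc_le L br m i = quot_module (L i) (trunc_le_ker L br m i)"

definition p_le :: "('k, 'v) graded \<Rightarrow> ('v word \<Rightarrow> 'v) \<Rightarrow> int \<Rightarrow> int \<Rightarrow> 'v \<Rightarrow> 'v set" where
  "p_le L br m i x = trunc_le_ker L br m i +>\<^bsub>L i\<^esub> x"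

definition trunc_lt :: "('k, 'v) graded \<Rightarrow> ('v word \<Rightarrow> 'v) \<Rightarrow> int \<Rightarrow> ('k, 'v) graded" where
  "trunc_lt L br m i =
     (if i < m then L i
      else if i = m then (L (m - 1))\<lparr>carrier := boundaries L br (m - 1)\<rparr>
      else (L i)\<lparr>carrier := {\<zero>\<^bsub>L i\<^esub>}\<rparr>)"

definition p_lt :: "('k, 'v) graded \<Rightarrow> ('v word \<Rightarrow> 'v) \<Rightarrow> int \<Rightarrow> int \<Rightarrow> 'v \<Rightarrow> 'v" where
  "p_lt L br m i x = (if i < m then x else if i = m then br [(m, x)] else \<zero>\<^bsub>L i\<^esub>)"

text \<open>
  The family \<open>\<psi>\<close> with \<open>\<psi>\<^sub>k(p x\<^sub>1, \<dots>, p x\<^sub>k) = p' (\<phi>\<^sub>k(x\<^sub>1, \<dots>, x\<^sub>k))\<close>, computed on chosen preimages under the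
  degreewise surjection \<open>p\<close> defined on \<open>L\<close>.
\<close>

definition induced_family ::
    "('k, 'v) graded \<Rightarrow> (int \<Rightarrow> 'v \<Rightarrow> 'x) \<Rightarrow> (int \<Rightarrow> 'w \<Rightarrow> 'y) \<Rightarrow> int \<Rightarrow> ('v word \<Rightarrow> 'w) \<Rightarrow>
     'x word \<Rightarrow> 'y" where
  "induced_family L p p' r \<phi> w =
     p' (out_deg r w) (\<phi> (map (\<lambda>(i, y). (i, SOME x. x \<in> carrier (L i) \<and> p i x = y)) w))"

definition trunc_le_bracket ::
    "('k, 'v) graded \<Rightarrow> ('v word \<Rightarrow> 'v) \<Rightarrow> int \<Rightarrow> 'v set word \<Rightarrow> 'v set" where
  "trunc_le_bracket L br m = induced_family L (p_le L br m) (p_le L br m) (-2) br"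

definition trunc_le_mor ::
    "('k, 'v) graded \<Rightarrow> ('v word \<Rightarrow> 'v) \<Rightarrow> ('k, 'w) graded \<Rightarrow> ('w word \<Rightarrow> 'w) \<Rightarrow> int \<Rightarrow>
     ('v word \<Rightarrow> 'w) \<Rightarrow> 'v set word \<Rightarrow> 'w set" where
  "trunc_le_mor L br L' br' m = induced_family L (p_le L br m) (p_le L' br' m) (-1)"

definition trunc_lt_mor ::
    "('k, 'v) graded \<Rightarrow> ('v word \<Rightarrow> 'v) \<Rightarrow> ('k, 'w) graded \<Rightarrow> ('w word \<Rightarrow> 'w) \<Rightarrow> int \<Rightarrow>
     ('v word \<Rightarrow> 'w) \<Rightarrow> 'v word \<Rightarrow> 'w" where
  "trunc_lt_mor L br L' br' m = induced_family L (p_lt L br m) (p_lt L' br' m) (-1)"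

definition dsum :: "('k, 'v) graded \<Rightarrow> ('k, 'w) graded \<Rightarrow> ('k, 'v \<times> 'w) graded" where
  "dsum V W i = dsum_module (V i) (W i)"

definition dsum_family ::
    "('v word \<Rightarrow> 'v') \<Rightarrow> ('w word \<Rightarrow> 'w') \<Rightarrow> ('v \<times> 'w) word \<Rightarrow> 'v' \<times> 'w'" where
  "dsum_family \<phi> \<psi> w =
     (\<phi> (map (\<lambda>(i, x, y). (i, x)) w), \<psi> (map (\<lambda>(i, x, y). (i, y)) w))"

text \<open>The family with linear part \<open>g\<close> and no higher components.\<close>

definition linear_family ::
    "('k, 'w) graded \<Rightarrow> (int \<Rightarrow> 'v \<Rightarrow> 'w) \<Rightarrow> 'v word \<Rightarrow> 'w" where
  "linear_family W g w =
     (case w of [(i, x)] \<Rightarrow> g i x | _ \<Rightarrow> \<zero>\<^bsub>W (out_deg (-1) w)\<^esub>)"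

definition trunc_lt_hom ::
    "('k, 'v) graded \<Rightarrow> ('v word \<Rightarrow> 'v) \<Rightarrow> int \<Rightarrow> ('k, 'v \<times> 'v set) graded" where
  "trunc_lt_hom L br m = dsum (trunc_lt L br m) (conc m (homology L br))"

definition trunc_lt_hom_mor ::
    "('k, 'v) graded \<Rightarrow> ('v word \<Rightarrow> 'v) \<Rightarrow> ('k, 'w) graded \<Rightarrow> ('w word \<Rightarrow> 'w) \<Rightarrow> int \<Rightarrow>
     ('v word \<Rightarrow> 'w) \<Rightarrow> ('v \<times> 'v set) word \<Rightarrow> 'w \<times> 'w set" where
  "trunc_lt_hom_mor L br L' br' m f =
     dsum_family (trunc_lt_mor L br L' br' m f)
       (linear_family (conc m (homology L' br')) (homology_map L' br' f))"

end

theory Submission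
  imports Defs
begin

text \<open>
  Multiplying the two factors of the reduced coproduct back together is a nonzero scalar on \<open>S\<^sup>k(V)\<close> for
  \<open>k \<ge> 2\<close>, so an element of the reduced symmetric coalgebra is determined by its linear part and its coproduct.
  By induction on word length, coderivations and coalgebra morphisms are determined by their components.
  Therefore an \<open>L\<^sub>\<infinity>\<close>-structure descends along a strict surjection \<open>P\<close> as soon as its brackets do:
  for a linear section \<open>S\<close>, the map \<open>P \<delta> S\<close> is a coderivation, and \<open>P \<delta> = (P \<delta> S) P\<close> by uniqueness.

  This is used twice.  The kernel of \<open>p\<^bsub>\<le>m\<^esub>\<close> is an ideal for degree reasons, except for a binary bracket of
  a boundary in degree \<open>m\<close> with an element of degree \<open>0\<close>, where the Leibniz rule applies.  Then the structure on
  \<open>\<tau>\<^bsub>\<le>m\<^esub> L\<close> is transported along the linear isomorphism \<open>(d, r)\<close> from \<open>L\<^sub>m / im d\<close> to \<open>im d \<oplus> H\<^sub>m\<close>,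
  where \<open>r : L\<^sub>m \<rightarrow> H\<^sub>m\<close> extends the projection of the cycles.  The square commutes if \<open>H(f) r = r' f\<close>: choose \<open>r'\<close>
  first, and obtain \<open>r\<close> by lifting \<open>r' f\<close> through the surjection \<open>H(f)\<close> on a complement of the cycles.
\<close>

text \<open>\<open>Linf_algebra\<close> demands a coderivation with the given components. Uniqueness
  of such maps is established below; existence from arbitrary components would require the explicit
  formula for a cofree lift. That obstacle shapes the proof: every new structure is obtained as the
  image of a given one along a strict surjection, and transport along an isomorphism is treated as a
  special case of this. All four maps of the square are strict, so their coalgebra morphisms are
  induced letterwise by linear maps, and the square reduces to one equation per degree. Shuffles are
  ill suited to induction on words, so the coproduct is rewritten as a sum over bit lists that mark
  the letters of the left factor. The scalar in the overview then counts the splittings of a word of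
  length k into two non-empty subwords; it is \<open>2^k - 2\<close>, and characteristic zero makes
  it invertible. The truncated brackets and maps are defined through arbitrary, non-linear choices
  of preimages. Their linearity is recovered from linear sections or from factorizations along
  surjections.\<close>

lemma rta_simps [simp]:
  "carrier (ring_of_type_algebra :: 'k::field_char_0 ring) = UNIV"
  "a \<oplus>\<^bsub>ring_of_type_algebra\<^esub> b = a + (b :: 'k)"
  "a \<otimes>\<^bsub>ring_of_type_algebra\<^esub> b = a * b"
  "\<zero>\<^bsub>ring_of_type_algebra\<^esub> = (0 :: 'k)" "\<one>\<^bsub>ring_of_type_algebra\<^esub> = (1 :: 'k)"
  by (simp_all add: ring_of_type_algebra_def)

section \<open>Arithmetic in carrier-based vector spaces\<close>

locale vs = M?: module ring_of_type_algebra M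
  for M :: "('k::field_char_0, 'v) module" (structure)
begin

lemmas smult_cl = smult_closed[simplified]
lemmas smult_l = smult_l_distr[simplified]
lemmas smult_r = smult_r_distr[simplified]
lemmas smult_assoc = smult_assoc1[simplified]
lemmas smult_1 = smult_one[simplified]
lemmas smult_0 = smult_l_null[simplified]

lemma smult_zero: "a \<odot> \<zero> = \<zero>"
  by simp

lemma smult_m1: "x \<in> carrier M \<Longrightarrow> (-1) \<odot> x = \<ominus> x"
  by (metis M.add.inv_equality M.l_zero add.left_inverse smult_0 smult_1 smult_cl smult_l)

end

lemma vs_iff: "vs M \<longleftrightarrow> is_vs M"
  by (simp add: vs_def)

text \<open>The laws are restated with \<open>is_vs M\<close> as a premise because later arguments
  move between many modules at once (each \<open>V i\<close>, \<open>Sym V\<close>,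
  \<open>Sym2 V\<close>), where one interpretation per module would be unwieldy.\<close>

lemma vs_abelian_group: "is_vs M \<Longrightarrow> abelian_group M"
  by (simp add: module_def)
lemma vs_add_closed: "is_vs M \<Longrightarrow> x \<in> carrier M \<Longrightarrow> y \<in> carrier M \<Longrightarrow> x \<oplus>\<^bsub>M\<^esub> y \<in> carrier M"
  by (rule abelian_groupE(1)[OF vs_abelian_group])
lemma vs_zero_closed: "is_vs M \<Longrightarrow> \<zero>\<^bsub>M\<^esub> \<in> carrier M"
  by (rule abelian_groupE(2)[OF vs_abelian_group])
lemma vs_add_assoc: "is_vs M \<Longrightarrow> x \<in> carrier M \<Longrightarrow> y \<in> carrier M \<Longrightarrow> z \<in> carrier M
    \<Longrightarrow> (x \<oplus>\<^bsub>M\<^esub> y) \<oplus>\<^bsub>M\<^esub> z = x \<oplus>\<^bsub>M\<^esub> (y \<oplus>\<^bsub>M\<^esub> z)"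
  by (rule abelian_groupE(3)[OF vs_abelian_group])
lemma vs_add_comm: "is_vs M \<Longrightarrow> x \<in> carrier M \<Longrightarrow> y \<in> carrier M \<Longrightarrow> x \<oplus>\<^bsub>M\<^esub> y = y \<oplus>\<^bsub>M\<^esub> x"
  by (rule abelian_groupE(4)[OF vs_abelian_group])
lemma vs_l_zero: "is_vs M \<Longrightarrow> x \<in> carrier M \<Longrightarrow> \<zero>\<^bsub>M\<^esub> \<oplus>\<^bsub>M\<^esub> x = x"
  by (rule abelian_groupE(5)[OF vs_abelian_group])
lemma vs_r_zero: "is_vs M \<Longrightarrow> x \<in> carrier M \<Longrightarrow> x \<oplus>\<^bsub>M\<^esub> \<zero>\<^bsub>M\<^esub> = x"
  by (metis vs_add_comm vs_l_zero vs_zero_closed)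
lemma vs_smult_closed: "is_vs M \<Longrightarrow> x \<in> carrier M \<Longrightarrow> a \<odot>\<^bsub>M\<^esub> x \<in> carrier M"
  by (simp add: vs.smult_cl vs_iff)
lemma vs_smult_l: "is_vs M \<Longrightarrow> x \<in> carrier M \<Longrightarrow> (a + b) \<odot>\<^bsub>M\<^esub> x = a \<odot>\<^bsub>M\<^esub> x \<oplus>\<^bsub>M\<^esub> b \<odot>\<^bsub>M\<^esub> x"
  by (simp add: vs.smult_l vs_iff)
lemma vs_smult_r: "is_vs M \<Longrightarrow> x \<in> carrier M \<Longrightarrow> y \<in> carrier M
    \<Longrightarrow> a \<odot>\<^bsub>M\<^esub> (x \<oplus>\<^bsub>M\<^esub> y) = a \<odot>\<^bsub>M\<^esub> x \<oplus>\<^bsub>M\<^esub> a \<odot>\<^bsub>M\<^esub> y"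
  by (simp add: vs.smult_r vs_iff)
lemma vs_smult_assoc: "is_vs M \<Longrightarrow> x \<in> carrier M \<Longrightarrow> a \<odot>\<^bsub>M\<^esub> (b \<odot>\<^bsub>M\<^esub> x) = (a * b) \<odot>\<^bsub>M\<^esub> x"
  by (simp add: vs.smult_assoc vs_iff)
lemma vs_smult_one: "is_vs M \<Longrightarrow> x \<in> carrier M \<Longrightarrow> 1 \<odot>\<^bsub>M\<^esub> x = x"
  by (simp add: vs.smult_1 vs_iff)
lemma vs_smult_0: "is_vs M \<Longrightarrow> x \<in> carrier M \<Longrightarrow> 0 \<odot>\<^bsub>M\<^esub> x = \<zero>\<^bsub>M\<^esub>"
  by (simp add: vs.smult_0 vs_iff)
lemma vs_smult_zero: "is_vs M \<Longrightarrow> a \<odot>\<^bsub>M\<^esub> \<zero>\<^bsub>M\<^esub> = \<zero>\<^bsub>M\<^esub>"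
  by (simp add: vs.smult_zero vs_iff)
lemma vs_r_neg: "is_vs M \<Longrightarrow> x \<in> carrier M \<Longrightarrow> x \<oplus>\<^bsub>M\<^esub> (-1) \<odot>\<^bsub>M\<^esub> x = \<zero>\<^bsub>M\<^esub>"
  by (metis add.right_inverse vs_smult_0 vs_smult_l vs_smult_one)
lemma vs_l_neg: "is_vs M \<Longrightarrow> x \<in> carrier M \<Longrightarrow> (-1) \<odot>\<^bsub>M\<^esub> x \<oplus>\<^bsub>M\<^esub> x = \<zero>\<^bsub>M\<^esub>"
  by (simp add: vs_r_neg vs_add_comm vs_smult_closed)
lemma vs_abelian_monoid: "is_vs M \<Longrightarrow> abelian_monoid M"
  by (simp add: module_def abelian_group_def)

lemmas vs_closed = vs_add_closed vs_zero_closed vs_smult_closed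
lemmas vs_simps = vs_closed vs_l_zero vs_r_zero vs_smult_one vs_smult_0 vs_smult_zero
  vs_smult_assoc vs_r_neg vs_l_neg

lemma vs_uminus: "is_vs M \<Longrightarrow> x \<in> carrier M \<Longrightarrow> \<ominus>\<^bsub>M\<^esub> x = (-1) \<odot>\<^bsub>M\<^esub> x"
  by (simp add: vs.smult_m1 vs_iff)

text \<open>Differences are always written with the scalar \<open>-1\<close>, so that linear maps
  pass through them by additivity and homogeneity alone; this rule moves a term across an
  equation.\<close>

lemma vs_add_eq_iff: "is_vs M \<Longrightarrow> x \<in> carrier M \<Longrightarrow> y \<in> carrier M \<Longrightarrow> z \<in> carrier M
    \<Longrightarrow> x = z \<oplus>\<^bsub>M\<^esub> y \<longleftrightarrow> x \<oplus>\<^bsub>M\<^esub> (-1) \<odot>\<^bsub>M\<^esub> y = z"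
  by (metis vs_add_assoc vs_l_neg vs_r_neg vs_r_zero vs_smult_closed)

lemma vs_diff_eq_zero: "is_vs M \<Longrightarrow> x \<in> carrier M \<Longrightarrow> y \<in> carrier M
    \<Longrightarrow> x \<oplus>\<^bsub>M\<^esub> (-1) \<odot>\<^bsub>M\<^esub> y = \<zero>\<^bsub>M\<^esub> \<longleftrightarrow> x = y"
  using vs_add_eq_iff[of M x y "\<zero>\<^bsub>M\<^esub>"] by (simp add: vs_simps)

lemma is_vsI:
  fixes M :: "('k::field_char_0, 'v) module"
  assumes "\<And>x y. x \<in> carrier M \<Longrightarrow> y \<in> carrier M \<Longrightarrow> x \<oplus>\<^bsub>M\<^esub> y \<in> carrier M"
    and "\<zero>\<^bsub>M\<^esub> \<in> carrier M"
    and "\<And>a x. x \<in> carrier M \<Longrightarrow> a \<odot>\<^bsub>M\<^esub> x \<in> carrier M"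
    and "\<And>x y z. x \<in> carrier M \<Longrightarrow> y \<in> carrier M \<Longrightarrow> z \<in> carrier M
      \<Longrightarrow> (x \<oplus>\<^bsub>M\<^esub> y) \<oplus>\<^bsub>M\<^esub> z = x \<oplus>\<^bsub>M\<^esub> (y \<oplus>\<^bsub>M\<^esub> z)"
    and "\<And>x y. x \<in> carrier M \<Longrightarrow> y \<in> carrier M \<Longrightarrow> x \<oplus>\<^bsub>M\<^esub> y = y \<oplus>\<^bsub>M\<^esub> x"
    and "\<And>x. x \<in> carrier M \<Longrightarrow> \<zero>\<^bsub>M\<^esub> \<oplus>\<^bsub>M\<^esub> x = x"
    and "\<And>x. x \<in> carrier M \<Longrightarrow> (-1) \<odot>\<^bsub>M\<^esub> x \<oplus>\<^bsub>M\<^esub> x = \<zero>\<^bsub>M\<^esub>"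
    and "\<And>a b x. x \<in> carrier M \<Longrightarrow> (a + b) \<odot>\<^bsub>M\<^esub> x = a \<odot>\<^bsub>M\<^esub> x \<oplus>\<^bsub>M\<^esub> b \<odot>\<^bsub>M\<^esub> x"
    and "\<And>a x y. x \<in> carrier M \<Longrightarrow> y \<in> carrier M
      \<Longrightarrow> a \<odot>\<^bsub>M\<^esub> (x \<oplus>\<^bsub>M\<^esub> y) = a \<odot>\<^bsub>M\<^esub> x \<oplus>\<^bsub>M\<^esub> a \<odot>\<^bsub>M\<^esub> y"
    and "\<And>a b x. x \<in> carrier M \<Longrightarrow> (a * b) \<odot>\<^bsub>M\<^esub> x = a \<odot>\<^bsub>M\<^esub> (b \<odot>\<^bsub>M\<^esub> x)"
    and "\<And>x. x \<in> carrier M \<Longrightarrow> 1 \<odot>\<^bsub>M\<^esub> x = x"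
  shows "is_vs M"
  by (intro moduleI abelian_groupI cring_from_type_algebra) (auto intro: assms)

text \<open>The axioms are equations, hence they pass to the image of a map compatible with the
  operations. Applied to the projection onto a quotient.\<close>

lemma is_vs_image:
  fixes M :: "('k::field_char_0, 'v) module" and N :: "('k, 'w) module"
  assumes M: "is_vs M" and c: "carrier N = h ` carrier M"
    and add: "\<And>x y. x \<in> carrier M \<Longrightarrow> y \<in> carrier M \<Longrightarrow> h x \<oplus>\<^bsub>N\<^esub> h y = h (x \<oplus>\<^bsub>M\<^esub> y)"
    and sm: "\<And>a x. x \<in> carrier M \<Longrightarrow> a \<odot>\<^bsub>N\<^esub> h x = h (a \<odot>\<^bsub>M\<^esub> x)"
    and z: "\<zero>\<^bsub>N\<^esub> = h \<zero>\<^bsub>M\<^esub>"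
  shows "is_vs N"
  by (rule is_vsI) (auto simp: c add sm z vs_simps[OF M] vs_add_assoc[OF M] vs_smult_l[OF M]
      vs_smult_r[OF M], metis vs_add_comm[OF M])

text \<open>Closure under negatives does not appear on the right because it is multiplication by
  \<open>-1\<close>.\<close>

lemma submodule_iff:
  assumes "is_vs (M :: ('k::field_char_0, 'v) module)"
  shows "submodule H ring_of_type_algebra M \<longleftrightarrow> H \<subseteq> carrier M \<and> \<zero>\<^bsub>M\<^esub> \<in> H \<and>
    (\<forall>x\<in>H. \<forall>y\<in>H. x \<oplus>\<^bsub>M\<^esub> y \<in> H) \<and> (\<forall>a. \<forall>x\<in>H. a \<odot>\<^bsub>M\<^esub> x \<in> H)"
proof
  assume s: "submodule H ring_of_type_algebra M"
  have "\<zero>\<^bsub>M\<^esub> \<in> H"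
    using s unfolding submodule_def by (metis subgroup.one_closed monoid.simps(2))
  then show "H \<subseteq> carrier M \<and> \<zero>\<^bsub>M\<^esub> \<in> H \<and>
    (\<forall>x\<in>H. \<forall>y\<in>H. x \<oplus>\<^bsub>M\<^esub> y \<in> H) \<and> (\<forall>a. \<forall>x\<in>H. a \<odot>\<^bsub>M\<^esub> x \<in> H)"
    using module.submoduleE[OF assms s] by auto
next
  assume a: "H \<subseteq> carrier M \<and> \<zero>\<^bsub>M\<^esub> \<in> H \<and>
    (\<forall>x\<in>H. \<forall>y\<in>H. x \<oplus>\<^bsub>M\<^esub> y \<in> H) \<and> (\<forall>a. \<forall>x\<in>H. a \<odot>\<^bsub>M\<^esub> x \<in> H)"
  show "submodule H ring_of_type_algebra M"
    by (rule module.submoduleI[OF assms]) (use a vs_uminus[OF assms] in auto)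
qed

lemma submodule_is_vs:
  "is_vs M \<Longrightarrow> submodule H ring_of_type_algebra M \<Longrightarrow> is_vs (M\<lparr>carrier := H\<rparr>)"
  by (rule submodule.submodule_is_module)

lemma a_r_coset_eq: "H +>\<^bsub>M\<^esub> x = (\<lambda>h. h \<oplus>\<^bsub>M\<^esub> x) ` H"
  by (auto simp: a_r_coset_def')

lemma coset_eq_iff:
  assumes M: "is_vs (M :: ('k::field_char_0, 'v) module)" and H: "submodule H ring_of_type_algebra M"
    and x: "x \<in> carrier M" and y: "y \<in> carrier M"
  shows "H +>\<^bsub>M\<^esub> x = H +>\<^bsub>M\<^esub> y \<longleftrightarrow> x \<oplus>\<^bsub>M\<^esub> (-1) \<odot>\<^bsub>M\<^esub> y \<in> H"
proof -
  have sub: "H \<subseteq> carrier M" "\<zero>\<^bsub>M\<^esub> \<in> H" "\<And>u v. u \<in> H \<Longrightarrow> v \<in> H \<Longrightarrow> u \<oplus>\<^bsub>M\<^esub> v \<in> H"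
    "\<And>a u. u \<in> H \<Longrightarrow> a \<odot>\<^bsub>M\<^esub> u \<in> H"
    using H by (auto simp: submodule_iff[OF M])
  show ?thesis
  proof
    assume "H +>\<^bsub>M\<^esub> x = H +>\<^bsub>M\<^esub> y"
    moreover have "x \<in> H +>\<^bsub>M\<^esub> x"
      using x sub by (auto simp: a_r_coset_eq image_iff vs_l_zero[OF M] intro!: bexI[of _ "\<zero>\<^bsub>M\<^esub>"])
    ultimately obtain h where "h \<in> H" "x = h \<oplus>\<^bsub>M\<^esub> y"
      by (auto simp: a_r_coset_eq)
    then show "x \<oplus>\<^bsub>M\<^esub> (-1) \<odot>\<^bsub>M\<^esub> y \<in> H"
      using sub x y vs_add_eq_iff[OF M, of x y h] by auto
  next
    have *: "H +>\<^bsub>M\<^esub> u \<subseteq> H +>\<^bsub>M\<^esub> v" if "u \<in> carrier M" "v \<in> carrier M" "h \<in> H" "u = h \<oplus>\<^bsub>M\<^esub> v" for u v h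
      using that sub by (auto simp: a_r_coset_eq image_iff vs_add_assoc[OF M, symmetric] subset_iff)
    assume a: "x \<oplus>\<^bsub>M\<^esub> (-1) \<odot>\<^bsub>M\<^esub> y \<in> H" (is "?h \<in> H")
    have 1: "x = ?h \<oplus>\<^bsub>M\<^esub> y"
      using x y vs_add_eq_iff[OF M, of x y ?h] by (simp add: vs_simps[OF M])
    have "(-1) \<odot>\<^bsub>M\<^esub> ?h \<oplus>\<^bsub>M\<^esub> x = (-1) \<odot>\<^bsub>M\<^esub> ?h \<oplus>\<^bsub>M\<^esub> (?h \<oplus>\<^bsub>M\<^esub> y)"
      using 1 by simp
    also have "\<dots> = y"
      using x y by (subst vs_add_assoc[OF M, symmetric]) (auto simp: vs_simps[OF M] simp del: vs_smult_assoc)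
    finally have 2: "y = (-1) \<odot>\<^bsub>M\<^esub> ?h \<oplus>\<^bsub>M\<^esub> x" by simp
    show "H +>\<^bsub>M\<^esub> x = H +>\<^bsub>M\<^esub> y"
      using *[OF x y a 1] *[OF y x sub(4)[OF a] 2] by auto
  qed
qed

section \<open>Linear maps, finite sums and spans\<close>

lemma linear_onD:
  assumes "linear_on M N f"
  shows "x \<in> carrier M \<Longrightarrow> f x \<in> carrier N"
    and "x \<in> carrier M \<Longrightarrow> y \<in> carrier M \<Longrightarrow> f (x \<oplus>\<^bsub>M\<^esub> y) = f x \<oplus>\<^bsub>N\<^esub> f y"
    and "x \<in> carrier M \<Longrightarrow> f (a \<odot>\<^bsub>M\<^esub> x) = a \<odot>\<^bsub>N\<^esub> f x"
  using assms by (auto simp: linear_on_def)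

lemma linear_on_zero:
  assumes "is_vs M" "is_vs N" "linear_on M N f"
  shows "f \<zero>\<^bsub>M\<^esub> = \<zero>\<^bsub>N\<^esub>"
  using linear_onD(3)[OF assms(3), of "\<zero>\<^bsub>M\<^esub>" 0] linear_onD(1)[OF assms(3), of "\<zero>\<^bsub>M\<^esub>"]
  by (simp add: vs_simps assms)

lemma linear_on_comp:
  "linear_on M N f \<Longrightarrow> linear_on N K g \<Longrightarrow> linear_on M K (\<lambda>x. g (f x))"
  by (auto simp: linear_on_def)

lemma linear_on_id: "linear_on M M (\<lambda>x. x)"
  by (auto simp: linear_on_def)

lemma linear_on_cong:
  assumes "is_vs M" "linear_on M N f" "\<And>x. x \<in> carrier M \<Longrightarrow> f x = g x"
  shows "linear_on M N g"
  using assms by (auto simp: linear_on_def vs_simps)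

lemma linear_on_add:
  assumes "is_vs N" "linear_on M N f" "linear_on M N g"
  shows "linear_on M N (\<lambda>x. f x \<oplus>\<^bsub>N\<^esub> g x)"
proof -
  have "(p \<oplus>\<^bsub>N\<^esub> q) \<oplus>\<^bsub>N\<^esub> (r \<oplus>\<^bsub>N\<^esub> s) = (p \<oplus>\<^bsub>N\<^esub> r) \<oplus>\<^bsub>N\<^esub> (q \<oplus>\<^bsub>N\<^esub> s)"
    if "p \<in> carrier N" "q \<in> carrier N" "r \<in> carrier N" "s \<in> carrier N" for p q r s
    using abelian_monoid.a_ac[OF vs_abelian_monoid[OF assms(1)]] that
    by (simp add: vs_simps assms(1))
  then show ?thesis
    using assms(2,3) by (auto simp: linear_on_def vs_simps assms(1) vs_smult_r)
qed

lemma linear_on_smult: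
  assumes "is_vs N" "linear_on M N f"
  shows "linear_on M N (\<lambda>x. a \<odot>\<^bsub>N\<^esub> f x)"
  using assms(2) by (auto simp: linear_on_def vs_simps assms(1) vs_smult_r mult.commute)

lemma linear_on_finsum:
  assumes M: "is_vs M" and N: "is_vs N" and f: "linear_on M N f"
    and g: "\<And>i. i \<in> A \<Longrightarrow> g i \<in> carrier M"
  shows "f (\<Oplus>\<^bsub>M\<^esub>i\<in>A. g i) = (\<Oplus>\<^bsub>N\<^esub>i\<in>A. f (g i))"
proof (cases "finite A")
  case True
  interpret M: abelian_monoid M by (rule vs_abelian_monoid[OF M])
  interpret N: abelian_monoid N by (rule vs_abelian_monoid[OF N])
  show ?thesis
    using True g
  proof (induction A rule: finite_induct)
    case empty
    then show ?case using linear_on_zero[OF M N f] by simp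
  next
    case (insert x F)
    then show ?case
      using linear_onD[OF f] by (simp add: Pi_def)
  qed
next
  \<comment> \<open>A sum over an infinite index set is zero by convention, and linear maps preserve
    zero.\<close>
  case False
  interpret M: abelian_monoid M by (rule vs_abelian_monoid[OF M])
  interpret N: abelian_monoid N by (rule vs_abelian_monoid[OF N])
  show ?thesis using False linear_on_zero[OF M N f] by simp
qed

lemmas (in abelian_monoid) finsum_mono_neutral_cong_left = add.finprod_mono_neutral_cong_left
lemmas (in abelian_monoid) finsum_UN_disjoint = add.finprod_UN_disjoint

lemma vs_finsum_insert:
  "is_vs M \<Longrightarrow> finite A \<Longrightarrow> a \<notin> A \<Longrightarrow> (\<And>i. i \<in> insert a A \<Longrightarrow> g i \<in> carrier M)
    \<Longrightarrow> (\<Oplus>\<^bsub>M\<^esub>i\<in>insert a A. g i) = g a \<oplus>\<^bsub>M\<^esub> (\<Oplus>\<^bsub>M\<^esub>i\<in>A. g i)"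
  by (rule abelian_monoid.finsum_insert[OF vs_abelian_monoid]) auto

lemma vs_finsum_empty: "is_vs M \<Longrightarrow> (\<Oplus>\<^bsub>M\<^esub>i\<in>{}. g i) = \<zero>\<^bsub>M\<^esub>"
  by (rule abelian_monoid.finsum_empty[OF vs_abelian_monoid])

lemma vs_finsum_singleton: "is_vs M \<Longrightarrow> g a \<in> carrier M \<Longrightarrow> (\<Oplus>\<^bsub>M\<^esub>i\<in>{a}. g i) = g a"
  using vs_finsum_insert[of M "{}" a g] vs_finsum_empty[of M g] by (simp add: vs_simps)

lemma vs_finsum_closed:
  "is_vs M \<Longrightarrow> (\<And>i. i \<in> A \<Longrightarrow> g i \<in> carrier M) \<Longrightarrow> (\<Oplus>\<^bsub>M\<^esub>i\<in>A. g i) \<in> carrier M"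
  by (rule abelian_monoid.finsum_closed[OF vs_abelian_monoid]) auto

lemma vs_finsum_cong:
  "is_vs M \<Longrightarrow> A = B \<Longrightarrow> (\<And>i. i \<in> B \<Longrightarrow> g i \<in> carrier M) \<Longrightarrow> (\<And>i. i \<in> B \<Longrightarrow> f i = g i)
    \<Longrightarrow> (\<Oplus>\<^bsub>M\<^esub>i\<in>A. f i) = (\<Oplus>\<^bsub>M\<^esub>i\<in>B. g i)"
  by (rule abelian_monoid.finsum_cong'[OF vs_abelian_monoid]) auto

lemma linear_on_finsum_fun:
  assumes M: "is_vs M" and N: "is_vs N" and f: "\<And>i. i \<in> A \<Longrightarrow> linear_on M N (f i)"
  shows "linear_on M N (\<lambda>x. \<Oplus>\<^bsub>N\<^esub>i\<in>A. f i x)"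
proof (cases "finite A")
  case True
  then show ?thesis using f
  proof (induction A rule: finite_induct)
    case empty
    then show ?case
      using N by (simp add: linear_on_def abelian_monoid.finsum_empty[OF vs_abelian_monoid[OF N]] vs_simps)
  next
    case (insert a A)
    have "linear_on M N (\<lambda>x. f a x \<oplus>\<^bsub>N\<^esub> (\<Oplus>\<^bsub>N\<^esub>i\<in>A. f i x))"
      using insert by (intro linear_on_add N) auto
    then show ?case
      using insert linear_onD(1)[OF insert(4)]
      by (elim linear_on_cong[OF M])
        (simp add: abelian_monoid.finsum_insert[OF vs_abelian_monoid[OF N]] Pi_def)
  qed
next
  case False
  then show ?thesis
    using N by (simp add: linear_on_def abelian_monoid.finsum_infinite[OF vs_abelian_monoid[OF N]] vs_simps)
qed

text \<open>An intersection of submodules is one only if the family is non-empty;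
  \<open>G \<subseteq> carrier M\<close> puts the whole space into it.\<close>

lemma vspan_submodule:
  assumes M: "is_vs M" and G: "G \<subseteq> carrier M"
  shows "submodule (vspan M G) ring_of_type_algebra M"
proof -
  have "\<exists>H. submodule H ring_of_type_algebra M \<and> G \<subseteq> H"
    using G module.carrier_is_submodule[OF M] by blast
  then show ?thesis
    unfolding vspan_def hull_def by (auto simp: submodule_iff[OF M])
qed

lemma vspan_subset:
  "is_vs M \<Longrightarrow> submodule H ring_of_type_algebra M \<Longrightarrow> G \<subseteq> H \<Longrightarrow> vspan M G \<subseteq> H"
  unfolding vspan_def by (rule hull_minimal)

lemma vspan_inc: "x \<in> G \<Longrightarrow> x \<in> vspan M G"
  unfolding vspan_def by (rule hull_inc)

lemma linear_eq_submodule: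
  assumes M: "is_vs M" and N: "is_vs N" and f: "linear_on M N f" and g: "linear_on M N g"
  shows "submodule {x \<in> carrier M. f x = g x} ring_of_type_algebra M"
  using linear_onD[OF f] linear_onD[OF g] linear_on_zero[OF M N f] linear_on_zero[OF M N g]
  by (auto simp: submodule_iff[OF M] vs_simps M)

lemma linear_preimage_submodule:
  assumes M: "is_vs M" and N: "is_vs N" and f: "linear_on M N f"
    and H: "submodule H ring_of_type_algebra N"
  shows "submodule {x \<in> carrier M. f x \<in> H} ring_of_type_algebra M"
  using linear_onD[OF f] linear_on_zero[OF M N f] H
  by (auto simp: submodule_iff[OF M] submodule_iff[OF N] vs_simps M)

lemma linear_image_submodule:
  assumes M: "is_vs M" and N: "is_vs N" and f: "linear_on M N f"
    and H: "submodule H ring_of_type_algebra M"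
  shows "submodule (f ` H) ring_of_type_algebra N"
proof -
  have H': "H \<subseteq> carrier M" "\<zero>\<^bsub>M\<^esub> \<in> H" "\<And>u v. u \<in> H \<Longrightarrow> v \<in> H \<Longrightarrow> u \<oplus>\<^bsub>M\<^esub> v \<in> H"
    "\<And>a u. u \<in> H \<Longrightarrow> a \<odot>\<^bsub>M\<^esub> u \<in> H"
    using H by (auto simp: submodule_iff[OF M])
  have "f u \<oplus>\<^bsub>N\<^esub> f v \<in> f ` H" if "u \<in> H" "v \<in> H" for u v
    using that H' linear_onD(2)[OF f, of u v] by (metis imageI subsetD)
  moreover have "a \<odot>\<^bsub>N\<^esub> f u \<in> f ` H" if "u \<in> H" for a u
    using that H' linear_onD(3)[OF f, of u a] by (metis imageI subsetD)
  ultimately show ?thesis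
    using linear_onD(1)[OF f] linear_on_zero[OF M N f, symmetric] H'
    by (auto simp: submodule_iff[OF N])
qed

section \<open>Quotients\<close>

lemma quot_simps:
  assumes M: "is_vs (M :: ('k::field_char_0, 'v) module)" and H: "submodule H ring_of_type_algebra M"
  shows "carrier (quot_module M H) = (\<lambda>x. H +>\<^bsub>M\<^esub> x) ` carrier M"
    and "x \<in> carrier M \<Longrightarrow> y \<in> carrier M \<Longrightarrow>
      (H +>\<^bsub>M\<^esub> x) \<oplus>\<^bsub>quot_module M H\<^esub> (H +>\<^bsub>M\<^esub> y) = H +>\<^bsub>M\<^esub> (x \<oplus>\<^bsub>M\<^esub> y)"
    and "x \<in> carrier M \<Longrightarrow> a \<odot>\<^bsub>quot_module M H\<^esub> (H +>\<^bsub>M\<^esub> x) = H +>\<^bsub>M\<^esub> (a \<odot>\<^bsub>M\<^esub> x)"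
    and "\<zero>\<^bsub>quot_module M H\<^esub> = H +>\<^bsub>M\<^esub> \<zero>\<^bsub>M\<^esub>"
proof -
  have sub: "H \<subseteq> carrier M" "\<zero>\<^bsub>M\<^esub> \<in> H" "\<And>u v. u \<in> H \<Longrightarrow> v \<in> H \<Longrightarrow> u \<oplus>\<^bsub>M\<^esub> v \<in> H"
    "\<And>a u. u \<in> H \<Longrightarrow> a \<odot>\<^bsub>M\<^esub> u \<in> H"
    using H by (auto simp: submodule_iff[OF M])
  show "carrier (quot_module M H) = (\<lambda>x. H +>\<^bsub>M\<^esub> x) ` carrier M"
    by (auto simp: quot_module_def A_RCOSETS_def' a_r_coset_def')
  show "\<zero>\<^bsub>quot_module M H\<^esub> = H +>\<^bsub>M\<^esub> \<zero>\<^bsub>M\<^esub>"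
    using sub by (force simp: quot_module_def a_r_coset_eq vs_r_zero[OF M] image_iff)
  interpret abelian_subgroup H M
    using H by (intro abelian_subgroupI3 vs_abelian_group[OF M])
      (auto simp: submodule_def additive_subgroup_def)
  show "x \<in> carrier M \<Longrightarrow> y \<in> carrier M \<Longrightarrow>
      (H +>\<^bsub>M\<^esub> x) \<oplus>\<^bsub>quot_module M H\<^esub> (H +>\<^bsub>M\<^esub> y) = H +>\<^bsub>M\<^esub> (x \<oplus>\<^bsub>M\<^esub> y)"
    by (simp add: quot_module_def a_rcos_sum)
  assume x: "x \<in> carrier M"
  \<comment> \<open>The quotient's scalar multiplication is a union over representatives. All its
    members are the same coset, because they differ by \<open>a h\<close>, an element of
    \<open>H\<close>.\<close>
  have "H +>\<^bsub>M\<^esub> (a \<odot>\<^bsub>M\<^esub> (h \<oplus>\<^bsub>M\<^esub> x)) = H +>\<^bsub>M\<^esub> (a \<odot>\<^bsub>M\<^esub> x)" if "h \<in> H" for h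
  proof -
    have h: "h \<in> carrier M" using that sub by auto
    have "a \<odot>\<^bsub>M\<^esub> (h \<oplus>\<^bsub>M\<^esub> x) = a \<odot>\<^bsub>M\<^esub> h \<oplus>\<^bsub>M\<^esub> a \<odot>\<^bsub>M\<^esub> x"
      using h x by (simp add: vs_smult_r[OF M])
    then have "a \<odot>\<^bsub>M\<^esub> (h \<oplus>\<^bsub>M\<^esub> x) \<oplus>\<^bsub>M\<^esub> (-1) \<odot>\<^bsub>M\<^esub> (a \<odot>\<^bsub>M\<^esub> x) = a \<odot>\<^bsub>M\<^esub> h"
      using h x vs_add_eq_iff[OF M] vs_closed[OF M] by metis
    then show ?thesis
      using h x that sub by (subst coset_eq_iff[OF M H]) (auto simp: vs_closed[OF M])
  qed
  then have "(\<Union>h\<in>H. H +>\<^bsub>M\<^esub> (a \<odot>\<^bsub>M\<^esub> (h \<oplus>\<^bsub>M\<^esub> x))) = (\<Union>h\<in>H. H +>\<^bsub>M\<^esub> (a \<odot>\<^bsub>M\<^esub> x))"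
    by simp
  also have "\<dots> = H +>\<^bsub>M\<^esub> (a \<odot>\<^bsub>M\<^esub> x)" using sub(2) by blast
  finally show "a \<odot>\<^bsub>quot_module M H\<^esub> (H +>\<^bsub>M\<^esub> x) = H +>\<^bsub>M\<^esub> (a \<odot>\<^bsub>M\<^esub> x)"
    by (simp add: quot_module_def a_r_coset_eq[of M H x])
qed

lemma quot_is_vs:
  assumes "is_vs M" "submodule H ring_of_type_algebra M"
  shows "is_vs (quot_module M H)"
  by (rule is_vs_image[OF assms(1), where h = "\<lambda>x. H +>\<^bsub>M\<^esub> x"]) (auto simp: quot_simps[OF assms])

lemma quot_linear:
  assumes "is_vs M" "submodule H ring_of_type_algebra M"
  shows "linear_on M (quot_module M H) (\<lambda>x. H +>\<^bsub>M\<^esub> x)"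
  by (auto simp: linear_on_def quot_simps[OF assms])

lemma coset_zero_iff:
  assumes "is_vs (M :: ('k::field_char_0, 'v) module)" "submodule H ring_of_type_algebra M"
    and "x \<in> carrier M"
  shows "H +>\<^bsub>M\<^esub> x = \<zero>\<^bsub>quot_module M H\<^esub> \<longleftrightarrow> x \<in> H"
  using coset_eq_iff[OF assms(1,2,3), of "\<zero>\<^bsub>M\<^esub>"] assms
  by (simp add: quot_simps[OF assms(1,2)] vs_simps)

lemma coset_mem:
  assumes "is_vs (M :: ('k::field_char_0, 'v) module)" "submodule H ring_of_type_algebra M"
    and "x \<in> carrier M" "y \<in> H +>\<^bsub>M\<^esub> x"
  shows "y \<in> carrier M" "H +>\<^bsub>M\<^esub> y = H +>\<^bsub>M\<^esub> x"
proof -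
  obtain h where h: "h \<in> H" "y = h \<oplus>\<^bsub>M\<^esub> x" using assms(4) by (auto simp: a_r_coset_eq)
  have H: "H \<subseteq> carrier M" using assms(2) by (auto simp: submodule_iff[OF assms(1)])
  then show "y \<in> carrier M" using h assms(1,3) by (auto simp: vs_closed)
  then show "H +>\<^bsub>M\<^esub> y = H +>\<^bsub>M\<^esub> x"
    using h H assms(3) coset_eq_iff[OF assms(1,2)] vs_add_eq_iff[OF assms(1), of y x h] by auto
qed

section \<open>Free modules and presentations\<close>

lemma free_simps [simp]:
  "carrier (free_module Z) = {c. Poly_Mapping.keys c \<subseteq> Z}"
  "c \<oplus>\<^bsub>free_module Z\<^esub> d = c + d" "\<zero>\<^bsub>free_module Z\<^esub> = 0"
  "a \<odot>\<^bsub>free_module Z\<^esub> c = Poly_Mapping.map ((*) a) c"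
  by (simp_all add: free_module_def)

lemma lookup_scale [simp]: "Poly_Mapping.lookup (Poly_Mapping.map ((*) a) c) x
    = (a :: 'k::field_char_0) * Poly_Mapping.lookup c x"
  by (cases "Poly_Mapping.lookup c x = 0") (auto simp: Poly_Mapping.map.rep_eq when_def)

lemma keys_scale: "Poly_Mapping.keys (Poly_Mapping.map ((*) (a :: 'k::field_char_0)) c)
    \<subseteq> Poly_Mapping.keys c"
  by (auto simp: in_keys_iff)

lemma free_is_vs: "is_vs (free_module Z :: ('k::field_char_0, _) module)"
proof (rule is_vsI)
  show "a \<odot>\<^bsub>free_module Z\<^esub> x \<in> carrier (free_module Z)"
    if "x \<in> carrier (free_module Z)" for a :: 'k and x
    using that keys_scale[of a x] by auto
qed (auto simp: algebra_simps poly_mapping_eq_iff fun_eq_iff lookup_add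
    dest!: subsetD[OF Poly_Mapping.keys_add])

text \<open>The linear map on the free module that \<open>ext_gen\<close> evaluates at a chosen
  representative of a class.\<close>

definition lin_ext :: "('k::field_char_0, 'z) module \<Rightarrow> ('x \<Rightarrow> 'z) \<Rightarrow> ('x \<Rightarrow>\<^sub>0 'k) \<Rightarrow> 'z" where
  "lin_ext N \<phi> c = (\<Oplus>\<^bsub>N\<^esub>x\<in>Poly_Mapping.keys c. Poly_Mapping.lookup c x \<odot>\<^bsub>N\<^esub> \<phi> x)"

text \<open>Enlarging the index set only adds zero terms; this brings two elements with different
  supports over a common index set.\<close>

lemma lin_ext_superset:
  assumes N: "is_vs N" and \<phi>: "\<And>x. x \<in> A \<Longrightarrow> \<phi> x \<in> carrier N"
    and A: "finite A" "Poly_Mapping.keys c \<subseteq> A"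
  shows "lin_ext N \<phi> c = (\<Oplus>\<^bsub>N\<^esub>x\<in>A. Poly_Mapping.lookup c x \<odot>\<^bsub>N\<^esub> \<phi> x)"
  unfolding lin_ext_def
proof (rule abelian_monoid.finsum_mono_neutral_cong_left[OF vs_abelian_monoid[OF N]])
  show "finite A" "Poly_Mapping.keys c \<subseteq> A" by fact+
  show "Poly_Mapping.lookup c i \<odot>\<^bsub>N\<^esub> \<phi> i = \<zero>\<^bsub>N\<^esub>" if "i \<in> A - Poly_Mapping.keys c" for i
    using that \<phi>[of i] by (auto simp: in_keys_iff vs_simps[OF N])
qed (use \<phi> N in \<open>auto simp: vs_simps\<close>)

lemma lin_ext_linear:
  assumes N: "is_vs N" and \<phi>: "\<And>x. x \<in> Z \<Longrightarrow> \<phi> x \<in> carrier N"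
  shows "linear_on (free_module Z) N (lin_ext N \<phi>)"
proof -
  interpret N: abelian_monoid N by (rule vs_abelian_monoid[OF N])
  have "lin_ext N \<phi> c \<in> carrier N" if "Poly_Mapping.keys c \<subseteq> Z" for c
    unfolding lin_ext_def by (rule vs_finsum_closed[OF N]) (use that \<phi> N in \<open>auto simp: vs_simps\<close>)
  moreover have "lin_ext N \<phi> (c + d) = lin_ext N \<phi> c \<oplus>\<^bsub>N\<^esub> lin_ext N \<phi> d"
    if c: "Poly_Mapping.keys c \<subseteq> Z" "Poly_Mapping.keys d \<subseteq> Z" for c d
  proof -
    let ?A = "Poly_Mapping.keys c \<union> Poly_Mapping.keys d"
    have A: "\<And>x. x \<in> ?A \<Longrightarrow> \<phi> x \<in> carrier N" "finite ?A" using \<phi> c by auto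
    have "lin_ext N \<phi> (c + d) = (\<Oplus>\<^bsub>N\<^esub>x\<in>?A. Poly_Mapping.lookup (c + d) x \<odot>\<^bsub>N\<^esub> \<phi> x)"
      using Poly_Mapping.keys_add[of c d] by (intro lin_ext_superset[OF N] A)
    also have "\<dots> = (\<Oplus>\<^bsub>N\<^esub>x\<in>?A. Poly_Mapping.lookup c x \<odot>\<^bsub>N\<^esub> \<phi> x \<oplus>\<^bsub>N\<^esub> Poly_Mapping.lookup d x \<odot>\<^bsub>N\<^esub> \<phi> x)"
      by (rule vs_finsum_cong[OF N])
        (use A(1) in \<open>auto simp: lookup_add vs_smult_l[OF N] vs_simps[OF N]\<close>)
    also have "\<dots> = lin_ext N \<phi> c \<oplus>\<^bsub>N\<^esub> lin_ext N \<phi> d"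
      using lin_ext_superset[OF N A(1,2), where c = c] lin_ext_superset[OF N A(1,2), where c = d] A
      by (subst N.finsum_addf) (auto simp: vs_simps[OF N] Pi_def)
    finally show ?thesis .
  qed
  moreover have "lin_ext N \<phi> (Poly_Mapping.map ((*) a) c) = a \<odot>\<^bsub>N\<^esub> lin_ext N \<phi> c"
    if c: "Poly_Mapping.keys c \<subseteq> Z" for a c
  proof -
    let ?A = "Poly_Mapping.keys c"
    have A: "\<And>x. x \<in> ?A \<Longrightarrow> \<phi> x \<in> carrier N" "finite ?A" using \<phi> c by auto
    have "lin_ext N \<phi> (Poly_Mapping.map ((*) a) c)
        = (\<Oplus>\<^bsub>N\<^esub>x\<in>?A. Poly_Mapping.lookup (Poly_Mapping.map ((*) a) c) x \<odot>\<^bsub>N\<^esub> \<phi> x)"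
      using keys_scale by (intro lin_ext_superset[OF N] A)
    also have "\<dots> = (\<Oplus>\<^bsub>N\<^esub>x\<in>?A. a \<odot>\<^bsub>N\<^esub> (Poly_Mapping.lookup c x \<odot>\<^bsub>N\<^esub> \<phi> x))"
      by (rule vs_finsum_cong[OF N]) (use A(1) in \<open>auto simp: vs_simps[OF N]\<close>)
    also have "\<dots> = a \<odot>\<^bsub>N\<^esub> lin_ext N \<phi> c"
      unfolding lin_ext_def
      by (rule module.finsum_smult_ldistr[OF N, symmetric]) (use A in \<open>auto simp: vs_simps[OF N]\<close>)
    finally show ?thesis .
  qed
  ultimately show ?thesis
    unfolding linear_on_def by simp
qed

lemma lin_ext_single:
  assumes N: "is_vs N" and x: "\<phi> x \<in> carrier N"
  shows "lin_ext N \<phi> (Poly_Mapping.single x a) = a \<odot>\<^bsub>N\<^esub> \<phi> x"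
proof -
  have "lin_ext N \<phi> (Poly_Mapping.single x a)
      = (\<Oplus>\<^bsub>N\<^esub>y\<in>{x}. Poly_Mapping.lookup (Poly_Mapping.single x a) y \<odot>\<^bsub>N\<^esub> \<phi> y)"
    by (rule lin_ext_superset[OF N]) (use x in auto)
  also have "\<dots> = a \<odot>\<^bsub>N\<^esub> \<phi> x"
    using x by (simp add: vs_finsum_singleton[OF N] vs_simps[OF N])
  finally show ?thesis .
qed

lemma lin_ext_diff:
  assumes N: "is_vs N" and \<phi>: "\<And>x. x \<in> Z \<Longrightarrow> \<phi> x \<in> carrier N"
    and c: "Poly_Mapping.keys c \<subseteq> Z" and d: "Poly_Mapping.keys d \<subseteq> Z"
  shows "lin_ext N \<phi> (c - d) = lin_ext N \<phi> c \<oplus>\<^bsub>N\<^esub> (-1) \<odot>\<^bsub>N\<^esub> lin_ext N \<phi> d"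
proof -
  have e: "c - d = c + Poly_Mapping.map ((*) (-1)) d"
    by (simp add: poly_mapping_eq_iff fun_eq_iff lookup_add lookup_minus)
  have "Poly_Mapping.keys (Poly_Mapping.map ((*) (-1)) d) \<subseteq> Z" using keys_scale[of "-1" d] d by (rule order_trans)
  then show ?thesis
    using linear_onD(2)[OF lin_ext_linear[of N Z \<phi>, OF N \<phi>], of c "Poly_Mapping.map ((*) (-1)) d"]
      linear_onD(3)[OF lin_ext_linear[of N Z \<phi>, OF N \<phi>], of d "-1"] c d
    by (simp add: e)
qed

text \<open>Generators span: this identity is what turns agreement on generators into equality of
  linear maps.\<close>

lemma lin_ext_self:
  assumes "Poly_Mapping.keys c \<subseteq> Z"
  shows "lin_ext (free_module Z) (\<lambda>x. Poly_Mapping.single x 1) c = (c :: 'x \<Rightarrow>\<^sub>0 'k::field_char_0)"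
proof -
  let ?M = "free_module Z :: ('k, _) module"
  have "finite A \<Longrightarrow> A \<subseteq> Z \<Longrightarrow> (\<Oplus>\<^bsub>?M\<^esub>x\<in>A. Poly_Mapping.lookup c x \<odot>\<^bsub>?M\<^esub> Poly_Mapping.single x 1)
      = (\<Sum>x\<in>A. Poly_Mapping.single x (Poly_Mapping.lookup c x))" for A
  proof (induction A rule: finite_induct)
    case empty
    then show ?case
      using vs_finsum_empty[OF free_is_vs[of Z]] by simp
  next
    case (insert x F)
    have *: "Poly_Mapping.keys (Poly_Mapping.map ((*) a) (Poly_Mapping.single y (1::'k))) \<subseteq> Z"
      if "y \<in> Z" for y a
      using keys_scale[of a "Poly_Mapping.single y 1"] that by auto
    have "Poly_Mapping.map ((*) a) (Poly_Mapping.single x 1) = Poly_Mapping.single x a" for a :: 'k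
      by (simp add: poly_mapping_eq_iff fun_eq_iff lookup_single when_def)
    then show ?case
      using insert * by (subst vs_finsum_insert[OF free_is_vs[of Z]]) (auto simp: subset_iff)
  qed
  moreover have "(\<Sum>x\<in>Poly_Mapping.keys c. Poly_Mapping.single x (Poly_Mapping.lookup c x)) = c"
    by (rule poly_mapping_eqI) (simp add: lookup_sum lookup_single when_def in_keys_iff)
  ultimately show ?thesis
    unfolding lin_ext_def using assms by simp
qed

context
  fixes Z :: "'x set" and R :: "('x \<Rightarrow>\<^sub>0 'k::field_char_0) set"
  assumes R: "R \<subseteq> carrier (free_module Z)"
begin

lemma presented_is_vs: "is_vs (presented Z R)"
  unfolding presented_def by (intro quot_is_vs free_is_vs vspan_submodule R)

lemma gen_class_closed: "x \<in> Z \<Longrightarrow> gen_class Z R x \<in> carrier (presented Z R)"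
  unfolding presented_def gen_class_def
  by (subst quot_simps[OF free_is_vs vspan_submodule[OF free_is_vs R]]) auto

text \<open>Uniqueness in the universal property: the value of any linear map at \<open>C\<close> is
  a fixed combination of its values at the generators occurring in a representative of
  \<open>C\<close>.\<close>

lemma presented_eq:
  assumes N: "is_vs N" and f: "linear_on (presented Z R) N f" and g: "linear_on (presented Z R) N g"
    and eq: "\<And>x. x \<in> Z \<Longrightarrow> f (gen_class Z R x) = g (gen_class Z R x)"
    and C: "C \<in> carrier (presented Z R)"
  shows "f C = g C"
proof -
  let ?H = "vspan (free_module Z) R" let ?M = "free_module Z :: ('k, _) module"
  let ?cl = "\<lambda>c. ?H +>\<^bsub>?M\<^esub> c"
  note H = vspan_submodule[OF free_is_vs R]
  have cl: "linear_on ?M (presented Z R) ?cl"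
    unfolding presented_def by (rule quot_linear[OF free_is_vs H])
  obtain c where c: "Poly_Mapping.keys c \<subseteq> Z" "C = ?cl c"
    using C unfolding presented_def quot_simps[OF free_is_vs H] by auto
  have "h C = (\<Oplus>\<^bsub>N\<^esub>x\<in>Poly_Mapping.keys c. Poly_Mapping.lookup c x \<odot>\<^bsub>N\<^esub> h (gen_class Z R x))"
    if h: "linear_on (presented Z R) N h" for h
  proof -
    have l: "linear_on ?M N (\<lambda>c. h (?cl c))" by (rule linear_on_comp[OF cl h])
    have "h C = h (?cl (lin_ext ?M (\<lambda>x. Poly_Mapping.single x 1) c))"
      using lin_ext_self[OF c(1)] c(2) by simp
    also have "\<dots> = (\<Oplus>\<^bsub>N\<^esub>x\<in>Poly_Mapping.keys c. h (?cl (Poly_Mapping.lookup c x \<odot>\<^bsub>?M\<^esub> Poly_Mapping.single x 1)))"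
      unfolding lin_ext_def
      by (rule linear_on_finsum[OF free_is_vs N l], rule vs_smult_closed[OF free_is_vs]) (use c in auto)
    also have "\<dots> = (\<Oplus>\<^bsub>N\<^esub>x\<in>Poly_Mapping.keys c. Poly_Mapping.lookup c x \<odot>\<^bsub>N\<^esub> h (gen_class Z R x))"
    proof (rule vs_finsum_cong[OF N refl])
      fix x assume "x \<in> Poly_Mapping.keys c"
      then have x: "x \<in> Z" using c by auto
      show "Poly_Mapping.lookup c x \<odot>\<^bsub>N\<^esub> h (gen_class Z R x) \<in> carrier N"
        by (rule vs_smult_closed[OF N linear_onD(1)[OF h gen_class_closed[OF x]]])
      show "h (?cl (Poly_Mapping.lookup c x \<odot>\<^bsub>?M\<^esub> Poly_Mapping.single x 1))
          = Poly_Mapping.lookup c x \<odot>\<^bsub>N\<^esub> h (gen_class Z R x)"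
        unfolding gen_class_def by (rule linear_onD(3)[OF l]) (use x in simp)
    qed
    finally show ?thesis .
  qed
  from this[OF f] this[OF g] show ?thesis
    using c eq by (auto intro!: vs_finsum_cong[OF N]
        simp: vs_simps[OF N] linear_onD(1)[OF g gen_class_closed] subset_iff)
qed

text \<open>Existence in the universal property. A map that kills the relations kills their span, so
  the representative picked by \<open>ext_gen\<close> does not influence the value.\<close>

lemma ext_gen_props:
  assumes N: "is_vs N" and \<phi>: "\<And>x. x \<in> Z \<Longrightarrow> \<phi> x \<in> carrier N"
    and kill: "\<And>r. r \<in> R \<Longrightarrow> lin_ext N \<phi> r = \<zero>\<^bsub>N\<^esub>"
  shows "linear_on (presented Z R) N (ext_gen N \<phi>)"
    and "x \<in> Z \<Longrightarrow> ext_gen N \<phi> (gen_class Z R x) = \<phi> x"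
proof -
  let ?H = "vspan (free_module Z) R" let ?M = "free_module Z :: ('k, _) module"
  let ?cl = "\<lambda>c. ?H +>\<^bsub>?M\<^esub> c"
  note H = vspan_submodule[OF free_is_vs R]
  have l: "linear_on ?M N (lin_ext N \<phi>)" by (rule lin_ext_linear[OF N \<phi>])
  have z: "linear_on ?M N (\<lambda>_. \<zero>\<^bsub>N\<^esub>)" using N by (simp add: linear_on_def vs_simps)
  have "?H \<subseteq> {c \<in> carrier ?M. lin_ext N \<phi> c = \<zero>\<^bsub>N\<^esub>}"
    by (rule vspan_subset[OF free_is_vs linear_eq_submodule[OF free_is_vs N l z]])
      (use R kill in auto)
  then have k: "lin_ext N \<phi> c = \<zero>\<^bsub>N\<^esub>" if "c \<in> ?H" for c using that by auto
  have e: "ext_gen N \<phi> (?cl c) = lin_ext N \<phi> c" if c: "c \<in> carrier ?M" for c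
  proof -
    define d where "d = (SOME d. d \<in> ?cl c)"
    have "c \<in> ?cl c" using c H by (force simp: a_r_coset_eq submodule_iff[OF free_is_vs] image_iff)
    then have "d \<in> ?cl c" unfolding d_def by (rule someI)
    then obtain h where h: "h \<in> ?H" "d = h + c" by (auto simp: a_r_coset_eq)
    have "h \<in> carrier ?M" using H h by (auto simp: submodule_iff[OF free_is_vs])
    then have "lin_ext N \<phi> d = lin_ext N \<phi> h \<oplus>\<^bsub>N\<^esub> lin_ext N \<phi> c"
      using linear_onD(2)[OF l, of h c] c h by simp
    then show ?thesis
      using k[OF h(1)] linear_onD(1)[OF l c] N
      by (simp add: ext_gen_def Let_def d_def[symmetric] lin_ext_def[symmetric] vs_simps)
  qed
  show "ext_gen N \<phi> (gen_class Z R x) = \<phi> x" if "x \<in> Z"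
    using e[of "Poly_Mapping.single x 1"] that lin_ext_single[of N \<phi> x 1, OF N \<phi>[OF that]] \<phi>[OF that] N
    by (simp add: gen_class_def vs_simps)
  have vM: "is_vs ?M" by (rule free_is_vs)
  show "linear_on (presented Z R) N (ext_gen N \<phi>)"
    unfolding linear_on_def presented_def quot_simps(1)[OF free_is_vs H]
    using quot_simps(2,3)[OF free_is_vs H] e linear_onD[OF l] vs_closed[OF vM]
    by (auto simp del: free_simps)
qed

text \<open>The source of every identity that holds by construction: bilinearity of
  \<open>tens\<close> and the symmetry of \<open>sym_class\<close> are read off from it.\<close>

lemma gen_class_relation:
  assumes "r \<in> R"
  shows "lin_ext (presented Z R) (gen_class Z R) r = \<zero>\<^bsub>presented Z R\<^esub>"
proof -
  let ?H = "vspan (free_module Z) R" let ?M = "free_module Z :: ('k, _) module"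
  let ?cl = "\<lambda>c. ?H +>\<^bsub>?M\<^esub> c"
  note H = vspan_submodule[OF free_is_vs R]
  have cl: "linear_on ?M (presented Z R) ?cl"
    unfolding presented_def by (rule quot_linear[OF free_is_vs H])
  have r: "r \<in> carrier ?M" using R assms by auto
  have "lin_ext (presented Z R) (gen_class Z R) r = ?cl (lin_ext ?M (\<lambda>x. Poly_Mapping.single x 1) r)"
    unfolding lin_ext_def
    apply (subst linear_on_finsum[OF free_is_vs presented_is_vs cl])
    subgoal for i using r keys_scale[of "Poly_Mapping.lookup r i" "Poly_Mapping.single i 1"] by auto
    apply (rule vs_finsum_cong[OF presented_is_vs refl])
    subgoal for i using r linear_onD(1)[OF cl, of "Poly_Mapping.lookup r i \<odot>\<^bsub>?M\<^esub> Poly_Mapping.single i 1"]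
        keys_scale[of "Poly_Mapping.lookup r i" "Poly_Mapping.single i 1"] by auto
    subgoal for i using r linear_onD(3)[OF cl, of "Poly_Mapping.single i 1" "Poly_Mapping.lookup r i"]
      by (auto simp: gen_class_def)
    done
  also have "\<dots> = ?cl r" using lin_ext_self[of r Z] r by simp
  also have "\<dots> = \<zero>\<^bsub>presented Z R\<^esub>"
    unfolding presented_def using coset_zero_iff[OF free_is_vs H r] vspan_inc[OF assms] by blast
  finally show ?thesis .
qed

end

lemma keys_single_sub: "x \<in> Z \<Longrightarrow> Poly_Mapping.keys (Poly_Mapping.single x a) \<subseteq> Z"
  by simp

lemma keys_diff_sub: "Poly_Mapping.keys c \<subseteq> Z \<Longrightarrow> Poly_Mapping.keys d \<subseteq> Z
    \<Longrightarrow> Poly_Mapping.keys (c - d) \<subseteq> Z"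
  using Poly_Mapping.keys_diff[of c d] by blast

text \<open>The relations of tensor products and symmetric powers are differences of two or three
  generators. This lemma and the next translate the killing of such a relation into the equation
  that it encodes.\<close>

lemma lin_ext_rel2:
  assumes N: "is_vs N" and \<phi>: "\<phi> x \<in> carrier N" "\<phi> y \<in> carrier N"
  shows "lin_ext N \<phi> (Poly_Mapping.single x 1 - Poly_Mapping.single y a) = \<zero>\<^bsub>N\<^esub>
    \<longleftrightarrow> \<phi> x = a \<odot>\<^bsub>N\<^esub> \<phi> y"
proof -
  have "lin_ext N \<phi> (Poly_Mapping.single x 1 - Poly_Mapping.single y a)
      = \<phi> x \<oplus>\<^bsub>N\<^esub> (-1) \<odot>\<^bsub>N\<^esub> (a \<odot>\<^bsub>N\<^esub> \<phi> y)"
    by (subst lin_ext_diff[OF N, where Z = "{x, y}"])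
      (use \<phi> in \<open>auto simp: lin_ext_single[OF N] vs_smult_one[OF N]\<close>)
  then show ?thesis
    using vs_diff_eq_zero[OF N \<phi>(1), of "a \<odot>\<^bsub>N\<^esub> \<phi> y"] \<phi>
    by (simp add: vs_smult_closed[OF N])
qed

lemma lin_ext_rel3:
  assumes N: "is_vs N" and \<phi>: "\<phi> x \<in> carrier N" "\<phi> y \<in> carrier N" "\<phi> z \<in> carrier N"
  shows "lin_ext N \<phi> (Poly_Mapping.single x 1 - Poly_Mapping.single y 1 - Poly_Mapping.single z 1)
    = \<zero>\<^bsub>N\<^esub> \<longleftrightarrow> \<phi> x = \<phi> y \<oplus>\<^bsub>N\<^esub> \<phi> z"
proof -
  have "lin_ext N \<phi> (Poly_Mapping.single x 1 - Poly_Mapping.single y 1)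
      = \<phi> x \<oplus>\<^bsub>N\<^esub> (-1) \<odot>\<^bsub>N\<^esub> \<phi> y"
    by (subst lin_ext_diff[OF N, where Z = "{x, y}"])
      (use \<phi> in \<open>auto simp: lin_ext_single[OF N] vs_smult_one[OF N]\<close>)
  then have "lin_ext N \<phi> (Poly_Mapping.single x 1 - Poly_Mapping.single y 1 - Poly_Mapping.single z 1)
      = (\<phi> x \<oplus>\<^bsub>N\<^esub> (-1) \<odot>\<^bsub>N\<^esub> \<phi> y) \<oplus>\<^bsub>N\<^esub> (-1) \<odot>\<^bsub>N\<^esub> \<phi> z"
  proof (subst lin_ext_diff[OF N, where Z = "{x, y, z}"])
    show "Poly_Mapping.keys (Poly_Mapping.single x (1::'a) - Poly_Mapping.single y 1) \<subseteq> {x, y, z}"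
      by (intro keys_diff_sub) auto
  qed (use \<phi> in \<open>auto simp: lin_ext_single[OF N] vs_smult_one[OF N]\<close>)
  moreover have "(\<phi> x \<oplus>\<^bsub>N\<^esub> (-1) \<odot>\<^bsub>N\<^esub> \<phi> y) \<oplus>\<^bsub>N\<^esub> (-1) \<odot>\<^bsub>N\<^esub> \<phi> z = \<zero>\<^bsub>N\<^esub>
      \<longleftrightarrow> \<phi> x \<oplus>\<^bsub>N\<^esub> (-1) \<odot>\<^bsub>N\<^esub> \<phi> y = \<phi> z"
    by (rule vs_diff_eq_zero[OF N]) (use \<phi> in \<open>auto simp: vs_closed[OF N]\<close>)
  moreover have "\<phi> x = \<phi> z \<oplus>\<^bsub>N\<^esub> \<phi> y \<longleftrightarrow> \<phi> x \<oplus>\<^bsub>N\<^esub> (-1) \<odot>\<^bsub>N\<^esub> \<phi> y = \<phi> z"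
    by (rule vs_add_eq_iff[OF N]) (use \<phi> in auto)
  ultimately show ?thesis
    using vs_add_comm[OF N \<phi>(2,3)] by simp
qed

section \<open>Tensor products\<close>

definition bilinear_on ::
    "('k::field_char_0, 'v) module \<Rightarrow> ('k, 'w) module \<Rightarrow> ('k, 'z) module \<Rightarrow> ('v \<Rightarrow> 'w \<Rightarrow> 'z) \<Rightarrow> bool" where
  "bilinear_on M N P \<beta> \<longleftrightarrow> (\<forall>y\<in>carrier N. linear_on M P (\<lambda>x. \<beta> x y)) \<and>
     (\<forall>x\<in>carrier M. linear_on N P (\<beta> x))"

lemma bilinear_onD:
  assumes "bilinear_on M N P \<beta>"
  shows "y \<in> carrier N \<Longrightarrow> linear_on M P (\<lambda>x. \<beta> x y)"
    and "x \<in> carrier M \<Longrightarrow> linear_on N P (\<beta> x)"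
    and "x \<in> carrier M \<Longrightarrow> y \<in> carrier N \<Longrightarrow> \<beta> x y \<in> carrier P"
  using assms by (auto simp: bilinear_on_def linear_on_def)

lemma tensor_rels_cases:
  assumes "r \<in> tensor_rels M N"
  obtains (add_l) x x' y where "x \<in> carrier M" "x' \<in> carrier M" "y \<in> carrier N"
      "r = Poly_Mapping.single (x \<oplus>\<^bsub>M\<^esub> x', y) 1 - Poly_Mapping.single (x, y) 1 - Poly_Mapping.single (x', y) 1"
    | (add_r) x y y' where "x \<in> carrier M" "y \<in> carrier N" "y' \<in> carrier N"
      "r = Poly_Mapping.single (x, y \<oplus>\<^bsub>N\<^esub> y') 1 - Poly_Mapping.single (x, y) 1 - Poly_Mapping.single (x, y') 1"
    | (smult_l) a x y where "x \<in> carrier M" "y \<in> carrier N"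
      "r = Poly_Mapping.single (a \<odot>\<^bsub>M\<^esub> x, y) 1 - Poly_Mapping.single (x, y) a"
    | (smult_r) a x y where "x \<in> carrier M" "y \<in> carrier N"
      "r = Poly_Mapping.single (x, a \<odot>\<^bsub>N\<^esub> y) 1 - Poly_Mapping.single (x, y) a"
  using assms unfolding tensor_rels_def by (elim UnE CollectE exE conjE) simp_all

context
  fixes M :: "('k::field_char_0, 'v) module" and N :: "('k, 'w) module"
  assumes M: "is_vs M" and N: "is_vs N"
begin

lemma tensor_rels_carrier: "tensor_rels M N \<subseteq> carrier (free_module (carrier M \<times> carrier N))"
proof
  fix r :: "'v \<times> 'w \<Rightarrow>\<^sub>0 'k" assume "r \<in> tensor_rels M N"
  then show "r \<in> carrier (free_module (carrier M \<times> carrier N))"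
    by (cases rule: tensor_rels_cases; simp only: free_simps mem_Collect_eq)
      (intro keys_diff_sub keys_single_sub; simp add: vs_closed M N)+
qed

lemma tensor_is_vs: "is_vs (tensor_module M N)"
  unfolding tensor_module_def by (rule presented_is_vs[OF tensor_rels_carrier])

lemma tens_closed: "x \<in> carrier M \<Longrightarrow> y \<in> carrier N \<Longrightarrow> tens M N x y \<in> carrier (tensor_module M N)"
  unfolding tensor_module_def tens_def by (rule gen_class_closed[OF tensor_rels_carrier]) simp

lemma tens_bilinear: "bilinear_on M N (tensor_module M N) (tens M N)"
proof -
  let ?P = "tensor_module M N"
  note P = tensor_is_vs
  have rel: "lin_ext ?P (\<lambda>(x, y). tens M N x y) r = \<zero>\<^bsub>?P\<^esub>" if "r \<in> tensor_rels M N" for r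
    using gen_class_relation[OF tensor_rels_carrier that]
    by (simp add: tensor_module_def tens_def)
  have 1: "tens M N (x \<oplus>\<^bsub>M\<^esub> x') y = tens M N x y \<oplus>\<^bsub>?P\<^esub> tens M N x' y"
    if "x \<in> carrier M" "x' \<in> carrier M" "y \<in> carrier N" for x x' y
  proof -
    have "Poly_Mapping.single (x \<oplus>\<^bsub>M\<^esub> x', y) 1 - Poly_Mapping.single (x, y) 1
        - Poly_Mapping.single (x', y) 1 \<in> tensor_rels M N"
      unfolding tensor_rels_def using that by blast
    from rel[OF this] show ?thesis
      by (subst (asm) lin_ext_rel3[OF P]) (use that in \<open>auto simp: tens_closed vs_closed M N\<close>)
  qed
  have 2: "tens M N x (y \<oplus>\<^bsub>N\<^esub> y') = tens M N x y \<oplus>\<^bsub>?P\<^esub> tens M N x y'"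
    if "x \<in> carrier M" "y \<in> carrier N" "y' \<in> carrier N" for x y y'
  proof -
    have "Poly_Mapping.single (x, y \<oplus>\<^bsub>N\<^esub> y') 1 - Poly_Mapping.single (x, y) 1
        - Poly_Mapping.single (x, y') 1 \<in> tensor_rels M N"
      unfolding tensor_rels_def using that by blast
    from rel[OF this] show ?thesis
      by (subst (asm) lin_ext_rel3[OF P]) (use that in \<open>auto simp: tens_closed vs_closed M N\<close>)
  qed
  have 3: "tens M N (a \<odot>\<^bsub>M\<^esub> x) y = a \<odot>\<^bsub>?P\<^esub> tens M N x y"
    if "x \<in> carrier M" "y \<in> carrier N" for a x y
  proof -
    have "Poly_Mapping.single (a \<odot>\<^bsub>M\<^esub> x, y) 1 - Poly_Mapping.single (x, y) a \<in> tensor_rels M N"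
      unfolding tensor_rels_def using that by blast
    from rel[OF this] show ?thesis
      by (subst (asm) lin_ext_rel2[OF P]) (use that in \<open>auto simp: tens_closed vs_closed M N\<close>)
  qed
  have 4: "tens M N x (a \<odot>\<^bsub>N\<^esub> y) = a \<odot>\<^bsub>?P\<^esub> tens M N x y"
    if "x \<in> carrier M" "y \<in> carrier N" for a x y
  proof -
    have "Poly_Mapping.single (x, a \<odot>\<^bsub>N\<^esub> y) 1 - Poly_Mapping.single (x, y) a \<in> tensor_rels M N"
      unfolding tensor_rels_def using that by blast
    from rel[OF this] show ?thesis
      by (subst (asm) lin_ext_rel2[OF P]) (use that in \<open>auto simp: tens_closed vs_closed M N\<close>)
  qed
  show ?thesis
    unfolding bilinear_on_def linear_on_def using 1 2 3 4 tens_closed by auto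
qed

lemma tensor_eq:
  fixes P :: "('k, 'z) module"
  assumes "is_vs P" "linear_on (tensor_module M N) P f" "linear_on (tensor_module M N) P g"
    and "\<And>x y. x \<in> carrier M \<Longrightarrow> y \<in> carrier N \<Longrightarrow> f (tens M N x y) = g (tens M N x y)"
    and "T \<in> carrier (tensor_module M N)"
  shows "f T = g T"
  using assms presented_eq[OF tensor_rels_carrier, of P f g T] by (auto simp: tensor_module_def tens_def)

lemma tensor_ext:
  fixes P :: "('k, 'z) module"
  assumes P: "is_vs P" and \<beta>: "bilinear_on M N P \<beta>"
  shows tensor_ext_linear: "linear_on (tensor_module M N) P (ext_gen P (\<lambda>(x, y). \<beta> x y))"
    and tensor_ext_tens: "x \<in> carrier M \<Longrightarrow> y \<in> carrier N \<Longrightarrow>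
      ext_gen P (\<lambda>(x, y). \<beta> x y) (tens M N x y) = \<beta> x y"
proof -
  have c: "(case z of (x, y) \<Rightarrow> \<beta> x y) \<in> carrier P" if "z \<in> carrier M \<times> carrier N" for z
    using that bilinear_onD(3)[OF \<beta>] by auto
  have "lin_ext P (\<lambda>(x, y). \<beta> x y) r = \<zero>\<^bsub>P\<^esub>" if "r \<in> tensor_rels M N" for r
    using that
  proof (cases rule: tensor_rels_cases)
    case (add_l x x' y)
    then show ?thesis
      using linear_onD(2)[OF bilinear_onD(1)[OF \<beta>], of y x x'] bilinear_onD(3)[OF \<beta>]
      by (simp only:, subst lin_ext_rel3[OF P]) (auto simp: vs_closed M N P)
  next
    case (add_r x y y')
    then show ?thesis
      using linear_onD(2)[OF bilinear_onD(2)[OF \<beta>], of x y y'] bilinear_onD(3)[OF \<beta>]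
      by (simp only:, subst lin_ext_rel3[OF P]) (auto simp: vs_closed M N P)
  next
    case (smult_l a x y)
    then show ?thesis
      using linear_onD(3)[OF bilinear_onD(1)[OF \<beta>], of y x a] bilinear_onD(3)[OF \<beta>]
      by (simp only:, subst lin_ext_rel2[OF P]) (auto simp: vs_closed M N P)
  next
    case (smult_r a x y)
    then show ?thesis
      using linear_onD(3)[OF bilinear_onD(2)[OF \<beta>], of x y a] bilinear_onD(3)[OF \<beta>]
      by (simp only:, subst lin_ext_rel2[OF P]) (auto simp: vs_closed M N P)
  qed
  note * = ext_gen_props[OF tensor_rels_carrier P c this]
  show "linear_on (tensor_module M N) P (ext_gen P (\<lambda>(x, y). \<beta> x y))"
    unfolding tensor_module_def by (rule *(1))
  show "x \<in> carrier M \<Longrightarrow> y \<in> carrier N \<Longrightarrow>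
      ext_gen P (\<lambda>(x, y). \<beta> x y) (tens M N x y) = \<beta> x y"
    unfolding tens_def using *(2)[of "(x, y)"] by simp
qed

end

lemma tens_map_props:
  assumes M: "is_vs M" and N: "is_vs N" and M': "is_vs M'" and N': "is_vs N'"
    and f: "linear_on M M' f" and g: "linear_on N N' g"
  shows tens_map_linear: "linear_on (tensor_module M N) (tensor_module M' N') (tens_map M' N' f g)"
    and tens_map_tens: "x \<in> carrier M \<Longrightarrow> y \<in> carrier N \<Longrightarrow>
      tens_map M' N' f g (tens M N x y) = tens M' N' (f x) (g y)"
proof -
  have "bilinear_on M N (tensor_module M' N') (\<lambda>x y. tens M' N' (f x) (g y))"
    unfolding bilinear_on_def
    using linear_on_comp[OF f bilinear_onD(1)[OF tens_bilinear[OF M' N']]]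
      linear_on_comp[OF g bilinear_onD(2)[OF tens_bilinear[OF M' N']]]
      linear_onD(1)[OF f] linear_onD(1)[OF g] by blast
  note * = tensor_ext[OF M N tensor_is_vs[OF M' N'] this]
  show "linear_on (tensor_module M N) (tensor_module M' N') (tens_map M' N' f g)"
    "x \<in> carrier M \<Longrightarrow> y \<in> carrier N \<Longrightarrow> tens_map M' N' f g (tens M N x y) = tens M' N' (f x) (g y)"
    unfolding tens_map_def using * by auto
qed

text \<open>No Koszul sign arises, since \<open>tens_map\<close> is the ungraded tensor product; the
  signs of graded maps are carried by \<open>Sym_sign\<close> instead.\<close>

lemma tens_map_comp:
  assumes "is_vs M" "is_vs N" "is_vs M'" "is_vs N'" "is_vs M''" "is_vs N''"
    and f: "linear_on M M' f" "linear_on N N' g" "linear_on M' M'' f'" "linear_on N' N'' g'"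
    and T: "T \<in> carrier (tensor_module M N)"
  shows "tens_map M'' N'' f' g' (tens_map M' N' f g T) = tens_map M'' N'' (\<lambda>x. f' (f x)) (\<lambda>y. g' (g y)) T"
proof (rule tensor_eq[OF assms(1,2) tensor_is_vs[OF assms(5,6)] _ _ _ T])
  show "linear_on (tensor_module M N) (tensor_module M'' N'') (\<lambda>T. tens_map M'' N'' f' g' (tens_map M' N' f g T))"
    by (intro linear_on_comp[OF tens_map_linear tens_map_linear] assms)
  show "linear_on (tensor_module M N) (tensor_module M'' N'') (tens_map M'' N'' (\<lambda>x. f' (f x)) (\<lambda>y. g' (g y)))"
    by (intro tens_map_linear linear_on_comp[OF f(1,3)] linear_on_comp[OF f(2,4)] assms)
qed (simp add: tens_map_tens[OF assms(1-4) f(1,2)] tens_map_tens[OF assms(3-6) f(3,4)]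
    tens_map_tens[OF assms(1,2,5,6) linear_on_comp[OF f(1,3)] linear_on_comp[OF f(2,4)]]
    linear_onD(1)[OF f(1)] linear_onD(1)[OF f(2)])

lemma tens_map_cong:
  assumes "is_vs M" "is_vs N" "is_vs M'" "is_vs N'"
    and f: "linear_on M M' f" "linear_on N N' g" "linear_on M M' f'" "linear_on N N' g'"
    and eq: "\<And>x. x \<in> carrier M \<Longrightarrow> f x = f' x" "\<And>y. y \<in> carrier N \<Longrightarrow> g y = g' y"
    and T: "T \<in> carrier (tensor_module M N)"
  shows "tens_map M' N' f g T = tens_map M' N' f' g' T"
  by (rule tensor_eq[OF assms(1,2) tensor_is_vs[OF assms(3,4)] _ _ _ T])
    (auto intro!: tens_map_linear assms(1-8) simp: tens_map_tens[OF assms(1-4) f(1,2)]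
      tens_map_tens[OF assms(1-4) f(3,4)] eq)

section \<open>Direct sums and extension of linear maps\<close>

lemma dsum_simps [simp]:
  "carrier (dsum_module M N) = carrier M \<times> carrier N"
  "(x, y) \<oplus>\<^bsub>dsum_module M N\<^esub> (x', y') = (x \<oplus>\<^bsub>M\<^esub> x', y \<oplus>\<^bsub>N\<^esub> y')"
  "\<zero>\<^bsub>dsum_module M N\<^esub> = (\<zero>\<^bsub>M\<^esub>, \<zero>\<^bsub>N\<^esub>)"
  "a \<odot>\<^bsub>dsum_module M N\<^esub> (x, y) = (a \<odot>\<^bsub>M\<^esub> x, a \<odot>\<^bsub>N\<^esub> y)"
  by (simp_all add: dsum_module_def)

lemma dsum_is_vs:
  assumes M: "is_vs M" and N: "is_vs N"
  shows "is_vs (dsum_module M N)"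
  by (rule is_vsI) (auto simp: vs_simps[OF M] vs_simps[OF N] vs_smult_l[OF M] vs_smult_l[OF N]
      vs_smult_r[OF M] vs_smult_r[OF N] vs_add_assoc[OF M] vs_add_assoc[OF N]
      intro: vs_add_comm[OF M] vs_add_comm[OF N])

text \<open>Serves the next proof, where a graph is enlarged by the multiples of one vector.\<close>

lemma vs_add_smult_ac:
  assumes M: "is_vs M" and "y \<in> carrier M" "y' \<in> carrier M" "z \<in> carrier M"
  shows "(y \<oplus>\<^bsub>M\<^esub> a \<odot>\<^bsub>M\<^esub> z) \<oplus>\<^bsub>M\<^esub> (y' \<oplus>\<^bsub>M\<^esub> a' \<odot>\<^bsub>M\<^esub> z) = (y \<oplus>\<^bsub>M\<^esub> y') \<oplus>\<^bsub>M\<^esub> (a + a') \<odot>\<^bsub>M\<^esub> z"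
  using assms abelian_monoid.a_ac[OF vs_abelian_monoid[OF M]] by (simp add: vs_smult_l vs_closed)

text \<open>Zorn's lemma on the graphs of partial extensions of \<open>\<pi>\<close> that lift \<open>\<rho>\<close>; a maximal graph is total
  because \<open>\<psi>\<close> is surjective.\<close>

lemma linear_extension:
  assumes V: "is_vs V" and H: "is_vs H" and H': "is_vs H'"
    and Z: "submodule Z ring_of_type_algebra V"
    and \<pi>: "linear_on (V\<lparr>carrier := Z\<rparr>) H \<pi>"
    and \<psi>: "linear_on H H' \<psi>" and surj: "\<psi> ` carrier H = carrier H'"
    and \<rho>: "linear_on V H' \<rho>" and eq: "\<And>x. x \<in> Z \<Longrightarrow> \<psi> (\<pi> x) = \<rho> x"
  obtains r where "linear_on V H r" "\<And>x. x \<in> Z \<Longrightarrow> r x = \<pi> x" "\<And>x. x \<in> carrier V \<Longrightarrow> \<psi> (r x) = \<rho> x"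
proof -
  let ?D = "dsum_module V H"
  have D: "is_vs ?D" by (rule dsum_is_vs[OF V H])
  have Z': "Z \<subseteq> carrier V" "\<zero>\<^bsub>V\<^esub> \<in> Z" "\<And>x y. x \<in> Z \<Longrightarrow> y \<in> Z \<Longrightarrow> x \<oplus>\<^bsub>V\<^esub> y \<in> Z"
    "\<And>a x. x \<in> Z \<Longrightarrow> a \<odot>\<^bsub>V\<^esub> x \<in> Z"
    using Z by (auto simp: submodule_iff[OF V])
  have \<pi>': "\<And>x. x \<in> Z \<Longrightarrow> \<pi> x \<in> carrier H" "\<And>x y. x \<in> Z \<Longrightarrow> y \<in> Z \<Longrightarrow> \<pi> (x \<oplus>\<^bsub>V\<^esub> y) = \<pi> x \<oplus>\<^bsub>H\<^esub> \<pi> y"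
    "\<And>a x. x \<in> Z \<Longrightarrow> \<pi> (a \<odot>\<^bsub>V\<^esub> x) = a \<odot>\<^bsub>H\<^esub> \<pi> x"
    using \<pi> by (auto simp: linear_on_def)
  have \<pi>0: "\<pi> \<zero>\<^bsub>V\<^esub> = \<zero>\<^bsub>H\<^esub>"
    using linear_on_zero[OF submodule_is_vs[OF V Z] H \<pi>] by simp
  \<comment> \<open>The third condition says that the subspace \<open>W\<close> is single-valued, so
    it is the graph of a linear map on its first projection.\<close>
  define A where "A = {W. submodule W ring_of_type_algebra ?D \<and> (\<forall>x h. (x, h) \<in> W \<longrightarrow> \<psi> h = \<rho> x) \<and>
    (\<forall>h. (\<zero>\<^bsub>V\<^esub>, h) \<in> W \<longrightarrow> h = \<zero>\<^bsub>H\<^esub>) \<and> (\<lambda>x. (x, \<pi> x)) ` Z \<subseteq> W}"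
  have "(\<lambda>x. (x, \<pi> x)) ` Z \<in> A"
    unfolding A_def submodule_iff[OF D] using Z' \<pi>' \<pi>0 eq by auto
  then have ne: "A \<noteq> {}" by blast
  have "\<exists>W\<in>A. \<forall>U\<in>A. W \<subseteq> U \<longrightarrow> U = W"
  proof (rule subset_Zorn_nonempty[OF ne])
    fix C assume C: "C \<noteq> {}" "subset.chain A C"
    have CA: "C \<subseteq> A" using C by (auto simp: subset.chain_def)
    have "x \<oplus>\<^bsub>?D\<^esub> y \<in> \<Union>C" if xy: "x \<in> \<Union>C" "y \<in> \<Union>C" for x y
    proof -
      obtain U Y where XY: "U \<in> C" "x \<in> U" "Y \<in> C" "y \<in> Y" using xy by auto
      then have "U \<subseteq> Y \<or> Y \<subseteq> U" using C(2) by (auto simp: subset.chain_def)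
      then obtain U where U: "U \<in> C" "x \<in> U" "y \<in> U" using XY by blast
      then have "submodule U ring_of_type_algebra ?D" using CA A_def by auto
      then have "x \<oplus>\<^bsub>?D\<^esub> y \<in> U" using U unfolding submodule_iff[OF D] by blast
      then show ?thesis using U by blast
    qed
    moreover have "a \<odot>\<^bsub>?D\<^esub> x \<in> \<Union>C" if x: "x \<in> \<Union>C" for a x
    proof -
      obtain U where U: "U \<in> C" "x \<in> U" using x by auto
      then have "submodule U ring_of_type_algebra ?D" using CA A_def by auto
      then have "a \<odot>\<^bsub>?D\<^esub> x \<in> U" using U unfolding submodule_iff[OF D] by blast
      then show ?thesis using U by blast
    qed
    moreover have "\<zero>\<^bsub>?D\<^esub> \<in> \<Union>C" "\<Union>C \<subseteq> carrier ?D"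
    proof -
      have *: "\<zero>\<^bsub>?D\<^esub> \<in> U" "U \<subseteq> carrier ?D" if "U \<in> C" for U
      proof -
        have "submodule U ring_of_type_algebra ?D" using CA A_def that by auto
        then show "\<zero>\<^bsub>?D\<^esub> \<in> U" "U \<subseteq> carrier ?D" unfolding submodule_iff[OF D] by blast+
      qed
      obtain U where "U \<in> C" using C by auto
      then show "\<zero>\<^bsub>?D\<^esub> \<in> \<Union>C" using *(1) by blast
      show "\<Union>C \<subseteq> carrier ?D" using *(2) by blast
    qed
    ultimately have "submodule (\<Union>C) ring_of_type_algebra ?D"
      unfolding submodule_iff[OF D] by blast
    moreover have "\<psi> h = \<rho> x" if "(x, h) \<in> \<Union>C" for x h
      using that CA unfolding A_def by auto
    moreover have "h = \<zero>\<^bsub>H\<^esub>" if "(\<zero>\<^bsub>V\<^esub>, h) \<in> \<Union>C" for h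
      using that CA unfolding A_def by auto
    moreover obtain U where "U \<in> C" using C by auto
    then have "(\<lambda>x. (x, \<pi> x)) ` Z \<subseteq> \<Union>C"
      using CA unfolding A_def by blast
    ultimately show "\<Union>C \<in> A" unfolding A_def by simp
  qed
  then obtain W where W: "W \<in> A" and max: "\<And>U. U \<in> A \<Longrightarrow> W \<subseteq> U \<Longrightarrow> U = W" by blast
  have Wsub: "submodule W ring_of_type_algebra ?D" and W\<psi>: "\<And>x h. (x, h) \<in> W \<Longrightarrow> \<psi> h = \<rho> x"
    and W0: "\<And>h. (\<zero>\<^bsub>V\<^esub>, h) \<in> W \<Longrightarrow> h = \<zero>\<^bsub>H\<^esub>" and WZ: "\<And>x. x \<in> Z \<Longrightarrow> (x, \<pi> x) \<in> W"
    using W unfolding A_def by auto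
  have Wc: "\<And>x h. (x, h) \<in> W \<Longrightarrow> x \<in> carrier V \<and> h \<in> carrier H"
    and Wz: "(\<zero>\<^bsub>V\<^esub>, \<zero>\<^bsub>H\<^esub>) \<in> W"
    and Wa: "\<And>x h x' h'. (x, h) \<in> W \<Longrightarrow> (x', h') \<in> W \<Longrightarrow> (x \<oplus>\<^bsub>V\<^esub> x', h \<oplus>\<^bsub>H\<^esub> h') \<in> W"
    and Ws: "\<And>a x h. (x, h) \<in> W \<Longrightarrow> (a \<odot>\<^bsub>V\<^esub> x, a \<odot>\<^bsub>H\<^esub> h) \<in> W"
    using Wsub unfolding submodule_iff[OF D] by force+
  have ex: "\<exists>h. (x, h) \<in> W" if x: "x \<in> carrier V" for x
  proof (rule ccontr)
    assume no: "\<nexists>h. (x, h) \<in> W"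
    have "\<rho> x \<in> \<psi> ` carrier H" using surj linear_onD(1)[OF \<rho> x] by simp
    then obtain h where h: "h \<in> carrier H" "\<psi> h = \<rho> x" by auto
    \<comment> \<open>The span of \<open>W\<close> and \<open>(x, h)\<close>, that is, the graph
      extended by the value \<open>h\<close> at \<open>x\<close>.\<close>
    let ?X = "{(y \<oplus>\<^bsub>V\<^esub> a \<odot>\<^bsub>V\<^esub> x, k \<oplus>\<^bsub>H\<^esub> a \<odot>\<^bsub>H\<^esub> h) | y k a. (y, k) \<in> W}"
    have WsubX: "W \<subseteq> ?X"
    proof
      fix p assume p: "p \<in> W"
      obtain y k where [simp]: "p = (y, k)" by (cases p)
      have "p = (y \<oplus>\<^bsub>V\<^esub> 0 \<odot>\<^bsub>V\<^esub> x, k \<oplus>\<^bsub>H\<^esub> 0 \<odot>\<^bsub>H\<^esub> h)"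
        using Wc p x h by (auto simp: vs_simps[OF V] vs_simps[OF H])
      moreover have "(y, k) \<in> W" using p by simp
      ultimately show "p \<in> ?X" by blast
    qed
    have "submodule ?X ring_of_type_algebra ?D"
      unfolding submodule_iff[OF D]
    proof (intro conjI ballI allI)
      show "?X \<subseteq> carrier ?D" using Wc x h by (auto simp: vs_closed[OF V] vs_closed[OF H])
      show "\<zero>\<^bsub>?D\<^esub> \<in> ?X" using subsetD[OF WsubX Wz] by (simp only: dsum_simps)
    next
      fix p q assume "p \<in> ?X" "q \<in> ?X"
      then obtain y k a y' k' a' where *: "p = (y \<oplus>\<^bsub>V\<^esub> a \<odot>\<^bsub>V\<^esub> x, k \<oplus>\<^bsub>H\<^esub> a \<odot>\<^bsub>H\<^esub> h)" "(y, k) \<in> W"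
        "q = (y' \<oplus>\<^bsub>V\<^esub> a' \<odot>\<^bsub>V\<^esub> x, k' \<oplus>\<^bsub>H\<^esub> a' \<odot>\<^bsub>H\<^esub> h)" "(y', k') \<in> W" by blast
      then have "p \<oplus>\<^bsub>?D\<^esub> q = ((y \<oplus>\<^bsub>V\<^esub> y') \<oplus>\<^bsub>V\<^esub> (a + a') \<odot>\<^bsub>V\<^esub> x, (k \<oplus>\<^bsub>H\<^esub> k') \<oplus>\<^bsub>H\<^esub> (a + a') \<odot>\<^bsub>H\<^esub> h)"
        using Wc x h vs_add_smult_ac[OF V] vs_add_smult_ac[OF H] by auto
      then show "p \<oplus>\<^bsub>?D\<^esub> q \<in> ?X" using Wa[OF *(2,4)] by blast
    next
      fix b p assume "p \<in> ?X"
      then obtain y k a where *: "p = (y \<oplus>\<^bsub>V\<^esub> a \<odot>\<^bsub>V\<^esub> x, k \<oplus>\<^bsub>H\<^esub> a \<odot>\<^bsub>H\<^esub> h)" "(y, k) \<in> W" by blast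
      then have "b \<odot>\<^bsub>?D\<^esub> p = (b \<odot>\<^bsub>V\<^esub> y \<oplus>\<^bsub>V\<^esub> (b * a) \<odot>\<^bsub>V\<^esub> x, b \<odot>\<^bsub>H\<^esub> k \<oplus>\<^bsub>H\<^esub> (b * a) \<odot>\<^bsub>H\<^esub> h)"
        using Wc x h by (auto simp: vs_smult_r[OF V] vs_smult_r[OF H] vs_simps[OF V] vs_simps[OF H])
      then show "b \<odot>\<^bsub>?D\<^esub> p \<in> ?X" using Ws[OF *(2)] by blast
    qed
    moreover have "\<psi> l = \<rho> z" if "(z, l) \<in> ?X" for z l
      using that W\<psi> Wc x h linear_onD[OF \<psi>] linear_onD[OF \<rho>]
      by (auto simp: vs_closed[OF V] vs_closed[OF H])
    moreover have "l = \<zero>\<^bsub>H\<^esub>" if l: "(\<zero>\<^bsub>V\<^esub>, l) \<in> ?X" for l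
    proof -
      obtain y k a where *: "\<zero>\<^bsub>V\<^esub> = y \<oplus>\<^bsub>V\<^esub> a \<odot>\<^bsub>V\<^esub> x" "l = k \<oplus>\<^bsub>H\<^esub> a \<odot>\<^bsub>H\<^esub> h" "(y, k) \<in> W"
        using l by auto
      show ?thesis
      proof (cases "a = 0")
        case True
        then have "y = \<zero>\<^bsub>V\<^esub>" "l = k" using * Wc x h by (auto simp: vs_simps[OF V] vs_simps[OF H])
        then show ?thesis using W0 * by simp
      next
        \<comment> \<open>With \<open>a\<close> invertible, \<open>x\<close> would be a multiple of
          \<open>y\<close> and therefore already lie in the domain of \<open>W\<close>.\<close>
        case False
        have "a \<odot>\<^bsub>V\<^esub> x = (-1) \<odot>\<^bsub>V\<^esub> y"
        proof -
          have c: "y \<in> carrier V" "a \<odot>\<^bsub>V\<^esub> x \<in> carrier V" using Wc[OF *(3)] x by (auto simp: vs_closed[OF V])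
          have "\<zero>\<^bsub>V\<^esub> \<oplus>\<^bsub>V\<^esub> (-1) \<odot>\<^bsub>V\<^esub> y = a \<odot>\<^bsub>V\<^esub> x"
            using vs_add_eq_iff[OF V vs_zero_closed[OF V] c] *(1) vs_add_comm[OF V c] by simp
          then show ?thesis using c by (simp add: vs_l_zero[OF V] vs_closed[OF V])
        qed
        then have "inverse a \<odot>\<^bsub>V\<^esub> (a \<odot>\<^bsub>V\<^esub> x) = inverse a \<odot>\<^bsub>V\<^esub> ((-1) \<odot>\<^bsub>V\<^esub> y)" by simp
        then have "x = (- inverse a) \<odot>\<^bsub>V\<^esub> y"
          using False x Wc[OF *(3)] by (simp add: vs_simps[OF V])
        then show ?thesis using Ws[OF *(3), of "- inverse a"] no by auto
      qed
    qed
    ultimately have "?X \<in> A" unfolding A_def using WZ WsubX by blast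
    then have "?X = W" using max WsubX by blast
    moreover have "(x, h) \<in> ?X"
    proof -
      have "(x, h) = (\<zero>\<^bsub>V\<^esub> \<oplus>\<^bsub>V\<^esub> 1 \<odot>\<^bsub>V\<^esub> x, \<zero>\<^bsub>H\<^esub> \<oplus>\<^bsub>H\<^esub> 1 \<odot>\<^bsub>H\<^esub> h)"
        using x h by (simp add: vs_simps[OF V] vs_simps[OF H])
      then show ?thesis using Wz by blast
    qed
    ultimately show False using no by blast
  qed
  have uniq: "h = h'" if "(x, h) \<in> W" "(x, h') \<in> W" for x h h'
  proof -
    have c: "x \<in> carrier V" "h \<in> carrier H" "h' \<in> carrier H" using Wc that by blast+
    have "(x \<oplus>\<^bsub>V\<^esub> (-1) \<odot>\<^bsub>V\<^esub> x, h \<oplus>\<^bsub>H\<^esub> (-1) \<odot>\<^bsub>H\<^esub> h') \<in> W" using Wa Ws that by blast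
    then have "h \<oplus>\<^bsub>H\<^esub> (-1) \<odot>\<^bsub>H\<^esub> h' = \<zero>\<^bsub>H\<^esub>" using W0 c by (simp add: vs_simps[OF V])
    then show ?thesis using vs_diff_eq_zero[OF H] c by simp
  qed
  define r where "r x = (SOME h. (x, h) \<in> W)" for x
  have rW: "(x, r x) \<in> W" if "x \<in> carrier V" for x
    unfolding r_def using ex[OF that] by (rule someI_ex)
  have "linear_on V H r"
    unfolding linear_on_def
  proof (intro conjI ballI allI)
    show "r x \<in> carrier H" if "x \<in> carrier V" for x using rW[OF that] Wc by blast
    show "r (x \<oplus>\<^bsub>V\<^esub> y) = r x \<oplus>\<^bsub>H\<^esub> r y" if "x \<in> carrier V" "y \<in> carrier V" for x y
      by (rule uniq[OF rW Wa]) (use that rW vs_closed[OF V] in auto)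
    show "r (a \<odot>\<^bsub>V\<^esub> x) = a \<odot>\<^bsub>H\<^esub> r x" if "x \<in> carrier V" for a x
      by (rule uniq[OF rW Ws]) (use that rW vs_closed[OF V] in auto)
  qed
  moreover have "r x = \<pi> x" if "x \<in> Z" for x
    using rW uniq WZ Z'(1) that by blast
  moreover have "\<psi> (r x) = \<rho> x" if "x \<in> carrier V" for x
    using W\<psi> rW that by blast
  ultimately show ?thesis using that by blast
qed

text \<open>The instance of \<open>linear_extension\<close> in which the zero map on the zero
  subspace of \<open>W\<close> is extended and the identity of \<open>W\<close> is lifted through
  \<open>p\<close>.\<close>

lemma linear_section:
  assumes V: "is_vs V" and W: "is_vs W" and p: "linear_on V W p" and surj: "p ` carrier V = carrier W"
  obtains s where "linear_on W V s" "\<And>y. y \<in> carrier W \<Longrightarrow> p (s y) = y"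
proof -
  have Z: "submodule {\<zero>\<^bsub>W\<^esub>} ring_of_type_algebra W"
    by (simp add: submodule_iff[OF W] vs_simps[OF W])
  have l: "linear_on (W\<lparr>carrier := {\<zero>\<^bsub>W\<^esub>}\<rparr>) V (\<lambda>_. \<zero>\<^bsub>V\<^esub>)"
    by (simp add: linear_on_def vs_simps[OF V])
  show ?thesis
    by (rule linear_extension[OF W V W Z l p surj linear_on_id])
      (use linear_on_zero[OF V W p] that in auto)
qed

section \<open>Koszul signs and subwords selected by bit lists\<close>

definition sg :: "int \<Rightarrow> 'k::field_char_0" where
  "sg n = (-1) powi n"

lemma sg_0 [simp]: "sg 0 = 1"
  by (simp add: sg_def)
lemma sg_add: "sg (a + b) = sg a * sg b"
  by (simp add: sg_def power_int_add)
lemma sg_self [simp]: "sg n * sg n = 1"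
  by (simp add: sg_def)
lemma sg_self_left [simp]: "sg n * (sg n * x) = x"
  by (simp add: mult.assoc[symmetric])

text \<open>A shuffle is encoded by the bit list marking the letters that go to the left factor;
  inside each factor the letters keep their order, so the marks determine everything.\<close>

fun sel :: "bool list \<Rightarrow> 'a list \<Rightarrow> 'a list" where
  "sel (b # bs) (x # w) = (if b then x # sel bs w else sel bs w)"
| "sel _ _ = []"

abbreviation nsel :: "bool list \<Rightarrow> 'a list \<Rightarrow> 'a list" where
  "nsel bs \<equiv> sel (map Not bs)"

text \<open>The Koszul sign of the unshuffle: a letter sent to the right is passed by the selected
  letters behind it. The recursion on the word replaces inversions of a permutation.\<close>

fun ksgn :: "bool list \<Rightarrow> 'v word \<Rightarrow> 'k::field_char_0" where
  "ksgn (b # bs) (x # w) = (if b then 1 else sg (fst x * wdeg (sel bs w))) * ksgn bs w"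
| "ksgn _ _ = 1"

lemma wdeg_simps [simp]:
  "wdeg [] = 0" "wdeg (x # w) = fst x + wdeg w" "wdeg (u @ w) = wdeg u + wdeg w"
  by (simp_all add: wdeg_def)

lemma wdeg_cong: "map fst w = map fst w' \<Longrightarrow> wdeg w = wdeg w'"
  by (simp add: wdeg_def)

lemma sel_Nil2 [simp]: "sel bs [] = []"
  by (cases bs) auto

lemma sel_append: "length bu = length u \<Longrightarrow> sel (bu @ bv) (u @ v) = sel bu u @ sel bv v"
  by (induction bu u rule: list_induct2) auto

lemma sel_map: "sel bs (map h w) = map h (sel bs w)"
  by (induction bs w rule: sel.induct) auto

lemma set_sel: "set (sel bs w) \<subseteq> set w"
  by (induction bs w rule: sel.induct) auto

lemma sel_ne: "length bs = length w \<Longrightarrow> True \<in> set bs \<Longrightarrow> sel bs w \<noteq> []"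
  by (induction bs w rule: list_induct2) auto

lemma length_sel: "length bs = length w \<Longrightarrow> length (sel bs w) + length (nsel bs w) = length w"
  by (induction bs w rule: list_induct2) auto

lemma wdeg_sel_cong: "map fst w = map fst w' \<Longrightarrow> wdeg (sel bs w) = wdeg (sel bs w')"
  by (rule wdeg_cong) (simp add: sel_map[symmetric])

text \<open>Hence the sign is constant while one letter varies in its space, and letterwise maps
  that keep degrees leave it unchanged.\<close>

lemma ksgn_cong:
  assumes "map fst w = map fst w'"
  shows "ksgn bs w = ksgn bs w'"
  using assms
proof (induction bs w arbitrary: w' rule: ksgn.induct)
  case (1 b bs x w)
  then obtain y v where *: "w' = y # v" "fst x = fst y" "map fst w = map fst v" by (cases w') auto
  then show ?case using 1 wdeg_sel_cong[OF *(3), of bs] by simp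
next
  case ("2_2" v)
  then show ?case by simp
qed auto

text \<open>The cross term accounts for the letters of \<open>u\<close> sent right that are passed
  by the letters of \<open>v\<close> sent left.\<close>

lemma ksgn_append: "length bu = length u \<Longrightarrow>
    ksgn (bu @ bv) (u @ v) = ksgn bu u * ksgn bv v * sg (wdeg (nsel bu u) * wdeg (sel bv v))"
  by (induction bu u rule: list_induct2) (auto simp: sel_append sg_add algebra_simps)

text \<open>Both bits must occur because the coproduct is reduced: neither factor may be
  empty.\<close>

definition bsets :: "nat \<Rightarrow> bool list set" where
  "bsets n = {bs. length bs = n \<and> True \<in> set bs \<and> False \<in> set bs}"

lemma finite_bsets [simp]: "finite (bsets n)"
  by (rule finite_subset[OF _ finite_lists_length_eq[of "UNIV :: bool set" n]])
    (auto simp: bsets_def)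

lemma nsel_ne: "length bs = length w \<Longrightarrow> False \<in> set bs \<Longrightarrow> nsel bs w \<noteq> []"
  by (rule sel_ne) auto

section \<open>Shuffles as subsets of positions\<close>

lemma sel_filter: "length bs = length w \<Longrightarrow> sel bs w = map (nth w) (filter (nth bs) [0..<length w])"
  by (induction bs w rule: list_induct2)
    (auto simp: upt_conv_Cons map_Suc_upt[symmetric] filter_map comp_def simp del: upt_Suc)

lemma prod_sel: "length bs = length w \<Longrightarrow>
    (\<Prod>a<length w. if bs ! a then sg (x * fst (w ! a)) else 1) = sg (x * wdeg (sel bs w))"
  by (induction bs w rule: list_induct2)
    (auto simp: prod.lessThan_Suc_shift sg_add algebra_simps simp del: prod.lessThan_Suc cong: if_cong)

text \<open>Unfolds the recursion into a product over pairs of positions, the form in which it can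
  be compared with the inversions in \<open>koszul\<close>.\<close>

lemma ksgn_prod: "length bs = length w \<Longrightarrow>
    ksgn bs w = (\<Prod>b<length w. \<Prod>a<length w.
      if b < a \<and> bs ! a \<and> \<not> bs ! b then sg (fst (w ! b) * fst (w ! a)) else 1)"
proof (induction bs w rule: list_induct2)
  case (Cons b bs x w)
  then show ?case
    by (cases b) (auto simp: prod_sel prod.lessThan_Suc_shift simp del: prod.lessThan_Suc cong: if_cong)
qed simp

definition shuffle_bits :: "nat \<Rightarrow> nat \<Rightarrow> (nat \<Rightarrow> nat) \<Rightarrow> bool list" where
  "shuffle_bits m p \<sigma> = map (\<lambda>i. i \<in> \<sigma> ` {..<p}) [0..<m]"

lemma sorted_map_strict:
  assumes "strict_mono_on {a..<b} (\<sigma> :: nat \<Rightarrow> nat)"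
  shows "sorted (map \<sigma> [a..<b])" "distinct (map \<sigma> [a..<b])"
proof -
  have "strict_mono_on (set [a..<b]) \<sigma>" using assms by simp
  then show "sorted (map \<sigma> [a..<b])"
    by (auto simp: sorted_iff_nth_mono strict_mono_on_leD)
  show "distinct (map \<sigma> [a..<b])"
    using strict_mono_on_imp_inj_on[OF assms] by (simp add: distinct_map)
qed

text \<open>A strictly increasing enumeration is determined by its range, so the two blocks of a
  shuffle are the sorted lists of the marked and of the unmarked positions.\<close>

lemma shuffle_filter:
  assumes \<sigma>: "\<sigma> \<in> shuffles_perm p m" and p: "p \<le> m"
  shows "filter (nth (shuffle_bits m p \<sigma>)) [0..<m] = map \<sigma> [0..<p]"
    and "filter (nth (map Not (shuffle_bits m p \<sigma>))) [0..<m] = map \<sigma> [p..<m]"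
proof -
  have perm: "\<sigma> permutes {..<m}" and mono: "strict_mono_on {0..<p} \<sigma>" "strict_mono_on {p..<m} \<sigma>"
    using \<sigma> by (auto simp: shuffles_perm_def atLeast0LessThan)
  have im: "\<sigma> ` {..<m} = {..<m}" "inj \<sigma>"
    using permutes_image[OF perm] permutes_inj[OF perm] by auto
  have "\<sigma> ` {..<p} \<subseteq> {..<m}" using im(1) p by (metis image_mono lessThan_subset_iff)
  then have 1: "{i. i < m \<and> i \<in> \<sigma> ` {..<p}} = \<sigma> ` {0..<p}"
    by (auto simp: atLeast0LessThan)
  have "{p..<m} = {..<m} - {..<p}" by auto
  then have "\<sigma> ` {p..<m} = {..<m} - \<sigma> ` {..<p}"
    by (simp only: image_set_diff[OF im(2)] im(1))
  then have 2: "{i. i < m \<and> i \<notin> \<sigma> ` {..<p}} = \<sigma> ` {p..<m}" by auto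
  have "filter (\<lambda>i. i \<in> \<sigma> ` {..<p}) [0..<m] = map \<sigma> [0..<p]"
    by (rule sorted_distinct_set_unique) (use 1 sorted_map_strict[OF mono(1)] in \<open>auto simp: sorted_wrt_filter\<close>)
  moreover have "filter (nth (shuffle_bits m p \<sigma>)) [0..<m] = filter (\<lambda>i. i \<in> \<sigma> ` {..<p}) [0..<m]"
    by (rule filter_cong) (auto simp: shuffle_bits_def)
  ultimately show "filter (nth (shuffle_bits m p \<sigma>)) [0..<m] = map \<sigma> [0..<p]" by simp
  have "filter (\<lambda>i. i \<notin> \<sigma> ` {..<p}) [0..<m] = map \<sigma> [p..<m]"
    by (rule sorted_distinct_set_unique) (use 2 sorted_map_strict[OF mono(2)] in \<open>auto simp: sorted_wrt_filter\<close>)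
  moreover have "filter (nth (map Not (shuffle_bits m p \<sigma>))) [0..<m] = filter (\<lambda>i. i \<notin> \<sigma> ` {..<p}) [0..<m]"
    by (rule filter_cong) (auto simp: shuffle_bits_def)
  ultimately show "filter (nth (map Not (shuffle_bits m p \<sigma>))) [0..<m] = map \<sigma> [p..<m]" by simp
qed

lemma shuffle_sel:
  assumes "\<sigma> \<in> shuffles_perm p (length w)" "p \<le> length w"
  shows "map (\<lambda>i. w ! \<sigma> i) [0..<p] = sel (shuffle_bits (length w) p \<sigma>) w"
    and "map (\<lambda>i. w ! \<sigma> i) [p..<length w] = nsel (shuffle_bits (length w) p \<sigma>) w"
  using shuffle_filter[OF assms] sel_filter[of "shuffle_bits (length w) p \<sigma>" w]
    sel_filter[of "map Not (shuffle_bits (length w) p \<sigma>)" w]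
  by (auto simp: shuffle_bits_def)

text \<open>A shuffle is increasing on each block, so its inversions run between the blocks. Sending
  an inversion \<open>(i, j)\<close> to \<open>(\<sigma> j, \<sigma> i)\<close> matches them with
  the pairs in \<open>ksgn_prod\<close>: an unmarked position before a marked one.\<close>

lemma shuffle_koszul:
  assumes \<sigma>: "\<sigma> \<in> shuffles_perm p (length w)" and p: "p \<le> length w"
  shows "koszul \<sigma> w = ksgn (shuffle_bits (length w) p \<sigma>) w"
proof -
  define m where "m = length w"
  have perm: "\<sigma> permutes {..<m}" and mono: "strict_mono_on {..<p} \<sigma>" "strict_mono_on {p..<m} \<sigma>"
    using \<sigma> by (auto simp: shuffles_perm_def m_def)
  have inj: "inj \<sigma>" by (rule permutes_inj[OF perm])
  have lt: "\<sigma> i < m" if "i < m" for i using permutes_in_image[OF perm, of i] that by simp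
  have pm: "p \<le> m" using p m_def by simp
  let ?bs = "shuffle_bits m p \<sigma>"
  let ?I = "{(i, j). i < j \<and> j < m \<and> \<sigma> j < \<sigma> i}"
  let ?J = "{(b, a) \<in> {..<m} \<times> {..<m}. b < a \<and> ?bs ! a \<and> \<not> ?bs ! b}"
  have sides: "i < p \<and> p \<le> j" if "(i, j) \<in> ?I" for i j
  proof -
    have ij: "i < j" "j < m" "\<sigma> j < \<sigma> i" using that by auto
    have "\<not> j < p" using strict_mono_onD[OF mono(1), of i j] ij by auto
    moreover have "\<not> p \<le> i" using strict_mono_onD[OF mono(2), of i j] ij by auto
    ultimately show ?thesis by auto
  qed
  have bit: "?bs ! \<sigma> i \<longleftrightarrow> i < p" if "i < m" for i
    using lt[OF that] inj by (auto simp: shuffle_bits_def dest: injD)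
  have "?J = (\<lambda>(i, j). (\<sigma> j, \<sigma> i)) ` ?I"
  proof (intro equalityI subsetI)
    fix q assume "q \<in> ?J"
    then obtain b a where q: "q = (b, a)" "b < a" "a < m" "?bs ! a" "\<not> ?bs ! b" by auto
    obtain i where i: "a = \<sigma> i" "i < m" using permutes_image[OF perm] q by (metis imageE lessThan_iff)
    have "b < m" using q by simp
    then obtain j where j: "b = \<sigma> j" "j < m" using permutes_image[OF perm] by (metis imageE lessThan_iff)
    have "i < p" "\<not> j < p" using bit i j q by auto
    then show "q \<in> (\<lambda>(i, j). (\<sigma> j, \<sigma> i)) ` ?I"
      using i j q by (intro image_eqI[of _ _ "(i, j)"]) auto
  next
    fix q assume "q \<in> (\<lambda>(i, j). (\<sigma> j, \<sigma> i)) ` ?I"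
    then obtain z where z: "q = (case z of (i, j) \<Rightarrow> (\<sigma> j, \<sigma> i))" "z \<in> ?I" by (rule imageE)
    obtain i j where zij: "z = (i, j)" by (cases z)
    have ij: "(i, j) \<in> ?I" and q: "q = (\<sigma> j, \<sigma> i)" using z zij by auto
    then show "q \<in> ?J" using sides[OF ij] bit[of i] bit[of j] lt[of i] lt[of j] by auto
  qed
  then have "(\<Prod>(b, a)\<in>?J. sg (fst (w ! b) * fst (w ! a)))
      = (\<Prod>(b, a)\<in>(\<lambda>(i, j). (\<sigma> j, \<sigma> i)) ` ?I. sg (fst (w ! b) * fst (w ! a)))"
    by simp
  also have "\<dots> = (\<Prod>(i, j)\<in>?I. sg (fst (w ! \<sigma> i) * fst (w ! \<sigma> j)))"
    by (subst prod.reindex) (auto simp: inj_on_def case_prod_unfold mult.commute dest: injD[OF inj])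
  also have "\<dots> = koszul \<sigma> w"
    by (simp add: koszul_def sg_def m_def)
  also have "(\<Prod>(b, a)\<in>?J. sg (fst (w ! b) * fst (w ! a))) = ksgn ?bs w"
  proof -
    have "?J = {x \<in> {..<m} \<times> {..<m}. fst x < snd x \<and> ?bs ! snd x \<and> \<not> ?bs ! fst x}" by auto
    then have "(\<Prod>(b, a)\<in>?J. sg (fst (w ! b) * fst (w ! a))) = (\<Prod>x\<in>{..<m} \<times> {..<m}.
        if fst x < snd x \<and> ?bs ! snd x \<and> \<not> ?bs ! fst x then sg (fst (w ! fst x) * fst (w ! snd x)) else 1)"
      by (simp only: prod.inter_filter[symmetric] finite_cartesian_product finite_lessThan case_prod_unfold)
    moreover have "length ?bs = length w" by (simp add: shuffle_bits_def m_def)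
    ultimately show ?thesis
      by (simp add: ksgn_prod m_def prod.cartesian_product case_prod_unfold)
  qed
  finally show ?thesis unfolding m_def by (rule sym)
qed

lemma shuffle_bits_bij:
  assumes p: "p \<le> m"
  shows "bij_betw (shuffle_bits m p) (shuffles_perm p m)
    {bs. length bs = m \<and> length (filter (nth bs) [0..<m]) = p}"
  unfolding bij_betw_def
proof (intro conjI equalityI subsetI)
  show "inj_on (shuffle_bits m p) (shuffles_perm p m)"
  proof (rule inj_onI)
    fix \<sigma> \<tau> assume *: "\<sigma> \<in> shuffles_perm p m" "\<tau> \<in> shuffles_perm p m"
      "shuffle_bits m p \<sigma> = shuffle_bits m p \<tau>"
    have "map \<sigma> [0..<p] = map \<tau> [0..<p]" "map \<sigma> [p..<m] = map \<tau> [p..<m]"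
      using shuffle_filter[OF *(1) p] shuffle_filter[OF *(2) p] *(3) by auto
    then have "\<sigma> i = \<tau> i" if "i < m" for i using that by (cases "i < p") auto
    moreover have "\<sigma> i = \<tau> i" if "\<not> i < m" for i
      using * that by (auto simp: shuffles_perm_def permutes_def)
    ultimately show "\<sigma> = \<tau>" by blast
  qed
next
  fix bs assume "bs \<in> shuffle_bits m p ` shuffles_perm p m"
  then show "bs \<in> {bs. length bs = m \<and> length (filter (nth bs) [0..<m]) = p}"
    using shuffle_filter(1)[OF _ p] by (auto simp: shuffle_bits_def)
next
  fix bs assume "bs \<in> {bs. length bs = m \<and> length (filter (nth bs) [0..<m]) = p}"
  then have bs: "length bs = m" "length (filter (nth bs) [0..<m]) = p" by auto
  \<comment> \<open>The inverse construction: list the marked positions in order, then the unmarked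
    ones, and read the concatenation as a permutation.\<close>
  define xs ys where "xs = filter (nth bs) [0..<m]" and "ys = filter (\<lambda>i. \<not> bs ! i) [0..<m]"
  have len: "length xs = p" "length (xs @ ys) = m"
    using bs(2) sum_length_filter_compl[of "nth bs" "[0..<m]"] by (auto simp: xs_def ys_def)
  have dist: "distinct (xs @ ys)" and set: "set (xs @ ys) = {..<m}"
    by (auto simp: xs_def ys_def)
  have sorted: "sorted_wrt (<) xs" "sorted_wrt (<) ys"
    by (auto simp: xs_def ys_def sorted_wrt_filter)
  define \<sigma> where "\<sigma> i = (if i < m then (xs @ ys) ! i else i)" for i
  have "bij_betw (nth (xs @ ys)) {..<m} {..<m}"
    by (rule bij_betw_nth[OF dist]) (use len(2) set in simp_all)
  then have "bij_betw \<sigma> {..<m} {..<m}"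
    by (subst bij_betw_cong[of _ _ "nth (xs @ ys)"]) (auto simp: \<sigma>_def)
  then have perm: "\<sigma> permutes {..<m}"
    by (rule bij_imp_permutes) (auto simp: \<sigma>_def)
  have "\<sigma> i < \<sigma> j" if "i < j" "j < p" for i j
    using that sorted(1) len p by (auto simp: \<sigma>_def nth_append sorted_wrt_iff_nth_less)
  moreover have "\<sigma> i < \<sigma> j" if "i < j" "j < m" "p \<le> i" for i j
    using that sorted(2) len p by (auto simp: \<sigma>_def nth_append sorted_wrt_iff_nth_less)
  ultimately have sh: "\<sigma> \<in> shuffles_perm p m"
    using perm by (auto simp: shuffles_perm_def intro!: strict_mono_onI)
  have "\<sigma> ` {..<p} = set xs"
    using len p by (auto simp: \<sigma>_def nth_append in_set_conv_nth image_iff)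
  then have "shuffle_bits m p \<sigma> = bs"
    by (intro nth_equalityI) (auto simp: shuffle_bits_def bs(1) xs_def)
  then show "bs \<in> shuffle_bits m p ` shuffles_perm p m" using sh by blast
qed

lemma bsets_UN: "bsets m = (\<Union>p\<in>{1..<m}. {bs. length bs = m \<and> length (filter (nth bs) [0..<m]) = p})"
proof -
  have "True \<in> set bs \<longleftrightarrow> 1 \<le> length (filter (nth bs) [0..<m])" if "length bs = m" for bs
    using that by (auto simp: Suc_le_eq filter_empty_conv in_set_conv_nth)
  moreover have "False \<in> set bs \<longleftrightarrow> length (filter (nth bs) [0..<m]) < m" if "length bs = m" for bs
  proof -
    have "length (filter (nth bs) [0..<m]) < m \<longleftrightarrow> length (filter (\<lambda>i. \<not> bs ! i) [0..<m]) > 0"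
      using sum_length_filter_compl[of "nth bs" "[0..<m]"] unfolding length_upt by linarith
    then show ?thesis using that by (auto simp: filter_empty_conv in_set_conv_nth)
  qed
  ultimately show ?thesis by (auto simp: bsets_def)
qed

text \<open>The number of marked positions is the outer index \<open>p\<close>. Through
  \<open>comult_class\<close> this removes shuffles from all later arguments.\<close>

lemma finsum_shuffles:
  assumes N: "is_vs N"
    and c: "\<And>bs. bs \<in> bsets m \<Longrightarrow> f bs \<in> carrier N"
    and F: "\<And>p \<sigma>. p \<in> {1..<m} \<Longrightarrow> \<sigma> \<in> shuffles_perm p m \<Longrightarrow> F p \<sigma> = f (shuffle_bits m p \<sigma>)"
  shows "(\<Oplus>\<^bsub>N\<^esub>p\<in>{1..<m}. \<Oplus>\<^bsub>N\<^esub>\<sigma>\<in>shuffles_perm p m. F p \<sigma>) = (\<Oplus>\<^bsub>N\<^esub>bs\<in>bsets m. f bs)"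
proof -
  interpret N: abelian_monoid N by (rule vs_abelian_monoid[OF N])
  let ?B = "\<lambda>p. {bs. length bs = m \<and> length (filter (nth bs) [0..<m]) = p}"
  have BU: "?B p \<subseteq> bsets m" if "p \<in> {1..<m}" for p
    using that by (subst bsets_UN) blast
  have im: "shuffle_bits m p ` shuffles_perm p m = ?B p" "inj_on (shuffle_bits m p) (shuffles_perm p m)"
    if "p \<in> {1..<m}" for p
    using shuffle_bits_bij[of p m] that by (auto simp: bij_betw_def)
  have 1: "(\<Oplus>\<^bsub>N\<^esub>\<sigma>\<in>shuffles_perm p m. F p \<sigma>) = (\<Oplus>\<^bsub>N\<^esub>bs\<in>?B p. f bs)" if p: "p \<in> {1..<m}" for p
  proof -
    have B: "f \<in> shuffle_bits m p ` shuffles_perm p m \<rightarrow> carrier N"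
      using im(1)[OF p] BU[OF p] c by blast
    have "(\<Oplus>\<^bsub>N\<^esub>\<sigma>\<in>shuffles_perm p m. F p \<sigma>) = (\<Oplus>\<^bsub>N\<^esub>\<sigma>\<in>shuffles_perm p m. f (shuffle_bits m p \<sigma>))"
      by (rule vs_finsum_cong[OF N refl]) (use F[OF p] B in auto)
    also have "\<dots> = (\<Oplus>\<^bsub>N\<^esub>bs\<in>?B p. f bs)"
      using N.finsum_reindex[OF B im(2)[OF p]] im(1)[OF p] by simp
    finally show ?thesis .
  qed
  have "(\<Oplus>\<^bsub>N\<^esub>p\<in>{1..<m}. \<Oplus>\<^bsub>N\<^esub>\<sigma>\<in>shuffles_perm p m. F p \<sigma>) = (\<Oplus>\<^bsub>N\<^esub>p\<in>{1..<m}. \<Oplus>\<^bsub>N\<^esub>bs\<in>?B p. f bs)"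
    by (rule vs_finsum_cong[OF N refl vs_finsum_closed[OF N] 1]) (use BU c in blast)
  also have "\<dots> = (\<Oplus>\<^bsub>N\<^esub>bs\<in>(\<Union>p\<in>{1..<m}. ?B p). f bs)"
  proof (rule N.finsum_UN_disjoint[symmetric])
    show "finite (?B i)" if "i \<in> {1..<m}" for i
      using BU[OF that] finite_bsets finite_subset by blast
    show "f x \<in> carrier N" if "i \<in> {1..<m}" "x \<in> ?B i" for i x
      using BU[OF that(1)] that(2) c by blast
  qed (auto simp: pairwise_def disjnt_def)
  finally show ?thesis by (simp only: bsets_UN[symmetric])
qed

section \<open>Words and graded symmetric multilinear maps\<close>

definition letters :: "('k, 'v) graded \<Rightarrow> 'v word set" where
  "letters V = {w. \<forall>(i, v)\<in>set w. v \<in> carrier (V i)}"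

lemma letters_simps [simp]:
  "[] \<in> letters V" "x # w \<in> letters V \<longleftrightarrow> snd x \<in> carrier (V (fst x)) \<and> w \<in> letters V"
  "u @ w \<in> letters V \<longleftrightarrow> u \<in> letters V \<and> w \<in> letters V"
  by (auto simp: letters_def)

text \<open>\<open>letters\<close> admits the empty word so that the contexts \<open>u\<close> and
  \<open>t\<close> around a letter may be empty; \<open>words\<close> does not, since the coalgebra
  is reduced.\<close>

lemma words_iff: "w \<in> words V \<longleftrightarrow> w \<noteq> [] \<and> w \<in> letters V"
  by (auto simp: words_def letters_def)

lemma letters_sel: "w \<in> letters V \<Longrightarrow> sel bs w \<in> letters V"
  using set_sel[of bs w] by (auto simp: letters_def)

lemma words_sel:
  assumes "w \<in> letters V" "bs \<in> bsets (length w)"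
  shows "sel bs w \<in> words V" "nsel bs w \<in> words V"
  using assms letters_sel[of w V] sel_ne[of bs w] nsel_ne[of bs w]
  by (auto simp: words_iff bsets_def)

lemma graded_vsD: "graded_vs V \<Longrightarrow> is_vs (V i)"
  by (simp add: graded_vs_def)

text \<open>Does to bit lists what the exchange of two neighbouring letters does to words.\<close>

definition swap_at :: "nat \<Rightarrow> 'a list \<Rightarrow> 'a list" where
  "swap_at k bs = take k bs @ [bs ! Suc k, bs ! k] @ drop (Suc (Suc k)) bs"

text \<open>The conditions under which a function on words respects \<open>sym_rels\<close> and so
  descends to \<open>Sym V\<close>.\<close>

definition sym_multilinear ::
    "('k::field_char_0, 'v) graded \<Rightarrow> ('k, 'z) module \<Rightarrow> ('v word \<Rightarrow> 'z) \<Rightarrow> bool" where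
  "sym_multilinear V N \<phi> \<longleftrightarrow>
     (\<forall>w\<in>words V. \<phi> w \<in> carrier N) \<and>
     (\<forall>u\<in>letters V. \<forall>t\<in>letters V. \<forall>i. linear_on (V i) N (\<lambda>x. \<phi> (u @ (i, x) # t))) \<and>
     (\<forall>u\<in>letters V. \<forall>t\<in>letters V. \<forall>x y. snd x \<in> carrier (V (fst x)) \<longrightarrow> snd y \<in> carrier (V (fst y)) \<longrightarrow>
        \<phi> (u @ x # y # t) = sg (fst x * fst y) \<odot>\<^bsub>N\<^esub> \<phi> (u @ y # x # t))"

lemma sym_multilinearD:
  assumes "sym_multilinear V N \<phi>"
  shows "w \<in> words V \<Longrightarrow> \<phi> w \<in> carrier N"
    and "u \<in> letters V \<Longrightarrow> t \<in> letters V \<Longrightarrow> linear_on (V i) N (\<lambda>x. \<phi> (u @ (i, x) # t))"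
    and "u \<in> letters V \<Longrightarrow> t \<in> letters V \<Longrightarrow> snd x \<in> carrier (V (fst x)) \<Longrightarrow> snd y \<in> carrier (V (fst y))
      \<Longrightarrow> \<phi> (u @ x # y # t) = sg (fst x * fst y) \<odot>\<^bsub>N\<^esub> \<phi> (u @ y # x # t)"
  using assms unfolding sym_multilinear_def by blast+

text \<open>The relations are homogeneous both in word length and in degree, so the factor may
  depend on both. Projections, signs and the inverse scalars of the decomposition are all of this
  kind.\<close>

lemma sym_multilinear_scale:
  assumes N: "is_vs N" and \<phi>: "sym_multilinear V N \<phi>"
  shows "sym_multilinear V N (\<lambda>w. c (length w) (wdeg w) \<odot>\<^bsub>N\<^esub> \<phi> w)"
  unfolding sym_multilinear_def
proof (intro conjI ballI allI impI)
  fix u t i assume "u \<in> letters V" "t \<in> letters V"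
  then show "linear_on (V i) N (\<lambda>x. c (length (u @ (i, x) # t)) (wdeg (u @ (i, x) # t)) \<odot>\<^bsub>N\<^esub> \<phi> (u @ (i, x) # t))"
    using linear_on_smult[OF N sym_multilinearD(2)[OF \<phi>]] by simp
next
  fix u t x y assume a: "u \<in> letters V" "t \<in> letters V" "snd x \<in> carrier (V (fst x))"
    "snd y \<in> carrier (V (fst y))"
  have "\<phi> (u @ y # x # t) \<in> carrier N"
    by (rule sym_multilinearD(1)[OF \<phi>]) (use a in \<open>simp add: words_iff\<close>)
  then show "c (length (u @ x # y # t)) (wdeg (u @ x # y # t)) \<odot>\<^bsub>N\<^esub> \<phi> (u @ x # y # t) = sg (fst x * fst y) \<odot>\<^bsub>N\<^esub>
      (c (length (u @ y # x # t)) (wdeg (u @ y # x # t)) \<odot>\<^bsub>N\<^esub> \<phi> (u @ y # x # t))"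
    by (simp add: sym_multilinearD(3)[OF \<phi> a] vs_smult_assoc[OF N] algebra_simps)
qed (use sym_multilinearD(1)[OF \<phi>] in \<open>auto intro: vs_smult_closed[OF N]\<close>)

lemma sym_multilinear_cong:
  assumes V: "graded_vs V" and \<phi>: "sym_multilinear V N \<phi>" and eq: "\<And>w. w \<in> words V \<Longrightarrow> \<phi> w = \<psi> w"
  shows "sym_multilinear V N \<psi>"
proof -
  have "linear_on (V i) N (\<lambda>x. \<psi> (u @ (i, x) # t))" if "u \<in> letters V" "t \<in> letters V" for u t i
    by (rule linear_on_cong[OF graded_vsD[OF V] sym_multilinearD(2)[OF \<phi> that]])
      (use that in \<open>auto simp: words_iff intro: eq\<close>)
  moreover have "\<psi> (u @ x # y # t) = sg (fst x * fst y) \<odot>\<^bsub>N\<^esub> \<psi> (u @ y # x # t)"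
    if "u \<in> letters V" "t \<in> letters V" "snd x \<in> carrier (V (fst x))" "snd y \<in> carrier (V (fst y))"
    for u t x y
    using sym_multilinearD(3)[OF \<phi> that] eq[of "u @ x # y # t"] eq[of "u @ y # x # t"] that
    by (simp add: words_iff)
  moreover have "\<psi> w \<in> carrier N" if "w \<in> words V" for w
    using sym_multilinearD(1)[OF \<phi> that] eq[OF that] by simp
  ultimately show ?thesis
    unfolding sym_multilinear_def by blast
qed

lemma sym_rels_cases:
  assumes "r \<in> sym_rels V"
  obtains (add) u i x y t where "u \<in> letters V" "t \<in> letters V" "x \<in> carrier (V i)" "y \<in> carrier (V i)"
      "r = Poly_Mapping.single (u @ (i, x \<oplus>\<^bsub>V i\<^esub> y) # t) 1 - Poly_Mapping.single (u @ (i, x) # t) 1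
        - Poly_Mapping.single (u @ (i, y) # t) 1"
    | (smult) u i a x t where "u \<in> letters V" "t \<in> letters V" "x \<in> carrier (V i)"
      "r = Poly_Mapping.single (u @ (i, a \<odot>\<^bsub>V i\<^esub> x) # t) 1 - Poly_Mapping.single (u @ (i, x) # t) a"
    | (swap) u x y t where "u \<in> letters V" "t \<in> letters V" "snd x \<in> carrier (V (fst x))"
      "snd y \<in> carrier (V (fst y))"
      "r = Poly_Mapping.single (u @ x # y # t) 1 - Poly_Mapping.single (u @ y # x # t) (sg (fst x * fst y))"
  using assms unfolding sym_rels_def words_iff sg_def[symmetric]
  apply (elim UnE CollectE exE conjE)
  subgoal for u i x y t by (rule that(1)[of u t x i y]) simp_all
  subgoal for u i a x t by (rule that(2)[of u t x i a]) simp_all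
  subgoal for u x y t by (rule that(3)[of u t x y]) simp_all
  done

lemma sym_relsI:
  assumes "u \<in> letters V" "t \<in> letters V"
  shows "x \<in> carrier (V i) \<Longrightarrow> y \<in> carrier (V i) \<Longrightarrow>
      Poly_Mapping.single (u @ (i, x \<oplus>\<^bsub>V i\<^esub> y) # t) 1 - Poly_Mapping.single (u @ (i, x) # t) 1
        - Poly_Mapping.single (u @ (i, y) # t) 1 \<in> sym_rels V"
    and "x \<in> carrier (V i) \<Longrightarrow>
      Poly_Mapping.single (u @ (i, a \<odot>\<^bsub>V i\<^esub> x) # t) 1 - Poly_Mapping.single (u @ (i, x) # t) a \<in> sym_rels V"
    and "snd p \<in> carrier (V (fst p)) \<Longrightarrow> snd q \<in> carrier (V (fst q)) \<Longrightarrow>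
      Poly_Mapping.single (u @ p # q # t) 1 - Poly_Mapping.single (u @ q # p # t) (sg (fst p * fst q))
        \<in> sym_rels V"
proof -
  show "x \<in> carrier (V i) \<Longrightarrow> y \<in> carrier (V i) \<Longrightarrow>
      Poly_Mapping.single (u @ (i, x \<oplus>\<^bsub>V i\<^esub> y) # t) 1 - Poly_Mapping.single (u @ (i, x) # t) 1
        - Poly_Mapping.single (u @ (i, y) # t) 1 \<in> sym_rels V"
    unfolding sym_rels_def words_iff
    by (rule UnI1, rule UnI1, rule CollectI, rule exI[of _ u], rule exI[of _ i], rule exI[of _ x],
        rule exI[of _ y], rule exI[of _ t]) (use assms in simp)
  show "x \<in> carrier (V i) \<Longrightarrow>
      Poly_Mapping.single (u @ (i, a \<odot>\<^bsub>V i\<^esub> x) # t) 1 - Poly_Mapping.single (u @ (i, x) # t) a \<in> sym_rels V"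
    unfolding sym_rels_def words_iff
    by (rule UnI1, rule UnI2, rule CollectI, rule exI[of _ u], rule exI[of _ i], rule exI[of _ a],
        rule exI[of _ x], rule exI[of _ t]) (use assms in simp)
  show "snd p \<in> carrier (V (fst p)) \<Longrightarrow> snd q \<in> carrier (V (fst q)) \<Longrightarrow>
      Poly_Mapping.single (u @ p # q # t) 1 - Poly_Mapping.single (u @ q # p # t) (sg (fst p * fst q))
        \<in> sym_rels V"
    unfolding sym_rels_def words_iff sg_def
    by (rule UnI2, rule CollectI, rule exI[of _ u], rule exI[of _ p], rule exI[of _ q],
        rule exI[of _ t]) (use assms in simp)
qed

context
  fixes V :: "('k::field_char_0, 'v) graded"
  assumes V: "graded_vs V"
begin

lemma sym_rels_carrier: "sym_rels V \<subseteq> carrier (free_module (words V))"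
proof
  fix r :: "'v word \<Rightarrow>\<^sub>0 'k" assume "r \<in> sym_rels V"
  then show "r \<in> carrier (free_module (words V))"
    by (cases rule: sym_rels_cases; simp only: free_simps mem_Collect_eq)
      (intro keys_diff_sub keys_single_sub; simp add: words_iff vs_closed[OF graded_vsD[OF V]])+
qed

lemma Sym_is_vs: "is_vs (Sym V)"
  unfolding Sym_def by (rule presented_is_vs[OF sym_rels_carrier])

lemma sym_class_closed: "w \<in> words V \<Longrightarrow> sym_class V w \<in> carrier (Sym V)"
  unfolding Sym_def sym_class_def by (rule gen_class_closed[OF sym_rels_carrier])

lemma Sym_eq:
  assumes "is_vs N" "linear_on (Sym V) N f" "linear_on (Sym V) N g"
    and "\<And>w. w \<in> words V \<Longrightarrow> f (sym_class V w) = g (sym_class V w)" and "Z \<in> carrier (Sym V)"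
  shows "f Z = g Z"
  using assms presented_eq[OF sym_rels_carrier, of N f g Z] by (auto simp: Sym_def sym_class_def)

lemma Sym_ext:
  fixes N :: "('k, 'z) module"
  assumes N: "is_vs N" and \<phi>: "sym_multilinear V N \<phi>"
  shows Sym_ext_linear: "linear_on (Sym V) N (ext_gen N \<phi>)"
    and Sym_ext_class: "w \<in> words V \<Longrightarrow> ext_gen N \<phi> (sym_class V w) = \<phi> w"
proof -
  note c = sym_multilinearD(1)[OF \<phi>]
  have "lin_ext N \<phi> r = \<zero>\<^bsub>N\<^esub>" if "r \<in> sym_rels V" for r
    using that
  proof (cases rule: sym_rels_cases)
    case (add u i x y t)
    then show ?thesis
      using linear_onD(2)[OF sym_multilinearD(2)[OF \<phi> add(1,2)], of x i y]
        c[of "u @ (i, x) # t"] c[of "u @ (i, y) # t"]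
      by (simp only:, subst lin_ext_rel3[OF N])
        (auto simp: words_iff vs_closed[OF graded_vsD[OF V]] vs_closed[OF N])
  next
    case (smult u i a x t)
    then show ?thesis
      using linear_onD(3)[OF sym_multilinearD(2)[OF \<phi> smult(1,2)], of x i a] c[of "u @ (i, x) # t"]
      by (simp only:, subst lin_ext_rel2[OF N])
        (auto simp: words_iff vs_closed[OF graded_vsD[OF V]] vs_closed[OF N])
  next
    case (swap u x y t)
    then show ?thesis
      using sym_multilinearD(3)[OF \<phi> swap(1-4)] c[of "u @ x # y # t"] c[of "u @ y # x # t"]
      by (simp only:, subst lin_ext_rel2[OF N]) (auto simp: words_iff vs_closed[OF N])
  qed
  note * = ext_gen_props[OF sym_rels_carrier N c this]
  show "linear_on (Sym V) N (ext_gen N \<phi>)" unfolding Sym_def by (rule *(1))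
  show "w \<in> words V \<Longrightarrow> ext_gen N \<phi> (sym_class V w) = \<phi> w"
    unfolding sym_class_def by (rule *(2))
qed

lemma sym_multilinear_class: "sym_multilinear V (Sym V) (sym_class V)"
proof -
  note S = Sym_is_vs
  have rel: "lin_ext (Sym V) (sym_class V) r = \<zero>\<^bsub>Sym V\<^esub>" if "r \<in> sym_rels V" for r
    using gen_class_relation[OF sym_rels_carrier that]
    by (simp add: Sym_def sym_class_def[abs_def])
  note cl = sym_class_closed words_iff vs_closed[OF graded_vsD[OF V]]
  show ?thesis
    unfolding sym_multilinear_def linear_on_def
  proof (intro conjI ballI allI impI)
    fix u t i x y assume a: "u \<in> letters V" "t \<in> letters V" "x \<in> carrier (V i)" "y \<in> carrier (V i)"
    show "sym_class V (u @ (i, x \<oplus>\<^bsub>V i\<^esub> y) # t)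
        = sym_class V (u @ (i, x) # t) \<oplus>\<^bsub>Sym V\<^esub> sym_class V (u @ (i, y) # t)"
      using rel[OF sym_relsI(1)[OF a]] by (subst (asm) lin_ext_rel3[OF S]) (use a in \<open>auto simp: cl\<close>)
  next
    fix u t i a x assume a: "u \<in> letters V" "t \<in> letters V" "x \<in> carrier (V i)"
    show "sym_class V (u @ (i, a \<odot>\<^bsub>V i\<^esub> x) # t) = a \<odot>\<^bsub>Sym V\<^esub> sym_class V (u @ (i, x) # t)"
      using rel[OF sym_relsI(2)[OF a, of a]] by (subst (asm) lin_ext_rel2[OF S]) (use a in \<open>auto simp: cl\<close>)
  next
    fix u t x y assume a: "u \<in> letters V" "t \<in> letters V" "snd x \<in> carrier (V (fst x))"
      "snd y \<in> carrier (V (fst y))"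
    show "sym_class V (u @ x # y # t) = sg (fst x * fst y) \<odot>\<^bsub>Sym V\<^esub> sym_class V (u @ y # x # t)"
      using rel[OF sym_relsI(3)[OF a]] by (subst (asm) lin_ext_rel2[OF S]) (use a in \<open>auto simp: cl\<close>)
  qed (auto simp: cl)
qed

lemma Sym2_is_vs: "is_vs (Sym2 V)"
  by (intro tensor_is_vs Sym_is_vs)

section \<open>The coproduct\<close>

definition unshuffle_term where
  "unshuffle_term w bs = ksgn bs w \<odot>\<^bsub>Sym2 V\<^esub>
     tens (Sym V) (Sym V) (sym_class V (sel bs w)) (sym_class V (nsel bs w))"

text \<open>The reduced coproduct of the class of \<open>w\<close>, written with bit lists;
  \<open>comult_class\<close> identifies it with the official one.\<close>

definition unshuffle where
  "unshuffle w = (\<Oplus>\<^bsub>Sym2 V\<^esub>bs\<in>bsets (length w). unshuffle_term w bs)"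

lemma unshuffle_term_closed:
  assumes "w \<in> letters V" "bs \<in> bsets (length w)"
  shows "unshuffle_term w bs \<in> carrier (Sym2 V)"
  unfolding unshuffle_term_def
  by (intro vs_smult_closed[OF Sym2_is_vs] tens_closed Sym_is_vs sym_class_closed words_sel[OF assms])

lemma unshuffle_closed: "w \<in> letters V \<Longrightarrow> unshuffle w \<in> carrier (Sym2 V)"
  unfolding unshuffle_def by (intro vs_finsum_closed[OF Sym2_is_vs] unshuffle_term_closed)

text \<open>In each term the varying letter lies in exactly one factor; the other factor and the
  sign stay fixed.\<close>

lemma unshuffle_linear:
  assumes u: "u \<in> letters V" and t: "t \<in> letters V"
  shows "linear_on (V i) (Sym2 V) (\<lambda>x. unshuffle (u @ (i, x) # t))"
proof -
  note S = Sym_is_vs and S2 = Sym2_is_vs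
  let ?w = "\<lambda>x. u @ (i, x) # t"
  have "linear_on (V i) (Sym2 V) (\<lambda>x. unshuffle_term (?w x) bs)" if bs: "bs \<in> bsets (length u + Suc (length t))" for bs
  proof -
    define bu where "bu = take (length u) bs"
    define c where "c = bs ! length u"
    define bt where "bt = drop (Suc (length u)) bs"
    have len: "length bs = length u + Suc (length t)" using bs by (simp add: bsets_def)
    then have e: "bs = bu @ c # bt" "length bu = length u" "length bt = length t"
      by (auto simp: bu_def c_def bt_def id_take_nth_drop[symmetric])
    have z: "\<zero>\<^bsub>V i\<^esub> \<in> carrier (V i)" by (rule vs_zero_closed[OF graded_vsD[OF V]])
    have w0: "?w \<zero>\<^bsub>V i\<^esub> \<in> letters V" "bs \<in> bsets (length (?w \<zero>\<^bsub>V i\<^esub>))" using u t z bs by auto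
    define k0 :: 'k where "k0 = ksgn bs (?w \<zero>\<^bsub>V i\<^esub>)"
    have ks: "ksgn bs (?w x) = k0" for x unfolding k0_def by (rule ksgn_cong) simp
    have T: "bilinear_on (Sym V) (Sym V) (Sym2 V) (tens (Sym V) (Sym V))"
      by (rule tens_bilinear[OF S S])
    have lin: "linear_on (V i) (Sym V) (\<lambda>x. sym_class V (sel b u @ (i, x) # sel b' t))" for b b'
      by (rule sym_multilinearD(2)[OF sym_multilinear_class]) (use u t in \<open>auto intro: letters_sel\<close>)
    have "linear_on (V i) (Sym2 V) (\<lambda>x. tens (Sym V) (Sym V) (sym_class V (sel bs (?w x))) (sym_class V (nsel bs (?w x))))"
    proof (cases c)
      case True
      define c0 where "c0 = nsel bs (?w \<zero>\<^bsub>V i\<^esub>)"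
      have "nsel bs (?w x) = c0" "sel bs (?w x) = sel bu u @ (i, x) # sel bt t" for x
        using e True by (auto simp: sel_append c0_def)
      moreover have "c0 \<in> words V" using words_sel(2)[OF w0] by (simp add: c0_def)
      ultimately show ?thesis
        using linear_on_comp[OF lin bilinear_onD(1)[OF T sym_class_closed[of c0]]] by simp
    next
      case False
      define c0 where "c0 = sel bs (?w \<zero>\<^bsub>V i\<^esub>)"
      have "sel bs (?w x) = c0" "nsel bs (?w x) = nsel bu u @ (i, x) # nsel bt t" for x
        using e False by (auto simp: sel_append c0_def)
      moreover have "c0 \<in> words V" using words_sel(1)[OF w0] by (simp add: c0_def)
      ultimately show ?thesis
        using linear_on_comp[OF lin bilinear_onD(2)[OF T sym_class_closed[of c0]]] by simp
    qed
    then show ?thesis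
      unfolding unshuffle_term_def ks by (rule linear_on_smult[OF S2])
  qed
  then show ?thesis
    unfolding unshuffle_def
    using linear_on_finsum_fun[OF graded_vsD[OF V] S2, of "bsets (length u + Suc (length t))" i
        "\<lambda>bs x. unshuffle_term (?w x) bs"] by simp
qed

text \<open>Letters and bits are exchanged simultaneously. If both letters go to the same factor,
  the sign comes from the symmetry relation there; if they are separated, it comes from
  \<open>ksgn\<close>.\<close>

lemma unshuffle_swap:
  assumes u: "u \<in> letters V" and t: "t \<in> letters V"
    and x: "snd x \<in> carrier (V (fst x))" and y: "snd y \<in> carrier (V (fst y))"
  shows "unshuffle (u @ x # y # t) = sg (fst x * fst y) \<odot>\<^bsub>Sym2 V\<^esub> unshuffle (u @ y # x # t)"
proof -
  note S = Sym_is_vs and S2 = Sym2_is_vs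
  interpret A: abelian_monoid "Sym2 V" by (rule vs_abelian_monoid[OF S2])
  let ?w = "u @ x # y # t" and ?w' = "u @ y # x # t" and ?s = "sg (fst x * fst y) :: 'k"
  let ?k = "length u"
  define n where "n = length u + Suc (Suc (length t))"
  have n: "length ?w = n" "length ?w' = n" by (auto simp: n_def)
  have w: "?w \<in> letters V" "?w' \<in> letters V" using u t x y by auto
  have dec: "\<exists>bu c d bt. bs = bu @ c # d # bt \<and> length bu = ?k \<and> length bt = length t" if "length bs = n" for bs :: "bool list"
  proof -
    have "bs = take ?k bs @ bs ! ?k # bs ! Suc ?k # drop (Suc (Suc ?k)) bs"
      using that by (simp add: n_def Cons_nth_drop_Suc)
    then show ?thesis using that by (intro exI conjI) (auto simp: n_def)
  qed
  have swp: "swap_at ?k (bu @ c # d # bt) = bu @ d # c # bt" if "length bu = ?k" for bu bt :: "bool list" and c d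
    using that by (simp add: swap_at_def nth_append)
  have term_eq: "unshuffle_term ?w bs = ?s \<odot>\<^bsub>Sym2 V\<^esub> unshuffle_term ?w' (swap_at ?k bs)"
    and sw_in: "swap_at ?k bs \<in> bsets n" and sw_sw: "swap_at ?k (swap_at ?k bs) = bs"
    if bs: "bs \<in> bsets n" for bs
  proof -
    obtain bu c d bt where e: "bs = bu @ c # d # bt" "length bu = ?k" "length bt = length t"
      using dec[of bs] bs by (auto simp: bsets_def)
    show in': "swap_at ?k bs \<in> bsets n" using bs e by (auto simp: swp bsets_def)
    show "swap_at ?k (swap_at ?k bs) = bs" using e by (simp add: swp)
    have wd: "sel bs ?w \<in> words V" "nsel bs ?w \<in> words V"
      "sel (swap_at ?k bs) ?w' \<in> words V" "nsel (swap_at ?k bs) ?w' \<in> words V"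
      using words_sel[OF w(1)] words_sel[OF w(2)] bs in' n by auto
    note cc = this[THEN sym_class_closed]
    note lin1 = linear_onD(3)[OF bilinear_onD(1)[OF tens_bilinear[OF S S]]]
    note lin2 = linear_onD(3)[OF bilinear_onD(2)[OF tens_bilinear[OF S S]]]
    note sw = sym_multilinearD(3)[OF sym_multilinear_class letters_sel letters_sel x y, OF u t]
    have tc: "tens (Sym V) (Sym V) (sym_class V (sel (swap_at ?k bs) ?w'))
        (sym_class V (nsel (swap_at ?k bs) ?w')) \<in> carrier (Sym2 V)"
      by (rule tens_closed[OF S S cc(3,4)])
    consider "c" "d" | "c" "\<not> d" | "\<not> c" "d" | "\<not> c" "\<not> d" by blast
    then show "unshuffle_term ?w bs = ?s \<odot>\<^bsub>Sym2 V\<^esub> unshuffle_term ?w' (swap_at ?k bs)"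
    proof cases
      case 1
      have "sym_class V (sel bs ?w) = ?s \<odot>\<^bsub>Sym V\<^esub> sym_class V (sel (swap_at ?k bs) ?w')"
        using sw[of bu bt] 1 e by (simp add: swp sel_append)
      moreover have "nsel bs ?w = nsel (swap_at ?k bs) ?w'" "ksgn bs ?w = (ksgn (swap_at ?k bs) ?w' :: 'k)"
        using 1 e by (auto simp: swp sel_append ksgn_append algebra_simps)
      ultimately show ?thesis
        using tc by (simp add: unshuffle_term_def lin1[OF cc(4,3)] vs_smult_assoc[OF S2] mult.commute)
    next
      case 2
      have "sel bs ?w = sel (swap_at ?k bs) ?w'" "nsel bs ?w = nsel (swap_at ?k bs) ?w'"
        "ksgn bs ?w = ?s * (ksgn (swap_at ?k bs) ?w' :: 'k)"
        using 2 e by (auto simp: swp sel_append ksgn_append sg_add algebra_simps)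
      then show ?thesis
        using tc by (simp add: unshuffle_term_def vs_smult_assoc[OF S2])
    next
      case 3
      have "sel bs ?w = sel (swap_at ?k bs) ?w'" "nsel bs ?w = nsel (swap_at ?k bs) ?w'"
        "ksgn bs ?w = ?s * (ksgn (swap_at ?k bs) ?w' :: 'k)"
        using 3 e by (auto simp: swp sel_append ksgn_append sg_add algebra_simps)
      then show ?thesis
        using tc by (simp add: unshuffle_term_def vs_smult_assoc[OF S2])
    next
      case 4
      have "sym_class V (nsel bs ?w) = ?s \<odot>\<^bsub>Sym V\<^esub> sym_class V (nsel (swap_at ?k bs) ?w')"
        using sw[of "map Not bu" "map Not bt"] 4 e by (simp add: swp sel_append)
      moreover have "sel bs ?w = sel (swap_at ?k bs) ?w'" "ksgn bs ?w = (ksgn (swap_at ?k bs) ?w' :: 'k)"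
        using 4 e by (auto simp: swp sel_append ksgn_append algebra_simps)
      ultimately show ?thesis
        using tc by (simp add: unshuffle_term_def lin2[OF cc(3,4)] vs_smult_assoc[OF S2] mult.commute)
    qed
  qed
  \<comment> \<open>The exchange of bits is an involution of the index set, so the sum may be
    reindexed along it.\<close>
  have img: "swap_at ?k ` bsets n = bsets n"
  proof
    show "swap_at ?k ` bsets n \<subseteq> bsets n" using sw_in by auto
    show "bsets n \<subseteq> swap_at ?k ` bsets n"
    proof
      fix bs assume "bs \<in> bsets n"
      then show "bs \<in> swap_at ?k ` bsets n"
        by (intro image_eqI[of bs _ "swap_at ?k bs"] sw_sw[symmetric] sw_in)
    qed
  qed
  have inj: "inj_on (swap_at ?k) (bsets n)"
    by (rule inj_on_inverseI[of _ "swap_at ?k"]) (rule sw_sw)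
  have cl: "unshuffle_term ?w' bs \<in> carrier (Sym2 V)" if "bs \<in> bsets n" for bs
    using unshuffle_term_closed[OF w(2)] that n by simp
  have "unshuffle ?w = (\<Oplus>\<^bsub>Sym2 V\<^esub>bs\<in>bsets n. ?s \<odot>\<^bsub>Sym2 V\<^esub> unshuffle_term ?w' (swap_at ?k bs))"
    unfolding unshuffle_def n
    by (rule vs_finsum_cong[OF S2 refl vs_smult_closed[OF S2 cl] term_eq]) (use sw_in in auto)
  also have "\<dots> = ?s \<odot>\<^bsub>Sym2 V\<^esub> (\<Oplus>\<^bsub>Sym2 V\<^esub>bs\<in>bsets n. unshuffle_term ?w' (swap_at ?k bs))"
    by (rule module.finsum_smult_ldistr[OF S2, symmetric]) (use cl sw_in in auto)
  also have "(\<Oplus>\<^bsub>Sym2 V\<^esub>bs\<in>bsets n. unshuffle_term ?w' (swap_at ?k bs)) = unshuffle ?w'"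
    unfolding unshuffle_def n
    using A.finsum_reindex[of "unshuffle_term ?w'" "swap_at ?k" "bsets n"] img inj cl by auto
  finally show ?thesis .
qed

lemma sym_multilinear_unshuffle: "sym_multilinear V (Sym2 V) unshuffle"
  unfolding sym_multilinear_def
  by (intro conjI ballI allI impI unshuffle_closed unshuffle_linear unshuffle_swap)
    (simp_all add: words_iff)

text \<open>\<open>ext_gen\<close> is meaningful only for functions that respect the relations. The
  shuffle formula inherits this from \<open>unshuffle\<close>, with which it agrees on
  words.\<close>

lemma comult_linear: "linear_on (Sym V) (Sym2 V) (comult V)"
  and comult_class: "w \<in> words V \<Longrightarrow> comult V (sym_class V w) = unshuffle w"
proof -
  have eq: "unshuffle w = (\<Oplus>\<^bsub>Sym2 V\<^esub>p\<in>{1..<length w}. \<Oplus>\<^bsub>Sym2 V\<^esub>\<sigma>\<in>shuffles_perm p (length w).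
       koszul \<sigma> w \<odot>\<^bsub>Sym2 V\<^esub>
         tens (Sym V) (Sym V)
           (sym_class V (map (\<lambda>i. w ! \<sigma> i) [0..<p]))
           (sym_class V (map (\<lambda>i. w ! \<sigma> i) [p..<length w])))" if "w \<in> words V" for w
    unfolding unshuffle_def
  proof (rule finsum_shuffles[OF Sym2_is_vs, symmetric])
    show "unshuffle_term w bs \<in> carrier (Sym2 V)" if "bs \<in> bsets (length w)" for bs
      using unshuffle_term_closed \<open>w \<in> words V\<close> that by (auto simp: words_iff)
  qed (simp add: shuffle_sel shuffle_koszul unshuffle_term_def)
  note sml = sym_multilinear_cong[OF V sym_multilinear_unshuffle eq]
  show "linear_on (Sym V) (Sym2 V) (comult V)"
    unfolding comult_def by (rule Sym_ext_linear[OF Sym2_is_vs sml])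
  show "w \<in> words V \<Longrightarrow> comult V (sym_class V w) = unshuffle w"
    unfolding comult_def using Sym_ext_class[OF Sym2_is_vs sml] eq by simp
qed

end

section \<open>Scalings, projection and sign on the symmetric coalgebra\<close>

lemma vs_finsum_const:
  assumes N: "is_vs N" and "finite A" and x: "x \<in> carrier N"
  shows "(\<Oplus>\<^bsub>N\<^esub>i\<in>A. x) = of_nat (card A) \<odot>\<^bsub>N\<^esub> x"
  using \<open>finite A\<close>
proof (induction A rule: finite_induct)
  case empty
  then show ?case using x by (simp add: vs_finsum_empty[OF N] vs_simps[OF N])
next
  case (insert a A)
  then show ?case
    using x by (simp add: vs_finsum_insert[OF N] vs_smult_l[OF N] vs_smult_one[OF N])
qed

text \<open>The cardinality is \<open>2^n - 2\<close>; one explicit member is enough to see that it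
  does not vanish.\<close>

lemma card_bsets_pos: "2 \<le> n \<Longrightarrow> card (bsets n) \<noteq> 0"
proof -
  assume "2 \<le> n"
  then have "True # replicate (n - 1) False \<in> bsets n" by (auto simp: bsets_def)
  then show ?thesis using finite_bsets[of n] by (metis card_eq_0_iff empty_iff)
qed

definition Sym_scale :: "('k::field_char_0, 'v) graded \<Rightarrow> (nat \<Rightarrow> int \<Rightarrow> 'k) \<Rightarrow>
    ('v word \<Rightarrow>\<^sub>0 'k) set \<Rightarrow> ('v word \<Rightarrow>\<^sub>0 'k) set" where
  "Sym_scale V c = ext_gen (Sym V) (\<lambda>w. c (length w) (wdeg w) \<odot>\<^bsub>Sym V\<^esub> sym_class V w)"

text \<open>\<open>ext_gen\<close> extends functions of a single word, so the product is extended
  one argument at a time: first in the right factor for a fixed word on the left, then in the left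
  factor, finally to the tensor product.\<close>

definition Sym_mult_word :: "('k::field_char_0, 'v) graded \<Rightarrow> 'v word \<Rightarrow>
    ('v word \<Rightarrow>\<^sub>0 'k) set \<Rightarrow> ('v word \<Rightarrow>\<^sub>0 'k) set" where
  "Sym_mult_word V u = ext_gen (Sym V) (\<lambda>v. sym_class V (u @ v))"

definition Sym_mult_aux :: "('k::field_char_0, 'v) graded \<Rightarrow> ('v word \<Rightarrow>\<^sub>0 'k) set \<Rightarrow>
    ('v word \<Rightarrow>\<^sub>0 'k) set \<Rightarrow> ('v word \<Rightarrow>\<^sub>0 'k) set" where
  "Sym_mult_aux V P Q = ext_gen (Sym V) (\<lambda>u. Sym_mult_word V u Q) P"

definition Sym_mult :: "('k::field_char_0, 'v) graded \<Rightarrow>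
    (('v word \<Rightarrow>\<^sub>0 'k) set \<times> ('v word \<Rightarrow>\<^sub>0 'k) set \<Rightarrow>\<^sub>0 'k) set \<Rightarrow> ('v word \<Rightarrow>\<^sub>0 'k) set" where
  "Sym_mult V = ext_gen (Sym V) (\<lambda>(P, Q). Sym_mult_aux V P Q)"

context
  fixes V :: "('k::field_char_0, 'v) graded"
  assumes V: "graded_vs V"
begin

private lemmas S = Sym_is_vs[OF V]
private lemmas S2 = Sym2_is_vs[OF V]
private lemmas sml_class = sym_multilinear_class[OF V]

lemma sym_class_zero:
  assumes "u \<in> letters V" "t \<in> letters V"
  shows "sym_class V (u @ (i, \<zero>\<^bsub>V i\<^esub>) # t) = \<zero>\<^bsub>Sym V\<^esub>"
  using linear_on_zero[OF graded_vsD[OF V] S sym_multilinearD(2)[OF sml_class assms]] .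

lemma Sym_scale_linear: "linear_on (Sym V) (Sym V) (Sym_scale V c)"
  and Sym_scale_class: "w \<in> words V \<Longrightarrow>
    Sym_scale V c (sym_class V w) = c (length w) (wdeg w) \<odot>\<^bsub>Sym V\<^esub> sym_class V w"
proof -
  note * = sym_multilinear_scale[OF S sml_class, of c]
  show "linear_on (Sym V) (Sym V) (Sym_scale V c)"
    unfolding Sym_scale_def by (rule Sym_ext_linear[OF V S *])
  show "w \<in> words V \<Longrightarrow> Sym_scale V c (sym_class V w) = c (length w) (wdeg w) \<odot>\<^bsub>Sym V\<^esub> sym_class V w"
    unfolding Sym_scale_def by (rule Sym_ext_class[OF V S *])
qed

lemma Sym_pr1_linear: "linear_on (Sym V) (Sym V) (Sym_pr1 V)"
  and Sym_pr1_class: "w \<in> words V \<Longrightarrow>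
    Sym_pr1 V (sym_class V w) = (if length w = 1 then sym_class V w else \<zero>\<^bsub>Sym V\<^esub>)"
proof -
  let ?\<phi> = "\<lambda>w. if length w = 1 then sym_class V w else \<zero>\<^bsub>Sym V\<^esub>"
  have *: "sym_multilinear V (Sym V) ?\<phi>"
    by (rule sym_multilinear_cong[OF V sym_multilinear_scale[OF S sml_class, of "\<lambda>k _. if k = 1 then 1 else 0"]])
      (auto simp: sym_class_closed[OF V] vs_simps[OF S])
  show "linear_on (Sym V) (Sym V) (Sym_pr1 V)"
    unfolding Sym_pr1_def by (rule Sym_ext_linear[OF V S *])
  show "w \<in> words V \<Longrightarrow> Sym_pr1 V (sym_class V w) = ?\<phi> w"
    unfolding Sym_pr1_def by (rule Sym_ext_class[OF V S *])
qed

lemma Sym_sign_linear: "linear_on (Sym V) (Sym V) (Sym_sign V)"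
  and Sym_sign_class: "w \<in> words V \<Longrightarrow>
    Sym_sign V (sym_class V w) = sg (wdeg w) \<odot>\<^bsub>Sym V\<^esub> sym_class V w"
  using Sym_scale_linear[of "\<lambda>_. sg"] Sym_scale_class[of w "\<lambda>_. sg"]
  by (simp_all add: Sym_sign_def Sym_scale_def sg_def)

text \<open>\<open>Sym_deg\<close> is a span of word classes and the preimage of a subspace is a
  subspace, so the effect on degrees can be tested on words.\<close>

lemma Sym_deg_map:
  assumes W: "graded_vs W" and A: "linear_on (Sym V) (Sym W) A"
    and w: "\<And>w. w \<in> words V \<Longrightarrow> wdeg w = j \<Longrightarrow> A (sym_class V w) \<in> Sym_deg W j'"
    and Z: "Z \<in> Sym_deg V j"
  shows "A Z \<in> Sym_deg W j'"
proof -
  have "submodule (Sym_deg W j') ring_of_type_algebra (Sym W)"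
    unfolding Sym_deg_def by (rule vspan_submodule[OF Sym_is_vs[OF W]]) (auto intro: sym_class_closed[OF W])
  then have "submodule {z \<in> carrier (Sym V). A z \<in> Sym_deg W j'} ring_of_type_algebra (Sym V)"
    by (rule linear_preimage_submodule[OF S Sym_is_vs[OF W] A])
  then have "Sym_deg V j \<subseteq> {z \<in> carrier (Sym V). A z \<in> Sym_deg W j'}"
    unfolding Sym_deg_def[of V j] by (rule vspan_subset[OF S]) (auto intro: w sym_class_closed[OF V])
  then show ?thesis using Z by auto
qed

lemma Sym_deg_class: "w \<in> words V \<Longrightarrow> sym_class V w \<in> Sym_deg V (wdeg w)"
  unfolding Sym_deg_def by (rule vspan_inc) auto

lemma sym_class_move:
  assumes "u \<in> letters V" "a \<in> letters V" "snd x \<in> carrier (V (fst x))" "t \<in> letters V"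
  shows "sym_class V (u @ a @ x # t) = sg (fst x * wdeg a) \<odot>\<^bsub>Sym V\<^esub> sym_class V (u @ x # a @ t)"
  using assms
proof (induction a arbitrary: u)
  case Nil
  then show ?case by (simp add: vs_smult_one[OF S] sym_class_closed[OF V] words_iff)
next
  case (Cons y a)
  have c: "sym_class V (u @ x # y # a @ t) \<in> carrier (Sym V)"
    using Cons.prems by (intro sym_class_closed[OF V]) (auto simp: words_iff)
  have "sym_class V (u @ (y # a) @ x # t) = sg (fst x * wdeg a) \<odot>\<^bsub>Sym V\<^esub> sym_class V (u @ y # x # a @ t)"
    using Cons.IH[of "u @ [y]"] Cons.prems by simp
  also have "sym_class V (u @ y # x # a @ t) = sg (fst y * fst x) \<odot>\<^bsub>Sym V\<^esub> sym_class V (u @ x # y # a @ t)"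
    by (rule sym_multilinearD(3)[OF sml_class]) (use Cons.prems in auto)
  finally show ?case
    using c by (simp add: vs_smult_assoc[OF S] sg_add algebra_simps)
qed

text \<open>Each unselected letter is moved back to the front of the selected ones behind it; the
  sign so collected is \<open>ksgn\<close>, and it squares to one. The prefix \<open>u\<close> holds
  the letters already in place.\<close>

lemma unshuffle_reassemble:
  assumes "length bs = length w" "w \<in> letters V" "u \<in> letters V" "u @ w \<noteq> []"
  shows "ksgn bs w \<odot>\<^bsub>Sym V\<^esub> sym_class V (u @ sel bs w @ nsel bs w) = sym_class V (u @ w)"
  using assms
proof (induction bs w arbitrary: u rule: list_induct2)
  case Nil
  then show ?case by (simp add: vs_smult_one[OF S] sym_class_closed[OF V] words_iff)
next
  case (Cons b bs x w)
  have IH: "ksgn bs w \<odot>\<^bsub>Sym V\<^esub> sym_class V (u @ x # sel bs w @ nsel bs w) = sym_class V (u @ x # w)"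
    using Cons.IH[of "u @ [x]"] Cons.prems by simp
  have l: "sel bs w \<in> letters V" "nsel bs w \<in> letters V"
    using Cons.prems by (auto intro: letters_sel)
  show ?case
  proof (cases b)
    case True
    then show ?thesis using IH by simp
  next
    case False
    have c: "sym_class V (u @ x # sel bs w @ nsel bs w) \<in> carrier (Sym V)"
      using Cons.prems l by (intro sym_class_closed[OF V]) (auto simp: words_iff)
    have "sym_class V (u @ sel bs w @ x # nsel bs w)
        = sg (fst x * wdeg (sel bs w)) \<odot>\<^bsub>Sym V\<^esub> sym_class V (u @ x # sel bs w @ nsel bs w)"
      by (rule sym_class_move) (use Cons.prems l in auto)
    then show ?thesis
      using False IH c by (simp add: vs_smult_assoc[OF S] algebra_simps)
  qed
qed

section \<open>Multiplication\<close>

lemma Sym_mult_word_linear: "u \<in> letters V \<Longrightarrow> linear_on (Sym V) (Sym V) (Sym_mult_word V u)"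
  and Sym_mult_word_class: "u \<in> letters V \<Longrightarrow> v \<in> words V \<Longrightarrow>
    Sym_mult_word V u (sym_class V v) = sym_class V (u @ v)"
proof -
  have *: "sym_multilinear V (Sym V) (\<lambda>v. sym_class V (u @ v))" if u: "u \<in> letters V"
    unfolding sym_multilinear_def
  proof (intro conjI ballI allI impI)
    fix a t i assume "a \<in> letters V" "t \<in> letters V"
    then show "linear_on (V i) (Sym V) (\<lambda>x. sym_class V (u @ a @ (i, x) # t))"
      using sym_multilinearD(2)[OF sml_class, of "u @ a" t i] u by simp
  next
    fix a t x y assume "a \<in> letters V" "t \<in> letters V" "snd x \<in> carrier (V (fst x))"
      "snd y \<in> carrier (V (fst y))"
    then show "sym_class V (u @ a @ x # y # t) = sg (fst x * fst y) \<odot>\<^bsub>Sym V\<^esub> sym_class V (u @ a @ y # x # t)"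
      using sym_multilinearD(3)[OF sml_class, of "u @ a" t x y] u by simp
  qed (use u in \<open>auto intro!: sym_class_closed[OF V] simp: words_iff\<close>)
  show "u \<in> letters V \<Longrightarrow> linear_on (Sym V) (Sym V) (Sym_mult_word V u)"
    unfolding Sym_mult_word_def by (rule Sym_ext_linear[OF V S *])
  show "u \<in> letters V \<Longrightarrow> v \<in> words V \<Longrightarrow> Sym_mult_word V u (sym_class V v) = sym_class V (u @ v)"
    unfolding Sym_mult_word_def by (rule Sym_ext_class[OF V S *])
qed

text \<open>Each relation in \<open>u\<close> asserts equality of two maps linear in
  \<open>Q\<close>, so it is checked on words \<open>v\<close>, where it is a relation for
  \<open>u @ v\<close>.\<close>

lemma Sym_mult_word_multilinear:
  assumes Q: "Q \<in> carrier (Sym V)"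
  shows "sym_multilinear V (Sym V) (\<lambda>u. Sym_mult_word V u Q)"
proof -
  note lin = Sym_mult_word_linear
  have 1: "Sym_mult_word V (u @ (i, x \<oplus>\<^bsub>V i\<^esub> y) # t) Q
      = Sym_mult_word V (u @ (i, x) # t) Q \<oplus>\<^bsub>Sym V\<^esub> Sym_mult_word V (u @ (i, y) # t) Q"
    if "u \<in> letters V" "t \<in> letters V" "x \<in> carrier (V i)" "y \<in> carrier (V i)" for u t i x y
  proof (rule Sym_eq[OF V S _ _ _ Q])
    show "linear_on (Sym V) (Sym V) (Sym_mult_word V (u @ (i, x \<oplus>\<^bsub>V i\<^esub> y) # t))"
      by (rule lin) (use that in \<open>simp add: vs_closed[OF graded_vsD[OF V]]\<close>)
    show "linear_on (Sym V) (Sym V) (\<lambda>Q. Sym_mult_word V (u @ (i, x) # t) Q \<oplus>\<^bsub>Sym V\<^esub> Sym_mult_word V (u @ (i, y) # t) Q)"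
      by (rule linear_on_add[OF S lin lin]) (use that in simp_all)
    fix v assume "v \<in> words V"
    then show "Sym_mult_word V (u @ (i, x \<oplus>\<^bsub>V i\<^esub> y) # t) (sym_class V v)
      = Sym_mult_word V (u @ (i, x) # t) (sym_class V v) \<oplus>\<^bsub>Sym V\<^esub> Sym_mult_word V (u @ (i, y) # t) (sym_class V v)"
      using that linear_onD(2)[OF sym_multilinearD(2)[OF sml_class, of u "t @ v" i], of x y]
      by (simp add: Sym_mult_word_class vs_closed[OF graded_vsD[OF V]] words_iff)
  qed
  have 2: "Sym_mult_word V (u @ (i, a \<odot>\<^bsub>V i\<^esub> x) # t) Q = a \<odot>\<^bsub>Sym V\<^esub> Sym_mult_word V (u @ (i, x) # t) Q"
    if "u \<in> letters V" "t \<in> letters V" "x \<in> carrier (V i)" for u t i x a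
  proof (rule Sym_eq[OF V S _ _ _ Q])
    show "linear_on (Sym V) (Sym V) (Sym_mult_word V (u @ (i, a \<odot>\<^bsub>V i\<^esub> x) # t))"
      by (rule lin) (use that in \<open>simp add: vs_closed[OF graded_vsD[OF V]]\<close>)
    show "linear_on (Sym V) (Sym V) (\<lambda>Q. a \<odot>\<^bsub>Sym V\<^esub> Sym_mult_word V (u @ (i, x) # t) Q)"
      by (rule linear_on_smult[OF S lin]) (use that in simp_all)
    fix v assume "v \<in> words V"
    then show "Sym_mult_word V (u @ (i, a \<odot>\<^bsub>V i\<^esub> x) # t) (sym_class V v)
      = a \<odot>\<^bsub>Sym V\<^esub> Sym_mult_word V (u @ (i, x) # t) (sym_class V v)"
      using that linear_onD(3)[OF sym_multilinearD(2)[OF sml_class, of u "t @ v" i], of x a]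
      by (simp add: Sym_mult_word_class vs_closed[OF graded_vsD[OF V]] words_iff)
  qed
  have 3: "Sym_mult_word V (u @ x # y # t) Q = sg (fst x * fst y) \<odot>\<^bsub>Sym V\<^esub> Sym_mult_word V (u @ y # x # t) Q"
    if "u \<in> letters V" "t \<in> letters V" "snd x \<in> carrier (V (fst x))" "snd y \<in> carrier (V (fst y))" for u t x y
  proof (rule Sym_eq[OF V S _ _ _ Q])
    show "linear_on (Sym V) (Sym V) (Sym_mult_word V (u @ x # y # t))"
      by (rule lin) (use that in simp)
    show "linear_on (Sym V) (Sym V) (\<lambda>Q. sg (fst x * fst y) \<odot>\<^bsub>Sym V\<^esub> Sym_mult_word V (u @ y # x # t) Q)"
      by (rule linear_on_smult[OF S lin]) (use that in simp_all)
    fix v assume "v \<in> words V"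
    then show "Sym_mult_word V (u @ x # y # t) (sym_class V v)
      = sg (fst x * fst y) \<odot>\<^bsub>Sym V\<^esub> Sym_mult_word V (u @ y # x # t) (sym_class V v)"
      using that sym_multilinearD(3)[OF sml_class, of u "t @ v" x y]
      by (simp add: Sym_mult_word_class words_iff)
  qed
  show ?thesis
    unfolding sym_multilinear_def linear_on_def
    by (intro conjI ballI allI impI 1 2 3 linear_onD(1)[OF lin Q]) (simp_all add: words_iff)
qed

lemma Sym_mult_linear: "linear_on (Sym2 V) (Sym V) (Sym_mult V)"
  and Sym_mult_tens: "u \<in> words V \<Longrightarrow> v \<in> words V \<Longrightarrow>
    Sym_mult V (tens (Sym V) (Sym V) (sym_class V u) (sym_class V v)) = sym_class V (u @ v)"
proof -
  have lin1: "linear_on (Sym V) (Sym V) (\<lambda>P. Sym_mult_aux V P Q)" if "Q \<in> carrier (Sym V)" for Q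
    unfolding Sym_mult_aux_def by (rule Sym_ext_linear[OF V S Sym_mult_word_multilinear[OF that]])
  have cl: "Sym_mult_aux V (sym_class V u) Q = Sym_mult_word V u Q"
    if "Q \<in> carrier (Sym V)" "u \<in> words V" for u Q
    unfolding Sym_mult_aux_def by (rule Sym_ext_class[OF V S Sym_mult_word_multilinear[OF that(1)] that(2)])
  have 2: "Sym_mult_aux V P (Q \<oplus>\<^bsub>Sym V\<^esub> Q') = Sym_mult_aux V P Q \<oplus>\<^bsub>Sym V\<^esub> Sym_mult_aux V P Q'"
    if "P \<in> carrier (Sym V)" "Q \<in> carrier (Sym V)" "Q' \<in> carrier (Sym V)" for P Q Q'
  proof (rule Sym_eq[OF V S lin1 linear_on_add[OF S lin1 lin1] _ that(1)])
    show "Sym_mult_aux V (sym_class V w) (Q \<oplus>\<^bsub>Sym V\<^esub> Q')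
        = Sym_mult_aux V (sym_class V w) Q \<oplus>\<^bsub>Sym V\<^esub> Sym_mult_aux V (sym_class V w) Q'" if "w \<in> words V" for w
      using that \<open>Q \<in> _\<close> \<open>Q' \<in> _\<close> linear_onD(2)[OF Sym_mult_word_linear]
      by (simp add: cl vs_closed[OF S] words_iff)
  qed (use that in \<open>auto simp: vs_closed[OF S]\<close>)
  have 3: "Sym_mult_aux V P (a \<odot>\<^bsub>Sym V\<^esub> Q) = a \<odot>\<^bsub>Sym V\<^esub> Sym_mult_aux V P Q"
    if "P \<in> carrier (Sym V)" "Q \<in> carrier (Sym V)" for P Q a
  proof (rule Sym_eq[OF V S lin1 linear_on_smult[OF S lin1] _ that(1)])
    show "Sym_mult_aux V (sym_class V w) (a \<odot>\<^bsub>Sym V\<^esub> Q) = a \<odot>\<^bsub>Sym V\<^esub> Sym_mult_aux V (sym_class V w) Q"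
      if "w \<in> words V" for w
      using that \<open>Q \<in> _\<close> linear_onD(3)[OF Sym_mult_word_linear]
      by (simp add: cl vs_closed[OF S] words_iff)
  qed (use that in \<open>auto simp: vs_closed[OF S]\<close>)
  have bil: "bilinear_on (Sym V) (Sym V) (Sym V) (Sym_mult_aux V)"
    unfolding bilinear_on_def
  proof (intro conjI ballI)
    show "linear_on (Sym V) (Sym V) (Sym_mult_aux V P)" if "P \<in> carrier (Sym V)" for P
      unfolding linear_on_def by (intro conjI ballI allI 2 3 linear_onD(1)[OF lin1] that)
  qed (rule lin1)
  show "linear_on (Sym2 V) (Sym V) (Sym_mult V)"
    unfolding Sym_mult_def by (rule tensor_ext_linear[OF S S S bil])
  show "Sym_mult V (tens (Sym V) (Sym V) (sym_class V u) (sym_class V v)) = sym_class V (u @ v)"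
    if "u \<in> words V" "v \<in> words V"
    unfolding Sym_mult_def using that
    by (subst tensor_ext_tens[OF S S S bil])
      (auto simp: sym_class_closed[OF V] cl Sym_mult_word_class words_iff)
qed

text \<open>By \<open>unshuffle_reassemble\<close> every term of the coproduct multiplies back to
  the same class, so the scalar counts the terms.\<close>

lemma Sym_mult_comult:
  assumes w: "w \<in> words V"
  shows "Sym_mult V (comult V (sym_class V w)) = of_nat (card (bsets (length w))) \<odot>\<^bsub>Sym V\<^esub> sym_class V w"
proof -
  have wl: "w \<in> letters V" "w \<noteq> []" using w by (auto simp: words_iff)
  have "Sym_mult V (comult V (sym_class V w)) = (\<Oplus>\<^bsub>Sym V\<^esub>bs\<in>bsets (length w). Sym_mult V (unshuffle_term V w bs))"
    unfolding comult_class[OF V w] unshuffle_def[OF V]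
    by (rule linear_on_finsum[OF S2 S Sym_mult_linear]) (rule unshuffle_term_closed[OF V wl(1)])
  also have "\<dots> = (\<Oplus>\<^bsub>Sym V\<^esub>bs\<in>bsets (length w). sym_class V w)"
  proof (rule vs_finsum_cong[OF S refl sym_class_closed[OF V w]])
    fix bs assume bs: "bs \<in> bsets (length w)"
    note ws = words_sel[OF wl(1) bs]
    have "Sym_mult V (unshuffle_term V w bs) = ksgn bs w \<odot>\<^bsub>Sym V\<^esub> sym_class V (sel bs w @ nsel bs w)"
      unfolding unshuffle_term_def[OF V]
      by (subst linear_onD(3)[OF Sym_mult_linear])
        (auto simp: Sym_mult_tens ws intro!: tens_closed[OF S S] sym_class_closed[OF V])
    also have "\<dots> = sym_class V w"
      using unshuffle_reassemble[of bs w "[]"] bs wl by (auto simp: bsets_def)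
    finally show "Sym_mult V (unshuffle_term V w bs) = sym_class V w" .
  qed
  also have "\<dots> = of_nat (card (bsets (length w))) \<odot>\<^bsub>Sym V\<^esub> sym_class V w"
    by (rule vs_finsum_const[OF S finite_bsets sym_class_closed[OF V w]])
  finally show ?thesis .
qed

text \<open>The composite of comultiplication and multiplication is an invertible scalar on \<open>S\<^sup>k(V)\<close> for
  \<open>k \<ge> 2\<close>.\<close>

lemma Sym_decompose:
  assumes Z: "Z \<in> carrier (Sym V)"
  shows "Z = Sym_pr1 V Z \<oplus>\<^bsub>Sym V\<^esub>
    Sym_scale V (\<lambda>k _. if k \<le> 1 then 0 else inverse (of_nat (card (bsets k)))) (Sym_mult V (comult V Z))"
    (is "_ = _ \<oplus>\<^bsub>Sym V\<^esub> Sym_scale V ?c _")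
proof (rule Sym_eq[OF V S linear_on_id _ _ Z])
  show "linear_on (Sym V) (Sym V) (\<lambda>Z. Sym_pr1 V Z \<oplus>\<^bsub>Sym V\<^esub> Sym_scale V ?c (Sym_mult V (comult V Z)))"
    by (intro linear_on_add[OF S] Sym_pr1_linear linear_on_comp[OF linear_on_comp[OF comult_linear[OF V] Sym_mult_linear]]
        Sym_scale_linear)
  fix w assume w: "w \<in> words V"
  note c = sym_class_closed[OF V w]
  have e: "Sym_scale V ?c (Sym_mult V (comult V (sym_class V w)))
      = (of_nat (card (bsets (length w))) * ?c (length w) (wdeg w)) \<odot>\<^bsub>Sym V\<^esub> sym_class V w"
    using w c linear_onD(3)[OF Sym_scale_linear c]
    by (simp add: Sym_mult_comult Sym_scale_class vs_smult_assoc[OF S])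
  have "length w \<noteq> 0" using w by (simp add: words_iff)
  then have "length w = 1 \<or> 2 \<le> length w" by linarith
  then show "sym_class V w = Sym_pr1 V (sym_class V w) \<oplus>\<^bsub>Sym V\<^esub> Sym_scale V ?c (Sym_mult V (comult V (sym_class V w)))"
  proof
    assume "length w = 1"
    then show ?thesis unfolding e using w c by (simp add: Sym_pr1_class vs_simps[OF S])
  next
    assume "2 \<le> length w"
    then show ?thesis
      unfolding e using w c card_bsets_pos[of "length w"] by (simp add: Sym_pr1_class vs_simps[OF S])
  qed
qed

lemma Sym_eqI:
  assumes "Z \<in> carrier (Sym V)" "Z' \<in> carrier (Sym V)" "Sym_pr1 V Z = Sym_pr1 V Z'" "comult V Z = comult V Z'"
  shows "Z = Z'"
  using Sym_decompose[OF assms(1)] Sym_decompose[OF assms(2)] assms(3,4) by simp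

text \<open>A left inverse exists: the linear map on \<open>Sym V\<close> that reads off one-letter
  words of degree \<open>i\<close> and kills all others. It turns equations between components into
  equations in \<open>V i\<close>.\<close>

lemma sym_class_single_inj:
  assumes x: "x \<in> carrier (V i)" and y: "y \<in> carrier (V i)" and eq: "sym_class V [(i, x)] = sym_class V [(i, y)]"
  shows "x = y"
proof -
  let ?\<phi> = "\<lambda>w. if length w = 1 \<and> fst (hd w) = i then snd (hd w) else \<zero>\<^bsub>V i\<^esub>"
  note Vi = graded_vsD[OF V, of i]
  have "sym_multilinear V (V i) ?\<phi>"
    unfolding sym_multilinear_def
  proof (intro conjI ballI allI impI)
    fix w assume "w \<in> words V"
    then show "?\<phi> w \<in> carrier (V i)"
      by (cases w) (auto simp: words_iff vs_zero_closed[OF Vi])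
  next
    fix u t j assume "u \<in> letters V" "t \<in> letters V"
    show "linear_on (V j) (V i) (\<lambda>x. ?\<phi> (u @ (j, x) # t))"
      by (cases "u = [] \<and> t = [] \<and> j = i") (auto simp: linear_on_def vs_simps[OF Vi])
  qed (simp add: vs_simps[OF Vi])
  from Sym_ext_class[OF V Vi this] have "ext_gen (V i) ?\<phi> (sym_class V w) = ?\<phi> w" if "w \<in> words V" for w
    using that .
  from this[of "[(i, x)]"] this[of "[(i, y)]"] x y eq show ?thesis by (simp add: words_iff)
qed

end

lemma tens_map_unshuffle:
  assumes V: "graded_vs V" and W: "graded_vs W"
    and f: "linear_on (Sym V) (Sym W) f" and g: "linear_on (Sym V) (Sym W) g" and w: "w \<in> words V"
  shows "tens_map (Sym W) (Sym W) f g (comult V (sym_class V w)) =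
    (\<Oplus>\<^bsub>Sym2 W\<^esub>bs\<in>bsets (length w). ksgn bs w \<odot>\<^bsub>Sym2 W\<^esub>
       tens (Sym W) (Sym W) (f (sym_class V (sel bs w))) (g (sym_class V (nsel bs w))))"
proof -
  have wl: "w \<in> letters V" using w by (auto simp: words_iff)
  note SV = Sym_is_vs[OF V] and SW = Sym_is_vs[OF W] and S2W = Sym2_is_vs[OF W]
  note lin = tens_map_linear[OF SV SV SW SW f g]
  have *: "tens_map (Sym W) (Sym W) f g (unshuffle_term V w bs) = ksgn bs w \<odot>\<^bsub>Sym2 W\<^esub>
       tens (Sym W) (Sym W) (f (sym_class V (sel bs w))) (g (sym_class V (nsel bs w)))"
    if bs: "bs \<in> bsets (length w)" for bs
    unfolding unshuffle_term_def[OF V] using words_sel[OF wl bs, THEN sym_class_closed[OF V]]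
    by (subst linear_onD(3)[OF lin]) (auto simp: tens_closed[OF SV SV] tens_map_tens[OF SV SV SW SW f g])
  show ?thesis
    unfolding comult_class[OF V w] unshuffle_def[OF V]
    apply (subst linear_on_finsum[OF Sym2_is_vs[OF V] S2W lin])
     apply (erule unshuffle_term_closed[OF V wl])
    apply (rule vs_finsum_cong[OF S2W refl])
    using linear_onD(1)[OF lin unshuffle_term_closed[OF V wl]] * by auto
qed

text \<open>In the reduced coproduct both factors are strictly shorter than \<open>w\<close>; this
  is what drives the inductions on word length.\<close>

lemma tens_map_comult_cong:
  assumes V: "graded_vs V" and W: "graded_vs W"
    and lin: "linear_on (Sym V) (Sym W) f" "linear_on (Sym V) (Sym W) g"
      "linear_on (Sym V) (Sym W) f'" "linear_on (Sym V) (Sym W) g'" and w: "w \<in> words V"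
    and eq: "\<And>u. u \<in> words V \<Longrightarrow> length u < length w \<Longrightarrow> f (sym_class V u) = f' (sym_class V u)"
      "\<And>u. u \<in> words V \<Longrightarrow> length u < length w \<Longrightarrow> g (sym_class V u) = g' (sym_class V u)"
  shows "tens_map (Sym W) (Sym W) f g (comult V (sym_class V w))
    = tens_map (Sym W) (Sym W) f' g' (comult V (sym_class V w))"
proof -
  have wl: "w \<in> letters V" using w by (auto simp: words_iff)
  note SW = Sym_is_vs[OF W] and S2W = Sym2_is_vs[OF W]
  show ?thesis
    unfolding tens_map_unshuffle[OF V W lin(1,2) w] tens_map_unshuffle[OF V W lin(3,4) w]
  proof (rule vs_finsum_cong[OF S2W refl])
    fix bs assume bs: "bs \<in> bsets (length w)"
    note ws = words_sel[OF wl bs]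
    have "length (sel bs w) > 0" "length (nsel bs w) > 0" using ws by (auto simp: words_iff)
    moreover have "length (sel bs w) + length (nsel bs w) = length w"
      using length_sel[of bs w] bs by (auto simp: bsets_def)
    ultimately have "length (sel bs w) < length w" "length (nsel bs w) < length w" by linarith+
    then show "ksgn bs w \<odot>\<^bsub>Sym2 W\<^esub> tens (Sym W) (Sym W) (f (sym_class V (sel bs w))) (g (sym_class V (nsel bs w)))
      = ksgn bs w \<odot>\<^bsub>Sym2 W\<^esub> tens (Sym W) (Sym W) (f' (sym_class V (sel bs w))) (g' (sym_class V (nsel bs w)))"
      using eq ws by simp
    show "ksgn bs w \<odot>\<^bsub>Sym2 W\<^esub> tens (Sym W) (Sym W) (f' (sym_class V (sel bs w))) (g' (sym_class V (nsel bs w)))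
        \<in> carrier (Sym2 W)"
      using ws linear_onD(1)[OF lin(3)] linear_onD(1)[OF lin(4)]
      by (intro vs_smult_closed[OF S2W] tens_closed[OF SW SW]) (simp_all add: sym_class_closed[OF V])
  qed
qed

text \<open>The common form of the uniqueness statements for coalgebra morphisms and for
  coderivations along a morphism: in each case the coproduct of a value is determined by the values
  on shorter words.\<close>

lemma Sym_maps_eq:
  assumes V: "graded_vs V" and W: "graded_vs W"
    and A: "linear_on (Sym V) (Sym W) A" and B: "linear_on (Sym V) (Sym W) B"
    and pr: "\<And>w. w \<in> words V \<Longrightarrow> Sym_pr1 W (A (sym_class V w)) = Sym_pr1 W (B (sym_class V w))"
    and com: "\<And>w. w \<in> words V \<Longrightarrow>
      (\<And>u. u \<in> words V \<Longrightarrow> length u < length w \<Longrightarrow> A (sym_class V u) = B (sym_class V u)) \<Longrightarrow>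
      comult W (A (sym_class V w)) = comult W (B (sym_class V w))"
    and Z: "Z \<in> carrier (Sym V)"
  shows "A Z = B Z"
proof (rule Sym_eq[OF V Sym_is_vs[OF W] A B _ Z])
  fix w assume "w \<in> words V"
  then show "A (sym_class V w) = B (sym_class V w)"
  proof (induction "length w" arbitrary: w rule: less_induct)
    case less
    show ?case
    proof (rule Sym_eqI[OF W])
      show "A (sym_class V w) \<in> carrier (Sym W)" "B (sym_class V w) \<in> carrier (Sym W)"
        using linear_onD(1)[OF A] linear_onD(1)[OF B] sym_class_closed[OF V less.prems] by blast+
      show "Sym_pr1 W (A (sym_class V w)) = Sym_pr1 W (B (sym_class V w))" by (rule pr[OF less.prems])
      show "comult W (A (sym_class V w)) = comult W (B (sym_class V w))"
        by (rule com[OF less.prems]) (rule less.hyps)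
    qed
  qed
qed

section \<open>Functoriality\<close>

definition map_letters :: "(int \<Rightarrow> 'v \<Rightarrow> 'w) \<Rightarrow> 'v word \<Rightarrow> 'w word" where
  "map_letters p w = map (\<lambda>(i, x). (i, p i x)) w"

text \<open>The coalgebra morphism whose only component is the degreewise linear map
  \<open>p\<close>.\<close>

definition Sym_map :: "('k::field_char_0, 'w) graded \<Rightarrow> (int \<Rightarrow> 'v \<Rightarrow> 'w) \<Rightarrow>
    ('v word \<Rightarrow>\<^sub>0 'k) set \<Rightarrow> ('w word \<Rightarrow>\<^sub>0 'k) set" where
  "Sym_map W p = ext_gen (Sym W) (\<lambda>w. sym_class W (map_letters p w))"

lemma map_letters_simps [simp]:
  "map_letters p [] = []" "map_letters p (x # w) = (fst x, p (fst x) (snd x)) # map_letters p w"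
  "map_letters p (u @ w) = map_letters p u @ map_letters p w"
  "length (map_letters p w) = length w" "wdeg (map_letters p w) = wdeg w"
  "map fst (map_letters p w) = map fst w"
  by (auto simp: map_letters_def wdeg_def case_prod_unfold comp_def)

lemma map_letters_comp: "map_letters q (map_letters p w) = map_letters (\<lambda>i x. q i (p i x)) w"
  by (auto simp: map_letters_def case_prod_unfold)

lemma map_letters_cong:
  "w \<in> letters V \<Longrightarrow> (\<And>i x. x \<in> carrier (V i) \<Longrightarrow> p i x = q i x) \<Longrightarrow> map_letters p w = map_letters q w"
  by (induction w) auto

lemma map_letters_id: "w \<in> letters V \<Longrightarrow> (\<And>i x. x \<in> carrier (V i) \<Longrightarrow> p i x = x) \<Longrightarrow> map_letters p w = w"
  by (induction w) auto

lemma sel_map_letters: "sel bs (map_letters p w) = map_letters p (sel bs w)"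
  by (simp add: map_letters_def sel_map)

lemma map_letters_closed:
  "(\<And>i x. x \<in> carrier (V i) \<Longrightarrow> p i x \<in> carrier (W i)) \<Longrightarrow> w \<in> letters V \<Longrightarrow> map_letters p w \<in> letters W"
  by (induction w) auto

definition graded_linear :: "('k::field_char_0, 'v) graded \<Rightarrow> ('k, 'w) graded \<Rightarrow> (int \<Rightarrow> 'v \<Rightarrow> 'w) \<Rightarrow> bool" where
  "graded_linear V W p \<longleftrightarrow> (\<forall>i. linear_on (V i) (W i) (p i))"

lemma graded_linearD: "graded_linear V W p \<Longrightarrow> linear_on (V i) (W i) (p i)"
  by (simp add: graded_linear_def)

lemma map_letters_words:
  assumes "graded_linear V W p"
  shows "w \<in> letters V \<Longrightarrow> map_letters p w \<in> letters W" "w \<in> words V \<Longrightarrow> map_letters p w \<in> words W"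
proof -
  have *: "map_letters p w \<in> letters W" if "w \<in> letters V" for w
    by (rule map_letters_closed[OF linear_onD(1)[OF graded_linearD[OF assms]] that])
  then show "w \<in> letters V \<Longrightarrow> map_letters p w \<in> letters W" .
  show "w \<in> words V \<Longrightarrow> map_letters p w \<in> words W"
    using *[of w] by (auto simp: words_iff map_letters_def)
qed

context
  fixes V :: "('k::field_char_0, 'v) graded" and W :: "('k, 'w) graded" and p
  assumes V: "graded_vs V" and W: "graded_vs W" and p: "graded_linear V W p"
begin

lemma sym_multilinear_map_letters: "sym_multilinear V (Sym W) (\<lambda>w. sym_class W (map_letters p w))"
  unfolding sym_multilinear_def
proof (intro conjI ballI allI impI)
  fix u t i assume "u \<in> letters V" "t \<in> letters V"
  then show "linear_on (V i) (Sym W) (\<lambda>x. sym_class W (map_letters p (u @ (i, x) # t)))"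
    using linear_on_comp[OF graded_linearD[OF p] sym_multilinearD(2)[OF sym_multilinear_class[OF W]],
        of "map_letters p u" "map_letters p t" i] map_letters_words(1)[OF p] by simp
next
  fix u t x y assume "u \<in> letters V" "t \<in> letters V" "snd x \<in> carrier (V (fst x))" "snd y \<in> carrier (V (fst y))"
  then show "sym_class W (map_letters p (u @ x # y # t))
      = sg (fst x * fst y) \<odot>\<^bsub>Sym W\<^esub> sym_class W (map_letters p (u @ y # x # t))"
    using sym_multilinearD(3)[OF sym_multilinear_class[OF W], of "map_letters p u" "map_letters p t"
        "(fst x, p (fst x) (snd x))" "(fst y, p (fst y) (snd y))"] map_letters_words(1)[OF p]
      linear_onD(1)[OF graded_linearD[OF p]] by simp
qed (rule sym_class_closed[OF W map_letters_words(2)[OF p]])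

lemma Sym_map_linear: "linear_on (Sym V) (Sym W) (Sym_map W p)"
  unfolding Sym_map_def by (rule Sym_ext_linear[OF V Sym_is_vs[OF W] sym_multilinear_map_letters])

lemma Sym_map_class: "w \<in> words V \<Longrightarrow> Sym_map W p (sym_class V w) = sym_class W (map_letters p w)"
  unfolding Sym_map_def by (rule Sym_ext_class[OF V Sym_is_vs[OF W] sym_multilinear_map_letters])

lemma Sym_map_coalg: "coalg_morphism V W (Sym_map W p)"
  unfolding coalg_morphism_def
proof (intro conjI allI ballI)
  show "linear_on (Sym V) (Sym W) (Sym_map W p)" by (rule Sym_map_linear)
next
  fix j Z assume "Z \<in> Sym_deg V j"
  then show "Sym_map W p Z \<in> Sym_deg W j"
  proof (rule Sym_deg_map[OF V W Sym_map_linear, rotated])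
    fix w assume "w \<in> words V" "wdeg w = j"
    then show "Sym_map W p (sym_class V w) \<in> Sym_deg W j"
      using Sym_deg_class[OF W map_letters_words(2)[OF p], of w] by (simp add: Sym_map_class)
  qed
next
  fix Z assume Z: "Z \<in> carrier (Sym V)"
  note SV = Sym_is_vs[OF V] and SW = Sym_is_vs[OF W]
  note T = tens_map_linear[OF SV SV SW SW Sym_map_linear Sym_map_linear]
  show "comult W (Sym_map W p Z) = tens_map (Sym W) (Sym W) (Sym_map W p) (Sym_map W p) (comult V Z)"
  proof (rule Sym_eq[OF V Sym2_is_vs[OF W] linear_on_comp[OF Sym_map_linear comult_linear[OF W]]
        linear_on_comp[OF comult_linear[OF V] T] _ Z])
    fix w assume w: "w \<in> words V"
    have wl: "w \<in> letters V" using w by (auto simp: words_iff)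
    note pw = map_letters_words(2)[OF p w]
    have k: "ksgn bs (map_letters p w) = ksgn bs w" for bs by (rule ksgn_cong) simp
    show "comult W (Sym_map W p (sym_class V w))
        = tens_map (Sym W) (Sym W) (Sym_map W p) (Sym_map W p) (comult V (sym_class V w))"
      unfolding tens_map_unshuffle[OF V W Sym_map_linear Sym_map_linear w] Sym_map_class[OF w]
        comult_class[OF W pw] unshuffle_def[OF W] map_letters_simps(4)
    proof (rule vs_finsum_cong[OF Sym2_is_vs[OF W] refl])
      fix bs assume bs: "bs \<in> bsets (length w)"
      note ws = words_sel[OF wl bs]
      show e: "unshuffle_term W (map_letters p w) bs = ksgn bs w \<odot>\<^bsub>Sym2 W\<^esub>
          tens (Sym W) (Sym W) (Sym_map W p (sym_class V (sel bs w))) (Sym_map W p (sym_class V (nsel bs w)))"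
        unfolding unshuffle_term_def[OF W] k using ws by (simp add: Sym_map_class sel_map_letters)
      show "ksgn bs w \<odot>\<^bsub>Sym2 W\<^esub>
          tens (Sym W) (Sym W) (Sym_map W p (sym_class V (sel bs w))) (Sym_map W p (sym_class V (nsel bs w)))
          \<in> carrier (Sym2 W)"
        unfolding e[symmetric]
        by (rule unshuffle_term_closed[OF W map_letters_words(1)[OF p wl]]) (use bs in simp)
    qed
  qed
qed

text \<open>Letterwise maps preserve degree and length of words; the first gives this lemma, the
  second the compatibility with \<open>Sym_pr1\<close> that follows.\<close>

lemma Sym_map_sign:
  assumes Z: "Z \<in> carrier (Sym V)"
  shows "Sym_sign W (Sym_map W p Z) = Sym_map W p (Sym_sign V Z)"
  by (rule Sym_eq[OF V Sym_is_vs[OF W] linear_on_comp[OF Sym_map_linear Sym_sign_linear[OF W]]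
        linear_on_comp[OF Sym_sign_linear[OF V] Sym_map_linear] _ Z])
    (simp add: Sym_sign_class V W Sym_map_class map_letters_words[OF p] linear_onD(3)[OF Sym_map_linear]
      sym_class_closed[OF V])

lemma Sym_map_pr1:
  assumes Z: "Z \<in> carrier (Sym V)"
  shows "Sym_pr1 W (Sym_map W p Z) = Sym_map W p (Sym_pr1 V Z)"
  by (rule Sym_eq[OF V Sym_is_vs[OF W] linear_on_comp[OF Sym_map_linear Sym_pr1_linear[OF W]]
        linear_on_comp[OF Sym_pr1_linear[OF V] Sym_map_linear] _ Z])
    (simp add: Sym_pr1_class V W Sym_map_class map_letters_words[OF p]
      linear_on_zero[OF Sym_is_vs[OF V] Sym_is_vs[OF W] Sym_map_linear])

end

text \<open>The composite is a separate map \<open>r\<close> that agrees with it on carriers, so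
  that \<open>r\<close> can be the identity when \<open>p\<close> is a section of
  \<open>q\<close>.\<close>

lemma Sym_map_comp:
  assumes U: "graded_vs U" and V: "graded_vs V" and W: "graded_vs W"
    and p: "graded_linear U V p" and q: "graded_linear V W q"
    and r: "graded_linear U W r" and eq: "\<And>i x. x \<in> carrier (U i) \<Longrightarrow> q i (p i x) = r i x"
    and Z: "Z \<in> carrier (Sym U)"
  shows "Sym_map W q (Sym_map V p Z) = Sym_map W r Z"
proof (rule Sym_eq[OF U Sym_is_vs[OF W] linear_on_comp[OF Sym_map_linear[OF U V p] Sym_map_linear[OF V W q]]
        Sym_map_linear[OF U W r] _ Z])
  fix w assume w: "w \<in> words U"
  then have "map_letters (\<lambda>i x. q i (p i x)) w = map_letters r w"
    by (intro map_letters_cong[of w U] eq) (auto simp: words_iff)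
  then show "Sym_map W q (Sym_map V p (sym_class U w)) = Sym_map W r (sym_class U w)"
    using w by (simp add: Sym_map_class[OF U V p] Sym_map_class[OF V W q] Sym_map_class[OF U W r]
        map_letters_words[OF p] map_letters_comp)
qed

lemma Sym_map_id:
  assumes U: "graded_vs U" and p: "graded_linear U U p" and eq: "\<And>i x. x \<in> carrier (U i) \<Longrightarrow> p i x = x"
    and Z: "Z \<in> carrier (Sym U)"
  shows "Sym_map U p Z = Z"
  by (rule Sym_eq[OF U Sym_is_vs[OF U] Sym_map_linear[OF U U p] linear_on_id _ Z])
    (use map_letters_id[of _ U p] eq in \<open>auto simp: Sym_map_class[OF U U p] words_iff\<close>)

section \<open>Suspension, skew families and strict families\<close>

definition lin :: "('v word \<Rightarrow> 'w) \<Rightarrow> int \<Rightarrow> 'v \<Rightarrow> 'w" where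
  "lin f i x = f [(i, x)]"

definition susp_map :: "(int \<Rightarrow> 'v \<Rightarrow> 'w) \<Rightarrow> int \<Rightarrow> 'v \<Rightarrow> 'w" where
  "susp_map p i = p (i - 1)"

lemma graded_vs_susp: "graded_vs V \<Longrightarrow> graded_vs (susp V)"
  by (simp add: graded_vs_def susp_def)

lemma graded_linear_susp: "graded_linear V W p \<Longrightarrow> graded_linear (susp V) (susp W) (susp_map p)"
  by (simp add: graded_linear_def susp_def susp_map_def)

lemma desusp_simps [simp]:
  "desusp [] = []" "desusp (x # w) = (fst x - 1, snd x) # desusp w"
  "desusp (u @ w) = desusp u @ desusp w"
  "length (desusp w) = length w" "wdeg (desusp w) = wdeg w - int (length w)"
  by (induction w) (auto simp: desusp_def case_prod_unfold)

lemma desusp_letters: "w \<in> letters (susp V) \<Longrightarrow> desusp w \<in> letters V"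
  by (induction w) (auto simp: susp_def)

lemma desusp_words: "w \<in> words (susp V) \<Longrightarrow> desusp w \<in> words V"
  using desusp_letters by (auto simp: words_iff desusp_def)

lemma out_deg_desusp [simp]: "out_deg r (desusp w) = wdeg w + r"
  by (simp add: out_deg_def)

lemma out_deg_map_letters [simp]: "out_deg r (map_letters p w) = out_deg r w"
  by (simp add: out_deg_def)

lemma desusp_map_letters: "desusp (map_letters (susp_map p) w) = map_letters p (desusp w)"
  by (induction w) (auto simp: susp_map_def)

text \<open>The suspension sign depends on degrees and length alone, both preserved by letterwise
  maps; hence compatibility with brackets passes to the suspended components.\<close>

lemma susp_family_natural:
  assumes p: "graded_linear L T p" and br: "br (desusp w) \<in> carrier (L (wdeg w + r))"
    and eq: "brT (map_letters p (desusp w)) = p (wdeg w + r) (br (desusp w))"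
  shows "susp_family T r brT (map_letters (susp_map p) w) = p (wdeg w + r) (susp_family L r br w)"
proof -
  have "fst (map_letters (susp_map p) w ! j) = fst (w ! j)" if "j < length w" for j
    using that by (simp add: map_letters_def case_prod_unfold)
  then show ?thesis
    using linear_onD(3)[OF graded_linearD[OF p] br]
    by (simp add: susp_family_def Let_def desusp_map_letters eq)
qed

text \<open>The target space depends only on degrees; \<open>x0\<close> names it without reference
  to the varying letter.\<close>

lemma skew_familyD:
  assumes "skew_family L L' r \<phi>"
  shows "w \<in> words L \<Longrightarrow> \<phi> w \<in> carrier (L' (out_deg r w))"
    and "u \<in> letters L \<Longrightarrow> t \<in> letters L \<Longrightarrow>
      linear_on (L i) (L' (out_deg r (u @ (i, x0) # t))) (\<lambda>x. \<phi> (u @ (i, x) # t))"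
    and "u \<in> letters L \<Longrightarrow> t \<in> letters L \<Longrightarrow> snd x \<in> carrier (L (fst x)) \<Longrightarrow> snd y \<in> carrier (L (fst y)) \<Longrightarrow>
      \<phi> (u @ x # y # t) = (- sg (fst x * fst y)) \<odot>\<^bsub>L' (out_deg r (u @ x # y # t))\<^esub> \<phi> (u @ y # x # t)"
proof -
  have d: "out_deg r (u @ (i, x) # t) = out_deg r (u @ (i, x0) # t)" for x by (simp add: out_deg_def)
  note a = assms[unfolded skew_family_def words_iff sg_def[symmetric]]
  show "w \<in> words L \<Longrightarrow> \<phi> w \<in> carrier (L' (out_deg r w))"
    using assms unfolding skew_family_def by blast
  show "linear_on (L i) (L' (out_deg r (u @ (i, x0) # t))) (\<lambda>x. \<phi> (u @ (i, x) # t))"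
    if "u \<in> letters L" "t \<in> letters L"
    unfolding linear_on_def
  proof (intro conjI ballI allI)
    fix x assume x: "x \<in> carrier (L i)"
    then have w: "u @ (i, x) # t \<in> words L" using that by (simp add: words_iff)
    show "\<phi> (u @ (i, x) # t) \<in> carrier (L' (out_deg r (u @ (i, x0) # t)))"
      using assms w unfolding skew_family_def d[of x, symmetric] by blast
    show "\<phi> (u @ (i, a \<odot>\<^bsub>L i\<^esub> x) # t) = a \<odot>\<^bsub>L' (out_deg r (u @ (i, x0) # t))\<^esub> \<phi> (u @ (i, x) # t)" for a
      using assms w unfolding skew_family_def d[of x, symmetric] by blast
    fix y assume y: "y \<in> carrier (L i)"
    then have w': "u @ (i, y) # t \<in> words L" using that by (simp add: words_iff)
    show "\<phi> (u @ (i, x \<oplus>\<^bsub>L i\<^esub> y) # t) = \<phi> (u @ (i, x) # t) \<oplus>\<^bsub>L' (out_deg r (u @ (i, x0) # t))\<^esub> \<phi> (u @ (i, y) # t)"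
      using assms w w' unfolding skew_family_def d[of x, symmetric] by blast
  qed
  show "\<phi> (u @ x # y # t) = (- sg (fst x * fst y)) \<odot>\<^bsub>L' (out_deg r (u @ x # y # t))\<^esub> \<phi> (u @ y # x # t)"
    if "u \<in> letters L" "t \<in> letters L" "snd x \<in> carrier (L (fst x))" "snd y \<in> carrier (L (fst y))"
  proof -
    have "u @ x # y # t \<in> words L" using that by (simp add: words_iff)
    then show ?thesis using assms unfolding skew_family_def sg_def by blast
  qed
qed

lemma skew_familyI:
  assumes 1: "\<And>w. w \<in> words L \<Longrightarrow> \<phi> w \<in> carrier (L' (out_deg r w))"
    and 2: "\<And>u t i x0. u \<in> letters L \<Longrightarrow> t \<in> letters L \<Longrightarrow> x0 \<in> carrier (L i) \<Longrightarrow>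
      linear_on (L i) (L' (out_deg r (u @ (i, x0) # t))) (\<lambda>x. \<phi> (u @ (i, x) # t))"
    and 3: "\<And>u t x y. u \<in> letters L \<Longrightarrow> t \<in> letters L \<Longrightarrow> snd x \<in> carrier (L (fst x)) \<Longrightarrow> snd y \<in> carrier (L (fst y)) \<Longrightarrow>
      \<phi> (u @ x # y # t) = (- sg (fst x * fst y)) \<odot>\<^bsub>L' (out_deg r (u @ x # y # t))\<^esub> \<phi> (u @ y # x # t)"
  shows "skew_family L L' r \<phi>"
  unfolding skew_family_def words_iff sg_def[symmetric]
proof (intro conjI ballI allI impI; (elim conjE)?)
  fix u i x y t assume a: "u @ (i, x) # t \<in> letters L" "u @ (i, y) # t \<in> letters L"
  show "\<phi> (u @ (i, x \<oplus>\<^bsub>L i\<^esub> y) # t) =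
          \<phi> (u @ (i, x) # t) \<oplus>\<^bsub>L' (out_deg r (u @ (i, x) # t))\<^esub> \<phi> (u @ (i, y) # t)"
    by (rule linear_onD(2)[OF 2]) (use a in simp_all)
next
  fix u i a x t assume a: "u @ (i, x) # t \<in> letters L"
  show "\<phi> (u @ (i, a \<odot>\<^bsub>L i\<^esub> x) # t) = a \<odot>\<^bsub>L' (out_deg r (u @ (i, x) # t))\<^esub> \<phi> (u @ (i, x) # t)"
    by (rule linear_onD(3)[OF 2]) (use a in simp_all)
next
  fix u x y t assume "u @ x # y # t \<in> letters L"
  then show "\<phi> (u @ x # y # t) = (- sg (fst x * fst y)) \<odot>\<^bsub>L' (out_deg r (u @ x # y # t))\<^esub> \<phi> (u @ y # x # t)"
    by (intro 3) simp_all
qed (simp_all add: 1 words_iff)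

lemma skew_family_lin: "skew_family L L' (-1) f \<Longrightarrow> graded_linear L L' (lin f)"
  using skew_familyD(2)[of L L' "-1" f "[]" "[]"] by (simp add: graded_linear_def lin_def[abs_def] out_deg_def)

lemma strict_skew_family:
  assumes L: "graded_vs L" and L': "graded_vs L'" and g: "graded_linear L L' (lin f)" and s: "strict_family L L' f"
  shows "skew_family L L' (-1) f"
proof (rule skew_familyI)
  have z: "f w = \<zero>\<^bsub>L' (out_deg (-1) w)\<^esub>" if "w \<in> words L" "length w \<ge> 2" for w
    using s that by (simp add: strict_family_def)
  have one: "linear_on (L i) (L' i) (\<lambda>x. f [(i, x)])" for i
    using graded_linearD[OF g, of i] by (simp add: lin_def[abs_def])
  note vL = graded_vsD[OF L] and vL' = graded_vsD[OF L']
  show "f w \<in> carrier (L' (out_deg (-1) w))" if w: "w \<in> words L" for w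
  proof (cases "length w \<ge> 2")
    case True
    then show ?thesis using z[OF w] vs_zero_closed[OF vL'] by simp
  next
    case False
    then obtain i x where "w = [(i, x)]" using w by (cases w; cases "tl w") (auto simp: words_iff)
    then show ?thesis using w linear_onD(1)[OF one] by (simp add: words_iff out_deg_def)
  qed
  show "linear_on (L i) (L' (out_deg (-1) (u @ (i, x0) # t))) (\<lambda>x. f (u @ (i, x) # t))"
    if "u \<in> letters L" "t \<in> letters L" for u t i x0
  proof (cases "u = [] \<and> t = []")
    case True
    then show ?thesis using one by (simp add: out_deg_def)
  next
    case False
    have "f (u @ (i, x) # t) = \<zero>\<^bsub>L' (out_deg (-1) (u @ (i, x0) # t))\<^esub>" if "x \<in> carrier (L i)" for x
    proof -
      have "length (u @ (i, x) # t) \<ge> 2" using False by (cases u; cases t) auto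
      then show ?thesis using z[of "u @ (i, x) # t"] that \<open>u \<in> _\<close> \<open>t \<in> _\<close>
        by (simp add: words_iff out_deg_def)
    qed
    then show ?thesis by (simp add: linear_on_def vs_simps[OF vL] vs_simps[OF vL'])
  qed
  show "f (u @ x # y # t) = (- sg (fst x * fst y)) \<odot>\<^bsub>L' (out_deg (-1) (u @ x # y # t))\<^esub> f (u @ y # x # t)"
    if "u \<in> letters L" "t \<in> letters L" "snd x \<in> carrier (L (fst x))" "snd y \<in> carrier (L (fst y))" for u t x y
    using z[of "u @ x # y # t"] z[of "u @ y # x # t"] that vs_smult_zero[OF vL']
    by (simp add: words_iff out_deg_def algebra_simps)
qed

text \<open>Strictness makes the coalgebra morphism explicit. On longer words both the projection of
  the letterwise image and the prescribed component vanish.\<close>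

lemma Linf_comor_strict:
  assumes L: "graded_vs L" and T: "graded_vs T" and g: "graded_linear L T (lin f)" and s: "strict_family L T f"
  shows "Linf_comor L T f (Sym_map (susp T) (susp_map (lin f)))"
  unfolding Linf_comor_def
proof
  note sL = graded_vs_susp[OF L] and sT = graded_vs_susp[OF T] and sg = graded_linear_susp[OF g]
  show "coalg_morphism (susp L) (susp T) (Sym_map (susp T) (susp_map (lin f)))"
    by (rule Sym_map_coalg[OF sL sT sg])
  show "has_components (susp L) (susp T) 0 (Sym_map (susp T) (susp_map (lin f))) (susp_family T (- 1) f)"
    unfolding has_components_def
  proof
    fix w assume w: "w \<in> words (susp L)"
    note pw = map_letters_words(2)[OF sg w]
    show "Sym_pr1 (susp T) (Sym_map (susp T) (susp_map (lin f)) (sym_class (susp L) w))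
        = sym_class (susp T) [(wdeg w + 0, susp_family T (- 1) f w)]"
    proof (cases "length w = 1")
      case True
      then obtain i x where w': "w = [(i, x)]" by (cases w) auto
      have "x \<in> carrier (L (i - 1))" using w w' by (simp add: words_iff susp_def)
      then have "f [(i - 1, x)] \<in> carrier (T (i - 1))"
        using linear_onD(1)[OF graded_linearD[OF g], of x "i - 1"] by (simp add: lin_def)
      then show ?thesis
        using w w' pw by (simp add: Sym_map_class[OF sL sT sg] Sym_pr1_class[OF sT] susp_family_def
            susp_map_def lin_def out_deg_def vs_smult_one[OF graded_vsD[OF T]])
    next
      case False
      then have l: "length w \<ge> 2" using w by (cases w; cases "tl w") (auto simp: words_iff)
      then have "f (desusp w) = \<zero>\<^bsub>T (wdeg w - 1)\<^esub>"
        using s desusp_words[OF w] by (simp add: strict_family_def)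
      then have "susp_family T (-1) f w = \<zero>\<^bsub>susp T (wdeg w)\<^esub>"
        by (simp add: susp_family_def Let_def vs_smult_zero[OF graded_vsD[OF T]] susp_def)
      then show ?thesis
        using False w pw sym_class_zero[OF sT, of "[]" "[]" "wdeg w"]
        by (simp add: Sym_map_class[OF sL sT sg] Sym_pr1_class[OF sT])
    qed
  qed
qed

text \<open>Allows the existentially given \<open>F\<close> of a morphism, and the choice in
  \<open>comor_of\<close>, to be replaced by the explicit \<open>Sym_map\<close>.\<close>

lemma Linf_comor_unique:
  assumes L: "graded_vs L" and T: "graded_vs T" and F: "Linf_comor L T f F" and G: "Linf_comor L T f G"
    and Z: "Z \<in> carrier (Sym (susp L))"
  shows "F Z = G Z"
proof -
  note sL = graded_vs_susp[OF L] and sT = graded_vs_susp[OF T]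
  have lin: "linear_on (Sym (susp L)) (Sym (susp T)) F" "linear_on (Sym (susp L)) (Sym (susp T)) G"
    using F G by (auto simp: Linf_comor_def coalg_morphism_def)
  show ?thesis
  proof (rule Sym_maps_eq[OF sL sT lin _ _ Z])
    fix w assume w: "w \<in> words (susp L)"
    show "Sym_pr1 (susp T) (F (sym_class (susp L) w)) = Sym_pr1 (susp T) (G (sym_class (susp L) w))"
      using F G w by (simp add: Linf_comor_def has_components_def)
    assume eq: "\<And>u. u \<in> words (susp L) \<Longrightarrow> length u < length w \<Longrightarrow> F (sym_class (susp L) u) = G (sym_class (susp L) u)"
    have "comult (susp T) (H (sym_class (susp L) w))
        = tens_map (Sym (susp T)) (Sym (susp T)) H H (comult (susp L) (sym_class (susp L) w))"
      if "Linf_comor L T f H" for H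
      using that sym_class_closed[OF sL w] by (auto simp: Linf_comor_def coalg_morphism_def)
    from this[OF F] this[OF G]
    show "comult (susp T) (F (sym_class (susp L) w)) = comult (susp T) (G (sym_class (susp L) w))"
      using tens_map_comult_cong[OF sL sT lin(1) lin(1) lin(2) lin(2) w eq eq] by simp
  qed
qed

section \<open>Strict surjections\<close>

text \<open>Only the brackets are required to match: that \<open>brT\<close> is skew and satisfies
  the higher Jacobi identities is a conclusion drawn from this, not part of it.\<close>

definition strict_surj ::
    "('k::field_char_0, 'v) graded \<Rightarrow> ('v word \<Rightarrow> 'v) \<Rightarrow> ('k, 'w) graded \<Rightarrow> ('w word \<Rightarrow> 'w) \<Rightarrow>
     ('v word \<Rightarrow> 'w) \<Rightarrow> bool" where
  "strict_surj L br T brT \<phi> \<longleftrightarrow>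
     strict_family L T \<phi> \<and> graded_linear L T (lin \<phi>) \<and>
     (\<forall>i. lin \<phi> i ` carrier (L i) = carrier (T i)) \<and>
     (\<forall>w\<in>words L. brT (map_letters (lin \<phi>) w) = lin \<phi> (out_deg (-2) w) (br w))"

lemma strict_surjD:
  assumes "strict_surj L br T brT \<phi>"
  shows "strict_family L T \<phi>" "graded_linear L T (lin \<phi>)" "lin \<phi> i ` carrier (L i) = carrier (T i)"
    and "w \<in> words L \<Longrightarrow> brT (map_letters (lin \<phi>) w) = lin \<phi> (out_deg (-2) w) (br w)"
  using assms by (auto simp: strict_surj_def)

lemma graded_section:
  assumes L: "graded_vs L" and T: "graded_vs T" and p: "graded_linear L T p"
    and surj: "\<And>i. p i ` carrier (L i) = carrier (T i)"
  obtains s where "graded_linear T L s" "\<And>i y. y \<in> carrier (T i) \<Longrightarrow> p i (s i y) = y"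
proof -
  have "\<exists>s. linear_on (T i) (L i) s \<and> (\<forall>y\<in>carrier (T i). p i (s y) = y)" for i
    using linear_section[OF graded_vsD[OF L] graded_vsD[OF T] graded_linearD[OF p] surj] by metis
  then obtain s where "\<And>i. linear_on (T i) (L i) (s i) \<and> (\<forall>y\<in>carrier (T i). p i (s i y) = y)"
    by metis
  then show ?thesis using that[of s] by (auto simp: graded_linear_def)
qed

text \<open>A coderivation descends along a strict surjection \<open>P\<close>: conjugate it with the coalgebra map of a
  degreewise linear section of \<open>P\<close>.  The result is independent of the section because coderivations
  along \<open>P\<close> are determined by their components.\<close>

context
  fixes L :: "('k::field_char_0, 'v) graded" and T :: "('k, 'w) graded" and br brT \<phi>
  assumes L: "graded_vs L" and T: "graded_vs T" and br: "skew_family L L (-2) br"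
    and surj: "strict_surj L br T brT \<phi>"
begin

private abbreviation "quot_map \<equiv> Sym_map (susp T) (susp_map (lin \<phi>))"

private lemmas lin_\<phi> = strict_surjD(2)[OF surj]
private lemmas onto = strict_surjD(3)[OF surj]
private lemmas br_\<phi> = strict_surjD(4)[OF surj]
private lemmas sL = graded_vs_susp[OF L]
private lemmas sT = graded_vs_susp[OF T]
private lemmas s\<phi> = graded_linear_susp[OF lin_\<phi>]
private lemmas P_lin = Sym_map_linear[OF sL sT s\<phi>]

lemma quot_map_section:
  assumes s: "graded_linear T L s" and ps: "\<And>i y. y \<in> carrier (T i) \<Longrightarrow> lin \<phi> i (s i y) = y"
    and Z: "Z \<in> carrier (Sym (susp T))"
  shows "quot_map (Sym_map (susp L) (susp_map s) Z) = Z"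
proof -
  have id: "graded_linear (susp T) (susp T) (\<lambda>i x. x)" by (simp add: graded_linear_def linear_on_id)
  have "quot_map (Sym_map (susp L) (susp_map s) Z) = Sym_map (susp T) (\<lambda>i x. x) Z"
    by (rule Sym_map_comp[OF sT sL sT graded_linear_susp[OF s] s\<phi> id _ Z])
      (simp add: susp_map_def ps susp_def)
  also have "\<dots> = Z" by (rule Sym_map_id[OF sT id _ Z]) simp
  finally show ?thesis .
qed

lemma quot_map_surj:
  assumes "Z \<in> carrier (Sym (susp T))"
  obtains Y where "Y \<in> carrier (Sym (susp L))" "Z = quot_map Y"
proof -
  obtain s where s: "graded_linear T L s" "\<And>i y. y \<in> carrier (T i) \<Longrightarrow> lin \<phi> i (s i y) = y"
    using graded_section[OF L T lin_\<phi> onto] by metis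
  show ?thesis
    using that quot_map_section[OF s assms] linear_onD(1)[OF Sym_map_linear[OF sT sL graded_linear_susp[OF s(1)]] assms]
    by metis
qed

lemma brT_section:
  assumes s: "graded_linear T L s" and ps: "\<And>i y. y \<in> carrier (T i) \<Longrightarrow> lin \<phi> i (s i y) = y"
    and w: "w \<in> words T"
  shows "brT w = lin \<phi> (out_deg (-2) w) (br (map_letters s w))"
proof -
  have "map_letters (lin \<phi>) (map_letters s w) = w"
    unfolding map_letters_comp by (rule map_letters_id[of _ T]) (use w ps in \<open>auto simp: words_iff\<close>)
  then show ?thesis using br_\<phi>[OF map_letters_words(2)[OF s w]] by simp
qed

text \<open>Through a linear section, \<open>brT\<close> becomes \<open>br\<close> composed with
  linear maps and inherits multilinearity and skew symmetry. This matters because \<open>brT\<close>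
  may have been defined by arbitrary preimages.\<close>

lemma skew_quot: "skew_family T T (-2) brT"
proof -
  obtain s where s: "graded_linear T L s" "\<And>i y. y \<in> carrier (T i) \<Longrightarrow> lin \<phi> i (s i y) = y"
    using graded_section[OF L T lin_\<phi> onto] by metis
  have b: "brT w = lin \<phi> (out_deg (-2) w) (br (map_letters s w))" if "w \<in> words T" for w
    by (rule brT_section[OF s(1) _ that]) (rule s(2))
  note ms = map_letters_words[OF s(1)]
  show ?thesis
  proof (rule skew_familyI)
    show "brT w \<in> carrier (T (out_deg (-2) w))" if "w \<in> words T" for w
      unfolding b[OF that] using skew_familyD(1)[OF br ms(2)[OF that]]
      by (intro linear_onD(1)[OF graded_linearD[OF lin_\<phi>]]) simp
    show "linear_on (T i) (T (out_deg (-2) (u @ (i, x0) # t))) (\<lambda>x. brT (u @ (i, x) # t))"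
      if "u \<in> letters T" "t \<in> letters T" "x0 \<in> carrier (T i)" for u t i x0
    proof (rule linear_on_cong[OF graded_vsD[OF T]])
      let ?d = "out_deg (-2) (u @ (i, x0) # t)"
      have "linear_on (L i) (L ?d) (\<lambda>y. br (map_letters s u @ (i, y) # map_letters s t))"
        using skew_familyD(2)[OF br ms(1)[OF that(1)] ms(1)[OF that(2)], of i "s i x0"]
        by (simp add: out_deg_def)
      then show "linear_on (T i) (T ?d) (\<lambda>x. lin \<phi> ?d (br (map_letters s u @ (i, s i x) # map_letters s t)))"
        by (intro linear_on_comp[OF linear_on_comp[OF graded_linearD[OF s(1)]] graded_linearD[OF lin_\<phi>]])
      show "lin \<phi> ?d (br (map_letters s u @ (i, s i x) # map_letters s t)) = brT (u @ (i, x) # t)"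
        if "x \<in> carrier (T i)" for x
        using b[of "u @ (i, x) # t"] that \<open>u \<in> _\<close> \<open>t \<in> _\<close> by (simp add: words_iff out_deg_def)
    qed
    show "brT (u @ x # y # t) = (- sg (fst x * fst y)) \<odot>\<^bsub>T (out_deg (-2) (u @ x # y # t))\<^esub> brT (u @ y # x # t)"
      if a: "u \<in> letters T" "t \<in> letters T" "snd x \<in> carrier (T (fst x))" "snd y \<in> carrier (T (fst y))" for u t x y
    proof -
      have w: "u @ x # y # t \<in> words T" "u @ y # x # t \<in> words T" using a by (auto simp: words_iff)
      let ?d = "out_deg (-2) (u @ x # y # t)"
      have d: "out_deg (-2) (u @ y # x # t) = ?d" by (simp add: out_deg_def)
      have c: "br (map_letters s (u @ y # x # t)) \<in> carrier (L ?d)"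
        using skew_familyD(1)[OF br ms(2)[OF w(2)]] by (simp only: out_deg_map_letters d)
      have "br (map_letters s (u @ x # y # t)) = (- sg (fst x * fst y)) \<odot>\<^bsub>L ?d\<^esub> br (map_letters s (u @ y # x # t))"
        using skew_familyD(3)[OF br ms(1)[OF a(1)] ms(1)[OF a(2)], of "(fst x, s (fst x) (snd x))"
            "(fst y, s (fst y) (snd y))"] linear_onD(1)[OF graded_linearD[OF s(1)]] a
        by (simp add: out_deg_def)
      then show ?thesis
        unfolding b[OF w(1)] b[OF w(2)] d using linear_onD(3)[OF graded_linearD[OF lin_\<phi>] c] by simp
    qed
  qed
qed

lemma coder_quot:
  assumes \<delta>: "Linf_coder L br \<delta>"
  obtains \<delta>T where "Linf_coder T brT \<delta>T" "\<And>Z. Z \<in> carrier (Sym (susp L)) \<Longrightarrow> \<delta>T (quot_map Z) = quot_map (\<delta> Z)"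
proof -
  obtain s where s: "graded_linear T L s" and ps: "\<And>i y. y \<in> carrier (T i) \<Longrightarrow> lin \<phi> i (s i y) = y"
    using graded_section[OF L T lin_\<phi> onto] by metis
  note ss = graded_linear_susp[OF s]
  let ?L = "Sym (susp L)" and ?T = "Sym (susp T)" and ?P = "quot_map" and ?s = "Sym_map (susp L) (susp_map s)"
  note vL = Sym_is_vs[OF sL] and vT = Sym_is_vs[OF sT]
  note s_lin = Sym_map_linear[OF sT sL ss]
  have \<delta>_lin: "linear_on ?L ?L \<delta>" and \<delta>_deg: "\<And>j Z. Z \<in> Sym_deg (susp L) j \<Longrightarrow> \<delta> Z \<in> Sym_deg (susp L) (j - 1)"
    and \<delta>_com: "\<And>Z. Z \<in> carrier ?L \<Longrightarrow> comult (susp L) (\<delta> Z) =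
          tens_map ?L ?L \<delta> (\<lambda>Y. Y) (comult (susp L) Z) \<oplus>\<^bsub>Sym2 (susp L)\<^esub>
          tens_map ?L ?L (Sym_sign (susp L)) \<delta> (comult (susp L) Z)"
    and \<delta>_comp: "\<And>w. w \<in> words (susp L) \<Longrightarrow> Sym_pr1 (susp L) (\<delta> (sym_class (susp L) w))
          = sym_class (susp L) [(wdeg w - 1, susp_family L (-2) br w)]"
    using \<delta> by (auto simp: Linf_coder_def coderivation_def has_components_def)
  have P_com: "\<And>Z. Z \<in> carrier ?L \<Longrightarrow> comult (susp T) (?P Z) = tens_map ?T ?T ?P ?P (comult (susp L) Z)"
    and P_deg: "\<And>j Z. Z \<in> Sym_deg (susp L) j \<Longrightarrow> ?P Z \<in> Sym_deg (susp T) j"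
    using Sym_map_coalg[OF sL sT s\<phi>] by (auto simp: coalg_morphism_def)
  have s_com: "\<And>Z. Z \<in> carrier ?T \<Longrightarrow> comult (susp L) (?s Z) = tens_map ?L ?L ?s ?s (comult (susp T) Z)"
    and s_deg: "\<And>j Z. Z \<in> Sym_deg (susp T) j \<Longrightarrow> ?s Z \<in> Sym_deg (susp L) j"
    using Sym_map_coalg[OF sT sL ss] by (auto simp: coalg_morphism_def)
  note sgL = Sym_sign_linear[OF sL] and sgT = Sym_sign_linear[OF sT]
  define \<delta>T where "\<delta>T Z = ?P (\<delta> (?s Z))" for Z
  have \<delta>T_lin: "linear_on ?T ?T \<delta>T"
    unfolding \<delta>T_def[abs_def] by (rule linear_on_comp[OF linear_on_comp[OF s_lin \<delta>_lin] P_lin])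
  note P\<delta>_lin = linear_on_comp[OF \<delta>_lin P_lin]
  \<comment> \<open>\<open>P \<circ> \<delta>\<close> is a coderivation along \<open>P\<close>: in
    its coproduct formula \<open>P\<close> stands where the identity would be.\<close>
  have com_P\<delta>: "comult (susp T) (?P (\<delta> Z)) =
      tens_map ?T ?T (\<lambda>Y. ?P (\<delta> Y)) ?P (comult (susp L) Z) \<oplus>\<^bsub>Sym2 (susp T)\<^esub>
      tens_map ?T ?T (\<lambda>Y. ?P (Sym_sign (susp L) Y)) (\<lambda>Y. ?P (\<delta> Y)) (comult (susp L) Z)"
    if Z: "Z \<in> carrier ?L" for Z
  proof -
    note cZ = linear_onD(1)[OF comult_linear[OF sL] Z]
    note PP = tens_map_linear[OF vL vL vT vT P_lin P_lin]
    show ?thesis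
      unfolding P_com[OF linear_onD(1)[OF \<delta>_lin Z]] \<delta>_com[OF Z]
      by (subst linear_onD(2)[OF PP])
        (intro linear_onD(1)[OF tens_map_linear[OF vL vL vL vL] cZ] \<delta>_lin sgL linear_on_id
          | simp add: tens_map_comp[OF vL vL vL vL vT vT \<delta>_lin linear_on_id P_lin P_lin cZ]
              tens_map_comp[OF vL vL vL vL vT vT sgL \<delta>_lin P_lin P_lin cZ])+
  qed
  have "coderivation (susp T) \<delta>T"
    unfolding coderivation_def
  proof (intro conjI allI ballI)
    show "linear_on ?T ?T \<delta>T" by (rule \<delta>T_lin)
    show "\<delta>T Z \<in> Sym_deg (susp T) (j - 1)" if "Z \<in> Sym_deg (susp T) j" for j Z
      unfolding \<delta>T_def by (intro P_deg \<delta>_deg s_deg that)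
    fix Z assume Z: "Z \<in> carrier ?T"
    note sZ = linear_onD(1)[OF s_lin Z] and cZ = linear_onD(1)[OF comult_linear[OF sT] Z]
    have id: "?P (?s Y) = Y" if "Y \<in> carrier ?T" for Y by (rule quot_map_section[OF s ps that])
    have 1: "tens_map ?T ?T (\<lambda>Y. ?P (\<delta> Y)) ?P (tens_map ?L ?L ?s ?s (comult (susp T) Z))
        = tens_map ?T ?T \<delta>T (\<lambda>Y. Y) (comult (susp T) Z)"
      unfolding tens_map_comp[OF vT vT vL vL vT vT s_lin s_lin P\<delta>_lin P_lin cZ]
      by (rule tens_map_cong[OF vT vT vT vT linear_on_comp[OF s_lin P\<delta>_lin] linear_on_comp[OF s_lin P_lin]
            \<delta>T_lin linear_on_id _ _ cZ]) (auto simp: \<delta>T_def id)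
    have 2: "tens_map ?T ?T (\<lambda>Y. ?P (Sym_sign (susp L) Y)) (\<lambda>Y. ?P (\<delta> Y)) (tens_map ?L ?L ?s ?s (comult (susp T) Z))
        = tens_map ?T ?T (Sym_sign (susp T)) \<delta>T (comult (susp T) Z)"
      unfolding tens_map_comp[OF vT vT vL vL vT vT s_lin s_lin linear_on_comp[OF sgL P_lin] P\<delta>_lin cZ]
    proof (rule tens_map_cong[OF vT vT vT vT linear_on_comp[OF s_lin linear_on_comp[OF sgL P_lin]]
          linear_on_comp[OF s_lin P\<delta>_lin] sgT \<delta>T_lin _ _ cZ])
      show "?P (Sym_sign (susp L) (?s Y)) = Sym_sign (susp T) Y" if "Y \<in> carrier ?T" for Y
        using Sym_map_sign[OF sL sT s\<phi> linear_onD(1)[OF s_lin that]] id[OF that] by simp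
    qed (simp add: \<delta>T_def)
    show "comult (susp T) (\<delta>T Z) = tens_map ?T ?T \<delta>T (\<lambda>Y. Y) (comult (susp T) Z) \<oplus>\<^bsub>Sym2 (susp T)\<^esub>
          tens_map ?T ?T (Sym_sign (susp T)) \<delta>T (comult (susp T) Z)"
      unfolding \<delta>T_def[of Z] com_P\<delta>[OF sZ] s_com[OF Z] 1 2 ..
  qed
  have P_comp: "Sym_pr1 (susp T) (?P (\<delta> (sym_class (susp L) w)))
      = sym_class (susp T) [(wdeg w - 1, susp_family T (-2) brT (map_letters (susp_map (lin \<phi>)) w))]"
    if w: "w \<in> words (susp L)" for w
  proof -
    have b: "br (desusp w) \<in> carrier (L (wdeg w + -2))"
      using skew_familyD(1)[OF br desusp_words[OF w]] by simp
    then have b': "susp_family L (-2) br w \<in> carrier (L (wdeg w - 2))"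
      by (simp add: susp_family_def Let_def vs_smult_closed[OF graded_vsD[OF L]])
    have e: "susp_family T (-2) brT (map_letters (susp_map (lin \<phi>)) w) = lin \<phi> (wdeg w + -2) (susp_family L (-2) br w)"
      by (rule susp_family_natural[where L = L and br = br and r = "-2", OF lin_\<phi> b]) (use br_\<phi>[OF desusp_words[OF w]] in simp)
    have "Sym_pr1 (susp T) (?P (\<delta> (sym_class (susp L) w))) = ?P (sym_class (susp L) [(wdeg w - 1, susp_family L (-2) br w)])"
      using Sym_map_pr1[OF sL sT s\<phi> linear_onD(1)[OF \<delta>_lin sym_class_closed[OF sL w]]] \<delta>_comp[OF w] by simp
    also have "\<dots> = sym_class (susp T) [(wdeg w - 1, susp_family T (-2) brT (map_letters (susp_map (lin \<phi>)) w))]"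
      using b' e by (subst Sym_map_class[OF sL sT s\<phi>]) (simp_all add: words_iff susp_def susp_map_def)
    finally show ?thesis .
  qed
  have comp: "Sym_pr1 (susp T) (\<delta>T (sym_class (susp T) w)) = sym_class (susp T) [(wdeg w - 1, susp_family T (-2) brT w)]"
    if w: "w \<in> words (susp T)" for w
  proof -
    have "map_letters (susp_map (lin \<phi>)) (map_letters (susp_map s) w) = w"
      unfolding map_letters_comp
      by (rule map_letters_id[of _ "susp T"]) (use w ps in \<open>auto simp: words_iff susp_def susp_map_def\<close>)
    then show ?thesis
      unfolding \<delta>T_def using P_comp[OF map_letters_words(2)[OF ss w]] w by (simp add: Sym_map_class[OF sT sL ss])
  qed
  have coder: "Linf_coder T brT \<delta>T"
    unfolding Linf_coder_def has_components_def using \<open>coderivation (susp T) \<delta>T\<close> comp by simp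
  \<comment> \<open>By definition \<open>\<delta>T\<close> is \<open>P \<delta>\<close> evaluated on
    the section, whose image need not contain \<open>Z\<close>. Both sides are coderivations along
    \<open>P\<close> with the same components, which closes the gap.\<close>
  have "\<delta>T (?P Z) = ?P (\<delta> Z)" if Z: "Z \<in> carrier ?L" for Z
  proof (rule Sym_maps_eq[OF sL sT linear_on_comp[OF P_lin \<delta>T_lin] P\<delta>_lin _ _ Z])
    fix w assume w: "w \<in> words (susp L)"
    note pw = map_letters_words(2)[OF s\<phi> w] and c = sym_class_closed[OF sL w]
    show "Sym_pr1 (susp T) (\<delta>T (?P (sym_class (susp L) w))) = Sym_pr1 (susp T) (?P (\<delta> (sym_class (susp L) w)))"
      using comp[OF pw] P_comp[OF w] by (simp add: Sym_map_class[OF sL sT s\<phi> w])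
    assume eq: "\<And>u. u \<in> words (susp L) \<Longrightarrow> length u < length w \<Longrightarrow>
      \<delta>T (?P (sym_class (susp L) u)) = ?P (\<delta> (sym_class (susp L) u))"
    note cc = linear_onD(1)[OF comult_linear[OF sL] c]
    have "comult (susp T) (\<delta>T (?P (sym_class (susp L) w))) =
        tens_map ?T ?T \<delta>T (\<lambda>Y. Y) (tens_map ?T ?T ?P ?P (comult (susp L) (sym_class (susp L) w))) \<oplus>\<^bsub>Sym2 (susp T)\<^esub>
        tens_map ?T ?T (Sym_sign (susp T)) \<delta>T (tens_map ?T ?T ?P ?P (comult (susp L) (sym_class (susp L) w)))"
      using \<open>coderivation (susp T) \<delta>T\<close> linear_onD(1)[OF P_lin c] P_com[OF c]
      by (simp add: coderivation_def)
    also have "\<dots> = tens_map ?T ?T (\<lambda>Y. \<delta>T (?P Y)) ?P (comult (susp L) (sym_class (susp L) w)) \<oplus>\<^bsub>Sym2 (susp T)\<^esub>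
        tens_map ?T ?T (\<lambda>Y. Sym_sign (susp T) (?P Y)) (\<lambda>Y. \<delta>T (?P Y)) (comult (susp L) (sym_class (susp L) w))"
      by (simp add: tens_map_comp[OF vL vL vT vT vT vT P_lin P_lin \<delta>T_lin linear_on_id cc]
          tens_map_comp[OF vL vL vT vT vT vT P_lin P_lin sgT \<delta>T_lin cc])
    also have "tens_map ?T ?T (\<lambda>Y. \<delta>T (?P Y)) ?P (comult (susp L) (sym_class (susp L) w))
        = tens_map ?T ?T (\<lambda>Y. ?P (\<delta> Y)) ?P (comult (susp L) (sym_class (susp L) w))"
      by (rule tens_map_comult_cong[OF sL sT linear_on_comp[OF P_lin \<delta>T_lin] P_lin P\<delta>_lin P_lin w eq refl])
    also have "tens_map ?T ?T (\<lambda>Y. Sym_sign (susp T) (?P Y)) (\<lambda>Y. \<delta>T (?P Y)) (comult (susp L) (sym_class (susp L) w))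
        = tens_map ?T ?T (\<lambda>Y. ?P (Sym_sign (susp L) Y)) (\<lambda>Y. ?P (\<delta> Y)) (comult (susp L) (sym_class (susp L) w))"
      by (rule tens_map_comult_cong[OF sL sT linear_on_comp[OF P_lin sgT] linear_on_comp[OF P_lin \<delta>T_lin]
            linear_on_comp[OF sgL P_lin] P\<delta>_lin w Sym_map_sign[OF sL sT s\<phi> sym_class_closed[OF sL]] eq])
    also have "tens_map ?T ?T (\<lambda>Y. ?P (\<delta> Y)) ?P (comult (susp L) (sym_class (susp L) w)) \<oplus>\<^bsub>Sym2 (susp T)\<^esub> \<dots>
        = comult (susp T) (?P (\<delta> (sym_class (susp L) w)))"
      by (rule com_P\<delta>[OF c, symmetric])
    finally show "comult (susp T) (\<delta>T (?P (sym_class (susp L) w))) = comult (susp T) (?P (\<delta> (sym_class (susp L) w)))" .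
  qed
  then show ?thesis using that coder by blast
qed

end

lemma Linf_algebraD:
  assumes "Linf_algebra L br"
  shows "graded_vs L" "skew_family L L (-2) br"
  using assms by (auto simp: Linf_algebra_def)

text \<open>\<open>\<delta>T\<close> squares to zero because the surjection \<open>P\<close>
  intertwines it with \<open>\<delta>\<close>; the same intertwining makes \<open>\<phi>\<close> a
  morphism.\<close>

lemma Linf_algebra_quot:
  assumes L: "Linf_algebra L br" and T: "graded_vs T" and surj: "strict_surj L br T brT \<phi>"
  shows "Linf_algebra T brT" and "Linf_morphism L br T brT \<phi>"
proof -
  note vL = Linf_algebraD(1)[OF L] and br = Linf_algebraD(2)[OF L]
  note sL = graded_vs_susp[OF vL] and sT = graded_vs_susp[OF T]
  let ?P = "Sym_map (susp T) (susp_map (lin \<phi>))"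
  obtain \<delta> where \<delta>: "Linf_coder L br \<delta>" and \<delta>2: "\<And>Z. Z \<in> carrier (Sym (susp L)) \<Longrightarrow> \<delta> (\<delta> Z) = \<zero>\<^bsub>Sym (susp L)\<^esub>"
    using L by (auto simp: Linf_algebra_def)
  have \<delta>c: "\<delta> Z \<in> carrier (Sym (susp L))" if "Z \<in> carrier (Sym (susp L))" for Z
    using \<delta> that by (auto simp: Linf_coder_def coderivation_def linear_on_def)
  obtain \<delta>T where \<delta>T: "Linf_coder T brT \<delta>T"
    and com: "\<And>Z. Z \<in> carrier (Sym (susp L)) \<Longrightarrow> \<delta>T (?P Z) = ?P (\<delta> Z)"
    using coder_quot[OF vL T br surj \<delta>] by metis
  note lin\<phi> = strict_surjD(2)[OF surj]
  note P = Sym_map_linear[OF sL sT graded_linear_susp[OF lin\<phi>]]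
  have "\<delta>T (\<delta>T Z) = \<zero>\<^bsub>Sym (susp T)\<^esub>" if "Z \<in> carrier (Sym (susp T))" for Z
  proof -
    obtain Y where Y: "Y \<in> carrier (Sym (susp L))" "Z = ?P Y"
      using quot_map_surj[OF vL T br surj \<open>Z \<in> _\<close>] by metis
    then show ?thesis
      using linear_on_zero[OF Sym_is_vs[OF sL] Sym_is_vs[OF sT] P] by (simp add: com \<delta>c \<delta>2)
  qed
  then show alg: "Linf_algebra T brT"
    using T skew_quot[OF vL T br surj] \<delta>T by (auto simp: Linf_algebra_def)
  note s = strict_surjD(1)[OF surj]
  show "Linf_morphism L br T brT \<phi>"
    unfolding Linf_morphism_def
    using L alg strict_skew_family[OF vL T lin\<phi> s] Linf_comor_strict[OF vL T lin\<phi> s] \<delta> \<delta>T com by metis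
qed

text \<open>With \<open>P\<close>, \<open>P'\<close>, \<open>F\<close>, \<open>G\<close> the induced
  coalgebra maps, \<open>G \<delta>T P = G P \<delta> = P' F \<delta> = P' \<delta>' F = \<delta>T'
  P' F = \<delta>T' G P\<close>, and the surjection \<open>P\<close> can be cancelled.\<close>

lemma Linf_morphism_quot:
  assumes f: "Linf_morphism L br L' br' f" "strict_family L L' f"
    and T: "graded_vs T" and T': "graded_vs T'"
    and surj: "strict_surj L br T brT \<phi>" and surj': "strict_surj L' br' T' brT' \<phi>'"
    and g: "graded_linear T T' (lin g)" "strict_family T T' g"
    and eq: "\<And>i x. x \<in> carrier (L i) \<Longrightarrow> lin g i (lin \<phi> i x) = lin \<phi>' i (lin f i x)"
  shows "Linf_morphism T brT T' brT' g"
proof -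
  have L: "Linf_algebra L br" and L': "Linf_algebra L' br'" and skf: "skew_family L L' (-1) f"
    using f by (auto simp: Linf_morphism_def)
  note vL = Linf_algebraD(1)[OF L] and br = Linf_algebraD(2)[OF L]
  note vL' = Linf_algebraD(1)[OF L'] and br' = Linf_algebraD(2)[OF L']
  note sL = graded_vs_susp[OF vL] and sT = graded_vs_susp[OF T]
  note sL' = graded_vs_susp[OF vL'] and sT' = graded_vs_susp[OF T']
  note linf = skew_family_lin[OF skf]
  note lin\<phi> = strict_surjD(2)[OF surj] and lin\<phi>' = strict_surjD(2)[OF surj']
  let ?P = "Sym_map (susp T) (susp_map (lin \<phi>))" and ?P' = "Sym_map (susp T') (susp_map (lin \<phi>'))"
  let ?F = "Sym_map (susp L') (susp_map (lin f))" and ?G = "Sym_map (susp T') (susp_map (lin g))"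
  obtain F \<delta> \<delta>' where F: "Linf_comor L L' f F" and \<delta>: "Linf_coder L br \<delta>" and \<delta>': "Linf_coder L' br' \<delta>'"
    and com: "\<And>Z. Z \<in> carrier (Sym (susp L)) \<Longrightarrow> F (\<delta> Z) = \<delta>' (F Z)"
    using f by (auto simp: Linf_morphism_def)
  \<comment> \<open>The morphism provides some coalgebra map \<open>F\<close>; uniqueness identifies
    it with the one induced by the linear part.\<close>
  have FF: "F Z = ?F Z" if "Z \<in> carrier (Sym (susp L))" for Z
    by (rule Linf_comor_unique[OF vL vL' F Linf_comor_strict[OF vL vL' linf f(2)] that])
  have \<delta>c: "\<delta> Z \<in> carrier (Sym (susp L))" if "Z \<in> carrier (Sym (susp L))" for Z
    using \<delta> that by (auto simp: Linf_coder_def coderivation_def linear_on_def)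
  obtain \<delta>T where \<delta>T: "Linf_coder T brT \<delta>T"
    and comT: "\<And>Z. Z \<in> carrier (Sym (susp L)) \<Longrightarrow> \<delta>T (?P Z) = ?P (\<delta> Z)"
    using coder_quot[OF vL T br surj \<delta>] by metis
  obtain \<delta>T' where \<delta>T': "Linf_coder T' brT' \<delta>T'"
    and comT': "\<And>Z. Z \<in> carrier (Sym (susp L')) \<Longrightarrow> \<delta>T' (?P' Z) = ?P' (\<delta>' Z)"
    using coder_quot[OF vL' T' br' surj' \<delta>'] by metis
  have h: "graded_linear (susp L) (susp T') (susp_map (\<lambda>i x. lin \<phi>' i (lin f i x)))"
    by (intro graded_linear_susp)
      (auto simp: graded_linear_def intro: linear_on_comp[OF graded_linearD[OF linf] graded_linearD[OF lin\<phi>']])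
  have GP: "?G (?P Z) = ?P' (?F Z)" if "Z \<in> carrier (Sym (susp L))" for Z
  proof -
    have "?G (?P Z) = Sym_map (susp T') (susp_map (\<lambda>i x. lin \<phi>' i (lin f i x))) Z"
      by (rule Sym_map_comp[OF sL sT sT' graded_linear_susp[OF lin\<phi>] graded_linear_susp[OF g(1)] h _ that])
        (simp add: susp_map_def eq susp_def)
    also have "\<dots> = ?P' (?F Z)"
      by (rule Sym_map_comp[OF sL sL' sT' graded_linear_susp[OF linf] graded_linear_susp[OF lin\<phi>'] h _ that, symmetric])
        (simp add: susp_map_def)
    finally show ?thesis .
  qed
  have "?G (\<delta>T Z) = \<delta>T' (?G Z)" if "Z \<in> carrier (Sym (susp T))" for Z
  proof -
    obtain Y where Y: "Y \<in> carrier (Sym (susp L))" "Z = ?P Y"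
      using quot_map_surj[OF vL T br surj \<open>Z \<in> _\<close>] by metis
    have "?F Y \<in> carrier (Sym (susp L'))"
      by (rule linear_onD(1)[OF Sym_map_linear[OF sL sL' graded_linear_susp[OF linf]] Y(1)])
    then show ?thesis
      using com[OF Y(1)] FF[OF Y(1)] FF[OF \<delta>c[OF Y(1)]] Y by (simp add: comT comT' GP \<delta>c)
  qed
  then show ?thesis
    unfolding Linf_morphism_def
    using Linf_algebra_quot(1)[OF L T surj] Linf_algebra_quot(1)[OF L' T' surj'] strict_skew_family[OF T T' g]
      Linf_comor_strict[OF T T' g] \<delta>T \<delta>T' by metis
qed

lemma comor_of_strict:
  assumes "graded_vs L" "graded_vs T" "graded_linear L T (lin f)" "strict_family L T f"
    and "Z \<in> carrier (Sym (susp L))"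
  shows "comor_of L T f Z = Sym_map (susp T) (susp_map (lin f)) Z"
  unfolding comor_of_def
  by (rule Linf_comor_unique[OF assms(1,2) _ Linf_comor_strict[OF assms(1-4)] assms(5)],
      rule someI[where P = "Linf_comor L T f"])
    (rule Linf_comor_strict[OF assms(1-4)])

section \<open>The coderivation on words of length one and two\<close>

lemma bsets_1 [simp]: "bsets (Suc 0) = {}"
  by (auto simp: bsets_def length_Suc_conv)

lemma bsets_2: "bsets 2 = {[True, False], [False, True]}"
  by (auto simp: bsets_def length_Suc_conv numeral_2_eq_2)

lemma vs_finsum_pair:
  assumes "is_vs M" "a \<noteq> b" "g a \<in> carrier M" "g b \<in> carrier M"
  shows "(\<Oplus>\<^bsub>M\<^esub>i\<in>{a, b}. g i) = g a \<oplus>\<^bsub>M\<^esub> g b"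
  by (subst vs_finsum_insert[OF assms(1)]) (use assms in \<open>auto simp: vs_finsum_singleton\<close>)

lemma Linf_coderD:
  assumes "Linf_coder L br \<delta>"
  shows "linear_on (Sym (susp L)) (Sym (susp L)) \<delta>"
    and "Z \<in> carrier (Sym (susp L)) \<Longrightarrow> comult (susp L) (\<delta> Z) =
          tens_map (Sym (susp L)) (Sym (susp L)) \<delta> (\<lambda>Y. Y) (comult (susp L) Z) \<oplus>\<^bsub>Sym2 (susp L)\<^esub>
          tens_map (Sym (susp L)) (Sym (susp L)) (Sym_sign (susp L)) \<delta> (comult (susp L) Z)"
    and "w \<in> words (susp L) \<Longrightarrow> Sym_pr1 (susp L) (\<delta> (sym_class (susp L) w))
          = sym_class (susp L) [(wdeg w - 1, susp_family L (-2) br w)]"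
  using assms by (auto simp: Linf_coder_def coderivation_def has_components_def)

lemma susp_family_closed:
  assumes "graded_vs L" "skew_family L L (-2) br" "w \<in> words (susp L)"
  shows "susp_family L (-2) br w \<in> carrier (susp L (wdeg w - 1))"
  using skew_familyD(1)[OF assms(2) desusp_words[OF assms(3)]]
  by (simp add: susp_family_def Let_def susp_def vs_smult_closed[OF graded_vsD[OF assms(1)]])

lemma differential_linear: "skew_family L L (-2) br \<Longrightarrow> linear_on (L i) (L (i - 1)) (\<lambda>x. br [(i, x)])"
  using skew_familyD(2)[of L L "-2" br "[]" "[]" i] by (simp add: out_deg_def)

context
  fixes L :: "('k::field_char_0, 'v) graded" and br \<delta>
  assumes L: "graded_vs L" and br: "skew_family L L (-2) br" and \<delta>: "Linf_coder L br \<delta>"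
begin

text \<open>The reduced coproduct of one letter is zero, so by \<open>Sym_decompose\<close> the
  value of \<open>\<delta>\<close> is its own linear part; the suspension sign is trivial in this
  arity.\<close>

lemma coder_single:
  assumes x: "x \<in> carrier (L i)"
  shows "\<delta> (sym_class (susp L) [(i + 1, x)]) = sym_class (susp L) [(i, br [(i, x)])]"
proof -
  note sL = graded_vs_susp[OF L]
  note vS = Sym_is_vs[OF sL] and vS2 = Sym2_is_vs[OF sL]
  let ?w = "[(i + 1, x)]"
  have w: "?w \<in> words (susp L)" using x by (simp add: words_iff susp_def)
  note c = sym_class_closed[OF sL w]
  note T = tens_map_linear[OF vS vS vS vS]
  have "comult (susp L) (sym_class (susp L) ?w) = \<zero>\<^bsub>Sym2 (susp L)\<^esub>"
    unfolding comult_class[OF sL w] unshuffle_def[OF sL] using vs_finsum_empty[OF vS2] by simp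
  then have "comult (susp L) (\<delta> (sym_class (susp L) ?w)) = \<zero>\<^bsub>Sym2 (susp L)\<^esub>"
    using linear_on_zero[OF vS2 vS2 T[OF Linf_coderD(1)[OF \<delta>] linear_on_id]]
      linear_on_zero[OF vS2 vS2 T[OF Sym_sign_linear[OF sL] Linf_coderD(1)[OF \<delta>]]]
    by (simp add: Linf_coderD(2)[OF \<delta> c] vs_simps[OF vS2])
  moreover have "\<delta> (sym_class (susp L) ?w) \<in> carrier (Sym (susp L))"
    by (rule linear_onD(1)[OF Linf_coderD(1)[OF \<delta>] c])
  ultimately have "\<delta> (sym_class (susp L) ?w) = Sym_pr1 (susp L) (\<delta> (sym_class (susp L) ?w))"
    using Sym_decompose[OF sL, of "\<delta> (sym_class (susp L) ?w)"]
      linear_onD(1)[OF Sym_pr1_linear[OF sL], of "\<delta> (sym_class (susp L) ?w)"]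
      linear_on_zero[OF vS2 vS Sym_mult_linear[OF sL]] linear_on_zero[OF vS vS Sym_scale_linear[OF sL]]
    by (simp add: vs_simps[OF vS])
  also have "\<dots> = sym_class (susp L) [(i, br [(i, x)])]"
    using skew_familyD(1)[OF br, of "[(i, x)]"] x
    by (simp add: Linf_coderD(3)[OF \<delta> w] susp_family_def vs_smult_one[OF graded_vsD[OF L]] words_iff)
  finally show ?thesis .
qed

lemma sym_class_single_zero: "y \<in> carrier (susp L j) \<Longrightarrow> sym_class (susp L) [(j, y)] = \<zero>\<^bsub>Sym (susp L)\<^esub> \<Longrightarrow> y = \<zero>\<^bsub>susp L j\<^esub>"
  using sym_class_zero[OF graded_vs_susp[OF L], of "[]" "[]" j]
    sym_class_single_inj[OF graded_vs_susp[OF L], of y j "\<zero>\<^bsub>susp L j\<^esub>"]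
    vs_zero_closed[OF graded_vsD[OF graded_vs_susp[OF L]]] by simp

lemma differential_square:
  assumes \<delta>2: "\<And>Z. Z \<in> carrier (Sym (susp L)) \<Longrightarrow> \<delta> (\<delta> Z) = \<zero>\<^bsub>Sym (susp L)\<^esub>"
    and x: "x \<in> carrier (L i)"
  shows "br [(i - 1, br [(i, x)])] = \<zero>\<^bsub>L (i - 2)\<^esub>"
proof -
  note sL = graded_vs_susp[OF L]
  have dx: "br [(i, x)] \<in> carrier (L (i - 1))" by (rule linear_onD(1)[OF differential_linear[OF br] x])
  have ddx: "br [(i - 1, br [(i, x)])] \<in> carrier (L (i - 2))"
    using linear_onD(1)[OF differential_linear[OF br] dx] by simp
  have "\<delta> (\<delta> (sym_class (susp L) [(i + 1, x)])) = \<zero>\<^bsub>Sym (susp L)\<^esub>"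
    by (intro \<delta>2 sym_class_closed[OF sL]) (use x in \<open>simp add: words_iff susp_def\<close>)
  moreover have "\<delta> (\<delta> (sym_class (susp L) [(i + 1, x)])) = sym_class (susp L) [(i - 1, br [(i - 1, br [(i, x)])])]"
    using coder_single[OF x] coder_single[OF dx] by simp
  ultimately show ?thesis
    using sym_class_single_zero[of "br [(i - 1, br [(i, x)])]" "i - 1"] ddx by (simp add: susp_def)
qed

text \<open>The part of the Leibniz rule needed to see that the boundaries in degree \<open>m\<close> together with everything
  above form an ideal: it is the linear part of \<open>\<delta>\<^sup>2 = 0\<close> on \<open>y \<or> x\<close> with \<open>d x = 0\<close> and \<open>x\<close> of degree \<open>0\<close>.\<close>

lemma binary_bracket_boundary:
  assumes \<delta>2: "\<And>Z. Z \<in> carrier (Sym (susp L)) \<Longrightarrow> \<delta> (\<delta> Z) = \<zero>\<^bsub>Sym (susp L)\<^esub>"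
    and y: "y \<in> carrier (L (m + 1))" and x: "x \<in> carrier (L 0)" and dx: "br [(0, x)] = \<zero>\<^bsub>L (-1)\<^esub>"
  shows "br [(m, br [(m + 1, y)]), (0, x)] \<in> boundaries L br m"
proof -
  note sL = graded_vs_susp[OF L]
  note vS = Sym_is_vs[OF sL] and vS2 = Sym2_is_vs[OF sL]
  let ?S = "Sym (susp L)" and ?c = "sym_class (susp L)"
  note \<delta>lin = Linf_coderD(1)[OF \<delta>]
  define dy where "dy = br [(m + 1, y)]"
  have dy: "dy \<in> carrier (L m)"
    using linear_onD(1)[OF differential_linear[OF br] y] by (simp add: dy_def)
  \<comment> \<open>Degrees in these words are those of the suspension, one higher than in
    \<open>L\<close>.\<close>
  let ?w = "[(m + 2, y), (1, x)]" and ?v = "[(m + 1, dy), (1, x)]"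
  have words: "?w \<in> words (susp L)" "?v \<in> words (susp L)" "[(m + 2, y)] \<in> words (susp L)"
    "[(1, x)] \<in> words (susp L)" "[(m + 1, dy)] \<in> words (susp L)" "[(1, x), (m + 1, dy)] \<in> words (susp L)"
    using x y dy by (auto simp: words_iff susp_def add.commute)
  note cl = words[THEN sym_class_closed[OF sL]]
  have \<delta>x: "\<delta> (?c [(1, x)]) = \<zero>\<^bsub>?S\<^esub>"
    using coder_single[OF x] sym_class_zero[OF sL, of "[]" "[]" 0] dx by (simp add: susp_def)
  have \<delta>y: "\<delta> (?c [(m + 2, y)]) = ?c [(m + 1, dy)]"
    using coder_single[OF y] by (simp add: dy_def add.commute add.left_commute)
  note bil = tens_bilinear[OF vS vS]
  have tl: "tens ?S ?S \<zero>\<^bsub>?S\<^esub> Z = \<zero>\<^bsub>Sym2 (susp L)\<^esub>" "tens ?S ?S Z \<zero>\<^bsub>?S\<^esub> = \<zero>\<^bsub>Sym2 (susp L)\<^esub>"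
    if "Z \<in> carrier ?S" for Z
    using linear_on_zero[OF vS vS2 bilinear_onD(1)[OF bil that]] linear_on_zero[OF vS vS2 bilinear_onD(2)[OF bil that]]
    by auto
  note tc = tens_closed[OF vS vS]
  have tm: "tens_map ?S ?S f g (comult (susp L) (?c ?w)) =
      tens ?S ?S (f (?c [(m + 2, y)])) (g (?c [(1, x)])) \<oplus>\<^bsub>Sym2 (susp L)\<^esub>
      sg (m + 2) \<odot>\<^bsub>Sym2 (susp L)\<^esub> tens ?S ?S (f (?c [(1, x)])) (g (?c [(m + 2, y)]))"
    if f: "linear_on ?S ?S f" and g: "linear_on ?S ?S g" for f g
  proof -
    have "tens ?S ?S (f (?c [(m + 2, y)])) (g (?c [(1, x)])) \<in> carrier (Sym2 (susp L))"
      "tens ?S ?S (f (?c [(1, x)])) (g (?c [(m + 2, y)])) \<in> carrier (Sym2 (susp L))"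
      using linear_onD(1)[OF f] linear_onD(1)[OF g] cl by (auto intro!: tc)
    then show ?thesis
      using tens_map_unshuffle[OF sL sL f g words(1)] bsets_2
      by (simp add: vs_finsum_pair[OF vS2] vs_simps[OF vS2] numeral_2_eq_2)
  qed
  \<comment> \<open>Of the four terms in the coderivation formula, the two that contain
    \<open>\<delta>\<close> of \<open>x\<close> vanish.\<close>
  have "comult (susp L) (\<delta> (?c ?w)) =
      tens ?S ?S (?c [(m + 1, dy)]) (?c [(1, x)]) \<oplus>\<^bsub>Sym2 (susp L)\<^esub>
      sg (m + 2) \<odot>\<^bsub>Sym2 (susp L)\<^esub> tens ?S ?S (sg 1 \<odot>\<^bsub>?S\<^esub> ?c [(1, x)]) (?c [(m + 1, dy)])"
    using cl tc
    by (simp add: Linf_coderD(2)[OF \<delta>] tm[OF \<delta>lin linear_on_id] tm[OF Sym_sign_linear[OF sL] \<delta>lin] \<delta>x \<delta>y tl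
        Sym_sign_class[OF sL] words vs_simps[OF vS2] vs_closed[OF vS])
  also have "\<dots> = tens ?S ?S (?c [(m + 1, dy)]) (?c [(1, x)]) \<oplus>\<^bsub>Sym2 (susp L)\<^esub>
      sg (m + 3) \<odot>\<^bsub>Sym2 (susp L)\<^esub> tens ?S ?S (?c [(1, x)]) (?c [(m + 1, dy)])"
    using cl linear_onD(3)[OF bilinear_onD(1)[OF bil cl(5)] cl(4), of "sg 1"] tc[OF cl(4,5)]
    by (simp add: vs_smult_assoc[OF vS2] sg_add[symmetric] add.commute)
  finally have com: "comult (susp L) (\<delta> (?c ?w)) = \<dots>" .
  \<comment> \<open>The two remaining terms become equal once the letters of the second are
    exchanged, whence the factor 2 below.\<close>
  have "Sym_mult (susp L) (comult (susp L) (\<delta> (?c ?w))) = ?c ?v \<oplus>\<^bsub>?S\<^esub> sg (m + 3) \<odot>\<^bsub>?S\<^esub> ?c [(1, x), (m + 1, dy)]"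
    unfolding com using tc[OF cl(5,4)] tc[OF cl(4,5)]
    by (simp add: linear_onD(2,3)[OF Sym_mult_linear[OF sL]] vs_closed[OF vS2] Sym_mult_tens[OF sL] words)
  also have "?c [(1, x), (m + 1, dy)] = sg (m + 1) \<odot>\<^bsub>?S\<^esub> ?c ?v"
    using sym_multilinearD(3)[OF sym_multilinear_class[OF sL], of "[]" "[]" "(1, x)" "(m + 1, dy)"] x dy
    by (simp add: susp_def)
  also have "sg (m + 3) \<odot>\<^bsub>?S\<^esub> (sg (m + 1) \<odot>\<^bsub>?S\<^esub> ?c ?v) = ?c ?v"
  proof -
    have "sg (m + 3) * sg (m + 1) = (sg (m + 1) * sg (m + 1) * (sg 1 * sg 1) :: 'k)"
      by (simp add: sg_add[symmetric] add.commute del: sg_self)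
    then have "sg (m + 3) * sg (m + 1) = (1 :: 'k)" by simp
    then show ?thesis using cl(2) by (simp add: vs_smult_assoc[OF vS] vs_smult_one[OF vS])
  qed
  also have "?c ?v \<oplus>\<^bsub>?S\<^esub> ?c ?v = 2 \<odot>\<^bsub>?S\<^esub> ?c ?v"
    using vs_smult_l[OF vS cl(2), of 1 1] cl(2) by (simp add: vs_smult_one[OF vS])
  finally have mc: "Sym_mult (susp L) (comult (susp L) (\<delta> (?c ?w))) = 2 \<odot>\<^bsub>?S\<^esub> ?c ?v" .
  define s where "s = susp_family L (-2) br ?w"
  define s' where "s' = susp_family L (-2) br ?v"
  have s: "s \<in> carrier (L (m + 1))" "s' \<in> carrier (L m)"
    using susp_family_closed[OF L br words(1)] susp_family_closed[OF L br words(2)]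
    by (simp_all add: s_def s'_def susp_def add.commute)
  \<comment> \<open>The factor 2 divided by the number of splittings of a two-letter word. Its value
    is 1, but the argument needs it only to be nonzero.\<close>
  let ?e = "2 * inverse (of_nat (card (bsets 2))) :: 'k"
  have \<delta>w: "\<delta> (?c ?w) = ?c [(m + 2, s)] \<oplus>\<^bsub>?S\<^esub> ?e \<odot>\<^bsub>?S\<^esub> ?c ?v"
  proof -
    let ?f = "\<lambda>k _. if k \<le> 1 then 0 else inverse (of_nat (card (bsets k))) :: 'k"
    have "wdeg ?w - 1 = m + 2" by simp
    then have 1: "Sym_pr1 (susp L) (\<delta> (?c ?w)) = ?c [(m + 2, s)]"
      using Linf_coderD(3)[OF \<delta> words(1)] by (simp only: s_def)
    have f: "?f (length ?v) (wdeg ?v) = inverse (of_nat (card (bsets 2)))" by (simp add: numeral_2_eq_2)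
    have 2: "Sym_scale (susp L) ?f (2 \<odot>\<^bsub>?S\<^esub> ?c ?v) = ?e \<odot>\<^bsub>?S\<^esub> ?c ?v"
      by (simp only: linear_onD(3)[OF Sym_scale_linear[OF sL] cl(2)] Sym_scale_class[OF sL words(2)] f
          vs_smult_assoc[OF vS cl(2)])
    show ?thesis
      using Sym_decompose[OF sL linear_onD(1)[OF \<delta>lin cl(1)]] unfolding 1 mc 2 .
  qed
  have sw: "[(m + 2, s)] \<in> words (susp L)" using s by (simp add: words_iff susp_def add.commute)
  note csw = sym_class_closed[OF sL sw]
  define ds where "ds = br [(m + 1, s)]"
  have ds: "ds \<in> carrier (L m)" using linear_onD(1)[OF differential_linear[OF br] s(1)] by (simp add: ds_def)
  have \<delta>s: "\<delta> (?c [(m + 2, s)]) = ?c [(m + 1, ds)]"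
    using coder_single[OF s(1)] by (simp add: ds_def add.commute add.left_commute)
  have dsw: "[(m + 1, ds)] \<in> words (susp L)" using ds by (simp add: words_iff susp_def)
  have "\<zero>\<^bsub>?S\<^esub> = \<delta> (\<delta> (?c ?w))" using \<delta>2[OF cl(1)] by simp
  also have "\<dots> = ?c [(m + 1, ds)] \<oplus>\<^bsub>?S\<^esub> ?e \<odot>\<^bsub>?S\<^esub> \<delta> (?c ?v)"
    unfolding \<delta>w using csw cl(2) by (simp add: linear_onD(2,3)[OF \<delta>lin] vs_closed[OF vS] \<delta>s)
  finally have z: "\<zero>\<^bsub>?S\<^esub> = ?c [(m + 1, ds)] \<oplus>\<^bsub>?S\<^esub> ?e \<odot>\<^bsub>?S\<^esub> \<delta> (?c ?v)" .
  \<comment> \<open>The linear part of \<open>\<delta> (\<delta> w) = 0\<close> says that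
    \<open>d s\<close> plus a nonzero multiple of \<open>s'\<close> vanishes.\<close>
  have "\<zero>\<^bsub>?S\<^esub> = Sym_pr1 (susp L) \<zero>\<^bsub>?S\<^esub>"
    using linear_on_zero[OF vS vS Sym_pr1_linear[OF sL]] by simp
  also have "\<dots> = ?c [(m + 1, ds)] \<oplus>\<^bsub>?S\<^esub> ?e \<odot>\<^bsub>?S\<^esub> ?c [(m + 1, s')]"
    unfolding z using sym_class_closed[OF sL dsw] linear_onD(1)[OF \<delta>lin cl(2)]
    by (simp add: linear_onD(2,3)[OF Sym_pr1_linear[OF sL]] vs_closed[OF vS] Sym_pr1_class[OF sL dsw]
        Linf_coderD(3)[OF \<delta> words(2)] s'_def[symmetric] add.commute[of 1 m])
  also have "\<dots> = ?c [(m + 1, ds \<oplus>\<^bsub>L m\<^esub> ?e \<odot>\<^bsub>L m\<^esub> s')]"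
  proof -
    have l: "linear_on (L m) ?S (\<lambda>x. ?c [(m + 1, x)])"
      using sym_multilinearD(2)[OF sym_multilinear_class[OF sL], of "[]" "[]" "m + 1"] by (simp add: susp_def)
    show ?thesis
      using linear_onD(2)[OF l ds, of "?e \<odot>\<^bsub>L m\<^esub> s'"] linear_onD(3)[OF l s(2), of ?e] s
      by (simp add: vs_closed[OF graded_vsD[OF L]])
  qed
  finally have ds0: "ds \<oplus>\<^bsub>L m\<^esub> ?e \<odot>\<^bsub>L m\<^esub> s' = \<zero>\<^bsub>L m\<^esub>"
    using sym_class_single_zero[of "ds \<oplus>\<^bsub>L m\<^esub> ?e \<odot>\<^bsub>L m\<^esub> s'" "m + 1"] ds s
    by (simp add: susp_def vs_closed[OF graded_vsD[OF L]])
  have es: "?e \<odot>\<^bsub>L m\<^esub> s' \<in> carrier (L m)" using s by (simp add: vs_closed[OF graded_vsD[OF L]])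
  have es_eq: "(-1) \<odot>\<^bsub>L m\<^esub> ds = ?e \<odot>\<^bsub>L m\<^esub> s'"
    using vs_add_eq_iff[OF graded_vsD[OF L] vs_zero_closed[OF graded_vsD[OF L]] ds es] ds0 ds
      vs_add_comm[OF graded_vsD[OF L] ds es]
    by (simp add: vs_closed[OF graded_vsD[OF L]] vs_l_zero[OF graded_vsD[OF L]])
  \<comment> \<open>\<open>s'\<close> is the bracket in question up to the suspension sign
    \<open>b\<close>.\<close>
  obtain b where b: "b \<noteq> 0" "s' = b \<odot>\<^bsub>L m\<^esub> br [(m, dy), (0, x)]"
  proof -
    have "sg n \<noteq> (0 :: 'k)" for n by (simp add: sg_def)
    then show ?thesis
      by (intro that[of "(-1) ^ (2 * (2 - 1) div 2) * sg (\<Sum>j<2. int (2 - 1 - j) * fst (?v ! j))"])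
        (simp_all add: s'_def susp_family_def Let_def sg_def out_deg_def numeral_2_eq_2)
  qed
  have v: "br [(m, dy), (0, x)] \<in> carrier (L m)"
    using skew_familyD(1)[OF br, of "[(m, dy), (0, x)]"] dy x by (simp add: words_iff out_deg_def)
  have e: "(?e * b) \<odot>\<^bsub>L m\<^esub> br [(m, dy), (0, x)] = (-1) \<odot>\<^bsub>L m\<^esub> ds"
    unfolding es_eq b(2) using v by (simp add: vs_smult_assoc[OF graded_vsD[OF L]])
  have "?e * b \<noteq> 0" using b card_bsets_pos[of 2] by simp
  then have "br [(m, dy), (0, x)] = (- inverse (?e * b)) \<odot>\<^bsub>L m\<^esub> ds"
    using arg_cong[OF e, of "\<lambda>z. inverse (?e * b) \<odot>\<^bsub>L m\<^esub> z"] v ds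
    by (simp add: vs_smult_assoc[OF graded_vsD[OF L]] vs_smult_one[OF graded_vsD[OF L]] del: inverse_mult_distrib)
  also have "\<dots> = br [(m + 1, (- inverse (?e * b)) \<odot>\<^bsub>L (m + 1)\<^esub> s)]"
    using linear_onD(3)[OF differential_linear[OF br] s(1)] by (simp add: ds_def)
  finally show ?thesis
    unfolding boundaries_def dy_def using s by (auto simp: vs_closed[OF graded_vsD[OF L]])
qed

end

text \<open>Evaluate \<open>F \<delta> = \<delta>' F\<close> on one letter: by
  \<open>coder_single\<close> and strictness both sides are single letters again, and these can be
  compared.\<close>

lemma strict_chain_map:
  assumes f: "Linf_morphism L br L' br' f" "strict_family L L' f" and x: "x \<in> carrier (L i)"
  shows "f [(i - 1, br [(i, x)])] = br' [(i, f [(i, x)])]"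
proof -
  have L: "Linf_algebra L br" and L': "Linf_algebra L' br'" and skf: "skew_family L L' (-1) f"
    using f by (auto simp: Linf_morphism_def)
  note vL = Linf_algebraD(1)[OF L] and br = Linf_algebraD(2)[OF L]
  note vL' = Linf_algebraD(1)[OF L'] and br' = Linf_algebraD(2)[OF L']
  note sL = graded_vs_susp[OF vL] and sL' = graded_vs_susp[OF vL']
  note linf = skew_family_lin[OF skf]
  obtain F \<delta> \<delta>' where F: "Linf_comor L L' f F" and \<delta>: "Linf_coder L br \<delta>" and \<delta>': "Linf_coder L' br' \<delta>'"
    and com: "\<And>Z. Z \<in> carrier (Sym (susp L)) \<Longrightarrow> F (\<delta> Z) = \<delta>' (F Z)"
    using f by (auto simp: Linf_morphism_def)
  have F1: "F (sym_class (susp L) [(j + 1, z)]) = sym_class (susp L') [(j + 1, f [(j, z)])]"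
    if "z \<in> carrier (L j)" for j z
  proof -
    have w: "[(j + 1, z)] \<in> words (susp L)" using that by (simp add: words_iff susp_def)
    show ?thesis
      using Linf_comor_unique[OF vL vL' F Linf_comor_strict[OF vL vL' linf f(2)] sym_class_closed[OF sL w]]
      by (simp add: Sym_map_class[OF sL sL' graded_linear_susp[OF linf] w] susp_map_def lin_def)
  qed
  have fx: "f [(i, x)] \<in> carrier (L' i)"
    using linear_onD(1)[OF graded_linearD[OF linf] x] by (simp add: lin_def)
  have dx: "br [(i, x)] \<in> carrier (L (i - 1))" by (rule linear_onD(1)[OF differential_linear[OF br] x])
  have "[(i + 1, x)] \<in> words (susp L)" using x by (simp add: words_iff susp_def)
  then have "F (\<delta> (sym_class (susp L) [(i + 1, x)])) = \<delta>' (F (sym_class (susp L) [(i + 1, x)]))"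
    by (intro com sym_class_closed[OF sL])
  then have "sym_class (susp L') [(i, f [(i - 1, br [(i, x)])])] = sym_class (susp L') [(i, br' [(i, f [(i, x)])])]"
    using coder_single[OF vL br \<delta> x] coder_single[OF vL' br' \<delta>' fx] F1[OF x] F1[OF dx] by simp
  then show ?thesis
  proof (rule sym_class_single_inj[OF sL', rotated 2])
    show "f [(i - 1, br [(i, x)])] \<in> carrier (susp L' i)"
      using linear_onD(1)[OF graded_linearD[OF linf] dx] by (simp add: lin_def susp_def)
    show "br' [(i, f [(i, x)])] \<in> carrier (susp L' i)"
      using linear_onD(1)[OF differential_linear[OF br'] fx] by (simp add: susp_def)
  qed
qed

section \<open>Maps defined through chosen preimages\<close>

definition lift :: "('k, 'v) module \<Rightarrow> ('v \<Rightarrow> 'x) \<Rightarrow> 'x \<Rightarrow> 'v" where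
  "lift M p y = (SOME x. x \<in> carrier M \<and> p x = y)"

lemma lift_props:
  assumes "y \<in> p ` carrier M"
  shows "lift M p y \<in> carrier M" "p (lift M p y) = y"
  using someI_ex[of "\<lambda>x. x \<in> carrier M \<and> p x = y"] assms unfolding lift_def by auto

text \<open>The chosen preimage of \<open>p x\<close> and \<open>x\<close> itself differ by an
  element of the kernel of \<open>p\<close>, which \<open>k\<close> annihilates. So the non-linear
  choice does no harm.\<close>

lemma lift_factor:
  assumes M: "is_vs M" and T: "is_vs T" and N: "is_vs N"
    and p: "linear_on M T p" and k: "linear_on M N k"
    and ker: "\<And>x. x \<in> carrier M \<Longrightarrow> p x = \<zero>\<^bsub>T\<^esub> \<Longrightarrow> k x = \<zero>\<^bsub>N\<^esub>"
    and x: "x \<in> carrier M"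
  shows "k (lift M p (p x)) = k x"
proof -
  let ?y = "lift M p (p x)"
  have y: "?y \<in> carrier M" "p ?y = p x" using lift_props[of "p x" p M] x by auto
  have m: "(-1) \<odot>\<^bsub>M\<^esub> x \<in> carrier M" using x by (simp add: vs_closed[OF M])
  have "p (?y \<oplus>\<^bsub>M\<^esub> (-1) \<odot>\<^bsub>M\<^esub> x) = \<zero>\<^bsub>T\<^esub>"
    using y x m linear_onD(1)[OF p x] by (simp add: linear_onD(2,3)[OF p] vs_r_neg[OF T])
  then have "k (?y \<oplus>\<^bsub>M\<^esub> (-1) \<odot>\<^bsub>M\<^esub> x) = \<zero>\<^bsub>N\<^esub>"
    using y m by (intro ker) (simp_all add: vs_closed[OF M])
  then show ?thesis
    using y x m linear_onD(1)[OF k] by (simp add: linear_onD(2,3)[OF k] vs_diff_eq_zero[OF N])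
qed

text \<open>Linearity of \<open>h\<close> is tested on images under \<open>p\<close>, where
  \<open>h\<close> is known to be \<open>k\<close>; in this way maps built with \<open>lift\<close>
  are shown to be linear.\<close>

lemma linear_on_factor:
  assumes M: "is_vs M" and surj: "p ` carrier M = carrier T" and p: "linear_on M T p" and k: "linear_on M N k"
    and h: "\<And>x. x \<in> carrier M \<Longrightarrow> h (p x) = k x"
  shows "linear_on T N h"
  unfolding linear_on_def surj[symmetric]
proof (intro conjI ballI allI; elim imageE; hypsubst)
  fix x assume x: "x \<in> carrier M"
  show "h (p x) \<in> carrier N" using x by (simp add: h linear_onD(1)[OF k])
  show "h (a \<odot>\<^bsub>T\<^esub> p x) = a \<odot>\<^bsub>N\<^esub> h (p x)" for a
    using x h[of "a \<odot>\<^bsub>M\<^esub> x"] by (simp add: h linear_onD(3)[OF k] linear_onD(3)[OF p] vs_closed[OF M])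
  fix y assume y: "y \<in> carrier M"
  show "h (p x \<oplus>\<^bsub>T\<^esub> p y) = h (p x) \<oplus>\<^bsub>N\<^esub> h (p y)"
    using x y h[of "x \<oplus>\<^bsub>M\<^esub> y"] by (simp add: h linear_onD(2)[OF k] linear_onD(2)[OF p] vs_closed[OF M])
qed

lemma induced_family_lift:
  "induced_family L p p' r \<phi> w = p' (out_deg r w) (\<phi> (map_letters (\<lambda>i. lift (L i) (p i)) w))"
  by (simp add: induced_family_def map_letters_def lift_def)

lemma lin_linear_family [simp]: "lin (linear_family W g) = g"
  by (simp add: lin_def[abs_def] linear_family_def)

lemma strict_linear_family: "strict_family U W (linear_family W g)"
  by (auto simp: strict_family_def linear_family_def split: list.splits)

lemma a_r_coset_carrier [simp]: "H +>\<^bsub>M\<lparr>carrier := C\<rparr>\<^esub> x = H +>\<^bsub>M\<^esub> x"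
  by (simp add: a_r_coset_eq)

lemma zero_submodule: "is_vs M \<Longrightarrow> submodule {\<zero>\<^bsub>M\<^esub>} ring_of_type_algebra M"
  by (simp add: submodule_iff vs_simps)

lemma graded_vs_conc: "graded_vs V \<Longrightarrow> graded_vs (conc m V)"
  using submodule_is_vs[OF _ zero_submodule] by (auto simp: graded_vs_def conc_def)

lemma graded_vs_dsum: "graded_vs V \<Longrightarrow> graded_vs W \<Longrightarrow> graded_vs (dsum V W)"
  by (simp add: graded_vs_def dsum_def dsum_is_vs)

section \<open>The truncation as a quotient by an ideal\<close>

locale nonneg_Linf =
  fixes L :: "('k::field_char_0, 'v) graded" and br :: "'v word \<Rightarrow> 'v" and m :: int
  assumes alg: "Linf_algebra L br" and m: "1 \<le> m"
    and neg: "\<And>i. i < 0 \<Longrightarrow> carrier (L i) = {\<zero>\<^bsub>L i\<^esub>}"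
begin

abbreviation d where "d i x \<equiv> br [(i, x)]"
abbreviation "K \<equiv> trunc_le_ker L br m"
abbreviation "T \<equiv> trunc_le L br m"
abbreviation "p \<equiv> p_le L br m"
abbreviation "H \<equiv> homology L br"
abbreviation "E \<equiv> trunc_lt_hom L br m"

lemmas gr = Linf_algebraD(1)[OF alg] and skew = Linf_algebraD(2)[OF alg]
lemmas V = graded_vsD[OF gr]
lemmas d_lin = differential_linear[OF skew]
lemmas d_closed = linear_onD(1)[OF d_lin]

lemma d_d: "x \<in> carrier (L i) \<Longrightarrow> d (i - 1) (d i x) = \<zero>\<^bsub>L (i - 2)\<^esub>"
  using alg differential_square[OF gr skew] by (auto simp: Linf_algebra_def)

lemma boundaries_submodule: "submodule (boundaries L br i) ring_of_type_algebra (L i)"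
  using linear_image_submodule[OF V V d_lin module.carrier_is_submodule[OF V], of "i + 1"]
  by (simp add: boundaries_def)

lemma K_submodule: "submodule (K i) ring_of_type_algebra (L i)"
  using zero_submodule[OF V] boundaries_submodule module.carrier_is_submodule[OF V]
  by (simp add: trunc_le_ker_def)

lemma K_zero: "\<zero>\<^bsub>L i\<^esub> \<in> K i"
  using K_submodule by (simp add: submodule_iff[OF V])

lemma br_zero_letter:
  assumes "u \<in> letters L" "t \<in> letters L"
  shows "br (u @ (i, \<zero>\<^bsub>L i\<^esub>) # t) = \<zero>\<^bsub>L (out_deg (-2) (u @ (i, z) # t))\<^esub>"
  using linear_on_zero[OF V V skew_familyD(2)[OF skew assms, of i z]] by simp

lemma br_neg:
  assumes w: "w \<in> letters L" and j: "(j, v) \<in> set w" "j < 0"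
  shows "br w = \<zero>\<^bsub>L (out_deg (-2) w)\<^esub>"
proof -
  obtain u t where ut: "w = u @ (j, v) # t" using j(1) by (meson split_list)
  then have "v = \<zero>\<^bsub>L j\<^esub>" using w neg[OF j(2)] by simp
  then show ?thesis using br_zero_letter[of u t j v] w ut by simp
qed

lemma wdeg_nonneg: "(\<And>j v. (j, v) \<in> set w \<Longrightarrow> 0 \<le> j) \<Longrightarrow> 0 \<le> wdeg w"
  by (induction w) force+

text \<open>With letters of non-negative degree, the output degree is \<open>i - 1\<close> plus at
  least one for each further letter, and \<open>K\<close> contains everything above
  \<open>m\<close>. Left over are a single letter of degree \<open>m + 1\<close>, whose image is a
  boundary; a single boundary of degree \<open>m\<close>, killed by \<open>d\<close>; and a boundary
  of degree \<open>m\<close> next to one letter of degree 0. A letter in \<open>K\<close> below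
  degree \<open>m\<close>, or any letter of negative degree, is zero.\<close>

lemma ideal:
  assumes u: "u \<in> letters L" and t: "t \<in> letters L" and z: "z \<in> K i"
  shows "br (u @ (i, z) # t) \<in> K (out_deg (-2) (u @ (i, z) # t))"
proof -
  let ?w = "u @ (i, z) # t" let ?D = "out_deg (-2) ?w"
  have zc: "z \<in> carrier (L i)" using z K_submodule[of i] by (auto simp: submodule_iff[OF V])
  have w: "?w \<in> words L" using u t zc by (simp add: words_iff)
  have c: "br ?w \<in> carrier (L ?D)" by (rule skew_familyD(1)[OF skew w])
  have big: "br ?w \<in> K ?D" if "?D > m" using that c by (simp add: trunc_le_ker_def)
  show ?thesis
  proof (cases "\<exists>(j, v)\<in>set ?w. j < 0")
    case True
    then obtain j v where "(j, v) \<in> set ?w" "j < 0" by auto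
    then have "br ?w = \<zero>\<^bsub>L ?D\<^esub>" using w by (intro br_neg) (auto simp: words_iff)
    then show ?thesis using K_zero by simp
  next
    case False
    have nj: "0 \<le> j" if "(j, v) \<in> set ?w" for j v using False that by force
    have "0 \<le> j" if "(j, v) \<in> set u \<or> (j, v) \<in> set t" for j v using nj[of j v] that by auto
    then have nn: "0 \<le> wdeg u" "0 \<le> wdeg t" by (metis wdeg_nonneg)+
    have D: "?D = wdeg u + wdeg t + i + int (length u) + int (length t) - 1"
      by (simp add: out_deg_def)
    consider "i < m" | "i > m" "length u + length t = 0" | "i > m" "length u + length t > 0"
      | "i = m" "length u + length t = 0" | "i = m" "length u + length t \<ge> 2" | "i = m" "length u + length t = 1"
      by atomize_elim arith
    then show ?thesis
    proof cases
      case 1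
      then have "z = \<zero>\<^bsub>L i\<^esub>" using z by (simp add: trunc_le_ker_def)
      then show ?thesis using br_zero_letter[OF u t, of i z] K_zero by simp
    next
      case 2
      show ?thesis
      proof (cases "i = m + 1")
        case True
        then show ?thesis using 2 zc m by (auto simp: trunc_le_ker_def out_deg_def boundaries_def)
      next
        case False
        then show ?thesis using 2 big D by simp
      qed
    next
      case 3
      then show ?thesis using nn D by (intro big) linarith
    next
      case 4
      then obtain y where "y \<in> carrier (L (m + 1))" "z = d (m + 1) y" using z by (auto simp: trunc_le_ker_def boundaries_def)
      then have "d m z = \<zero>\<^bsub>L (m - 1)\<^esub>" using d_d[of y "m + 1"] by simp
      then show ?thesis using 4 by (simp add: out_deg_def trunc_le_ker_def)
    next
      case 5
      then show ?thesis using nn D by (intro big) linarith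
    next
      case 6
      obtain y where y: "y \<in> carrier (L (m + 1))" "z = d (m + 1) y"
        using 6 z by (auto simp: trunc_le_ker_def boundaries_def)
      obtain a x where ax: "u @ t = [(a, x)]"
        using 6 by (cases u; cases t) auto
      have "u @ t \<in> letters L" using u t by simp
      then have xc: "x \<in> carrier (L a)" unfolding ax by simp
      have "(a, x) \<in> set (u @ t)" using ax by simp
      then have a0: "0 \<le> a" using nj[of a x] by auto
      have a_deg: "wdeg u + wdeg t = a" using arg_cong[OF ax, of wdeg] by simp
      show ?thesis
      proof (cases "a = 0")
        case False
        then show ?thesis using a0 a_deg D 6 by (intro big) linarith
      next
        case True
        \<comment> \<open>\<open>d x\<close> lies in degree -1, where the space is zero;
          \<open>binary_bracket_boundary\<close> asks for this.\<close>
        have dx: "d 0 x = \<zero>\<^bsub>L (-1)\<^esub>"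
          using d_closed[of x 0] xc True neg[of "-1"] by simp
        have *: "br [(m, z), (0, x)] \<in> boundaries L br m"
          using alg binary_bracket_boundary[OF gr skew _ _ y(1) _ dx] xc True y(2)
          by (auto simp: Linf_algebra_def)
        have D0: "?D = m" using D a_deg True 6 by simp
        show ?thesis
        proof (cases "u = []")
          case True
          then show ?thesis using * ax \<open>a = 0\<close> 6 D0 by (simp add: trunc_le_ker_def)
        next
          case False
          then have ut: "u = [(0, x)]" "t = []" using ax \<open>a = 0\<close> by (auto simp: append_eq_Cons_conv)
          have "br [(0, x), (m, z)] = (- sg (0 * m)) \<odot>\<^bsub>L m\<^esub> br [(m, z), (0, x)]"
            using skew_familyD(3)[OF skew, of "[]" "[]" "(0, x)" "(m, z)"] xc True zc 6 \<open>a = 0\<close>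
            by (simp add: out_deg_def)
          then show ?thesis
            using * ut 6 D0 boundaries_submodule[of m] by (simp add: trunc_le_ker_def submodule_iff[OF V])
        qed
      qed
    qed
  qed
qed

lemma T_vs: "graded_vs T"
  unfolding graded_vs_def trunc_le_def by (intro allI quot_is_vs V K_submodule)

lemma p_linear: "graded_linear L T p"
  unfolding graded_linear_def trunc_le_def p_le_def[abs_def] by (intro allI quot_linear V K_submodule)

lemma p_surj: "p i ` carrier (L i) = carrier (T i)"
  by (simp add: trunc_le_def p_le_def[abs_def] quot_simps(1)[OF V K_submodule])

lemma p_eq_iff: "x \<in> carrier (L i) \<Longrightarrow> y \<in> carrier (L i) \<Longrightarrow> p i x = p i y \<longleftrightarrow> x \<oplus>\<^bsub>L i\<^esub> (-1) \<odot>\<^bsub>L i\<^esub> y \<in> K i"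
  unfolding p_le_def by (rule coset_eq_iff[OF V K_submodule])

lemma p_zero_iff: "x \<in> carrier (L i) \<Longrightarrow> p i x = \<zero>\<^bsub>T i\<^esub> \<longleftrightarrow> x \<in> K i"
  unfolding p_le_def trunc_le_def by (rule coset_zero_iff[OF V K_submodule])

text \<open>Well-definedness of the truncated brackets. Letters are replaced one at a time,
  \<open>u\<close> collecting those already replaced, and each replacement changes the bracket by an
  element of the ideal.\<close>

lemma p_br_cong:
  assumes "map_letters p w = map_letters p w'" "u \<in> letters L" "w \<in> letters L" "w' \<in> letters L" "u @ w \<noteq> []"
  shows "p (out_deg (-2) (u @ w)) (br (u @ w)) = p (out_deg (-2) (u @ w)) (br (u @ w'))"
  using assms
proof (induction w arbitrary: u w')
  case Nil
  then show ?case by (simp add: map_letters_def)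
next
  case (Cons x w)
  obtain i x1 where x: "x = (i, x1)" by (cases x)
  obtain x2 v where w': "w' = (i, x2) # v" and px: "p i x1 = p i x2" and pw: "map_letters p w = map_letters p v"
    using Cons.prems(1) x by (cases w') (auto simp: map_letters_def)
  have c: "x1 \<in> carrier (L i)" "x2 \<in> carrier (L i)" "w \<in> letters L" "v \<in> letters L" "u \<in> letters L"
    using Cons.prems x w' by auto
  let ?D = "out_deg (-2) (u @ x # w)"
  let ?z = "x1 \<oplus>\<^bsub>L i\<^esub> (-1) \<odot>\<^bsub>L i\<^esub> x2"
  have lin: "linear_on (L i) (L ?D) (\<lambda>y. br (u @ (i, y) # w))"
    using skew_familyD(2)[OF skew c(5,3), of i x1] x by simp
  have D: "out_deg (-2) (u @ (i, y) # w) = ?D" for y using x by (simp add: out_deg_def)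
  note cl = linear_onD(1)[OF lin]
  have zK: "?z \<in> K i" using px c p_eq_iff by simp
  have m2: "(-1) \<odot>\<^bsub>L i\<^esub> x2 \<in> carrier (L i)" using c by (simp add: vs_closed[OF V])
  have "br (u @ (i, x1) # w) \<oplus>\<^bsub>L ?D\<^esub> (-1) \<odot>\<^bsub>L ?D\<^esub> br (u @ (i, x2) # w) \<in> K ?D"
    using ideal[OF c(5,3) zK] linear_onD(2)[OF lin c(1) m2] linear_onD(3)[OF lin c(2), of "-1"]
    by (simp only: D)
  then have "p ?D (br (u @ (i, x1) # w)) = p ?D (br (u @ (i, x2) # w))"
    using cl c by (subst p_eq_iff) auto
  also have "\<dots> = p ?D (br (u @ (i, x2) # v))"
    using Cons.IH[OF pw, of "u @ [(i, x2)]"] c D[of x2] by simp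
  finally show ?case using x w' by simp
qed

abbreviation "\<phi> \<equiv> linear_family T p"

lemma strict_surj_p: "strict_surj L br T (trunc_le_bracket L br m) \<phi>"
  unfolding strict_surj_def lin_linear_family
proof (intro conjI ballI allI strict_linear_family p_linear p_surj)
  fix w assume w: "w \<in> words L"
  \<comment> \<open>The word of preimages at which \<open>trunc_le_bracket\<close> evaluates
    \<open>br\<close>; letterwise it agrees with \<open>w\<close> modulo the ideal.\<close>
  let ?c = "map_letters (\<lambda>i. lift (L i) (p i)) (map_letters p w)"
  have l: "lift (L i) (p i) (p i x) \<in> carrier (L i)" "p i (lift (L i) (p i) (p i x)) = p i x"
    if "x \<in> carrier (L i)" for i x
    using lift_props[of "p i x" "p i" "L i"] that by auto
  have wl: "w \<in> letters L" using w by (simp add: words_iff)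
  have c: "?c \<in> letters L" unfolding map_letters_comp by (rule map_letters_closed[OF l(1) wl])
  have "map_letters p ?c = map_letters p w"
    unfolding map_letters_comp by (rule map_letters_cong[OF wl]) (rule l(2))
  then have "p (out_deg (-2) w) (br w) = p (out_deg (-2) w) (br ?c)"
    using p_br_cong[of w ?c "[]"] w c wl by (simp add: words_iff)
  then show "trunc_le_bracket L br m (map_letters p w) = p (out_deg (-2) w) (br w)"
    by (simp add: trunc_le_bracket_def induced_family_lift)
qed

lemma lift_letters: "w \<in> words T \<Longrightarrow> map_letters (\<lambda>i. lift (L i) (p i)) w \<in> words L"
  using map_letters_closed[of T "\<lambda>i. lift (L i) (p i)" L w, OF lift_props(1)] p_surj
  by (auto simp: words_iff map_letters_def)

lemma T_alg: "Linf_algebra T (trunc_le_bracket L br m)"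
  by (rule Linf_algebra_quot(1)[OF alg T_vs strict_surj_p])

section \<open>Splitting off the homology\<close>

lemma cycles_submodule: "submodule (cycles L br i) ring_of_type_algebra (L i)"
proof -
  have z: "linear_on (L i) (L (i - 1)) (\<lambda>_. \<zero>\<^bsub>L (i - 1)\<^esub>)" by (simp add: linear_on_def vs_simps[OF V])
  show ?thesis unfolding cycles_def by (rule linear_eq_submodule[OF V V d_lin z])
qed

lemma Z_vs: "is_vs ((L i)\<lparr>carrier := cycles L br i\<rparr>)"
  by (rule submodule_is_vs[OF V cycles_submodule])

lemma boundaries_cycles: "submodule (boundaries L br i) ring_of_type_algebra ((L i)\<lparr>carrier := cycles L br i\<rparr>)"
proof -
  have "boundaries L br i \<subseteq> cycles L br i"
  proof
    fix z assume "z \<in> boundaries L br i"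
    then obtain y where y: "y \<in> carrier (L (i + 1))" "z = d (i + 1) y" by (auto simp: boundaries_def)
    then show "z \<in> cycles L br i" using d_closed[OF y(1)] d_d[OF y(1)] by (simp add: cycles_def)
  qed
  then show ?thesis using boundaries_submodule[of i] by (simp add: submodule_iff[OF Z_vs] submodule_iff[OF V])
qed

lemma H_vs: "graded_vs H"
  unfolding graded_vs_def homology_def by (intro allI quot_is_vs Z_vs boundaries_cycles)

abbreviation "cls i x \<equiv> boundaries L br i +>\<^bsub>L i\<^esub> x"

lemma cls_linear: "linear_on ((L i)\<lparr>carrier := cycles L br i\<rparr>) (H i) (cls i)"
  using quot_linear[OF Z_vs boundaries_cycles, of i] by (simp add: homology_def)

lemma cls_surj: "cls i ` cycles L br i = carrier (H i)"
  using quot_simps(1)[OF Z_vs boundaries_cycles, of i] by (simp add: homology_def)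

lemma cls_zero_iff: "x \<in> cycles L br i \<Longrightarrow> cls i x = \<zero>\<^bsub>H i\<^esub> \<longleftrightarrow> x \<in> boundaries L br i"
  using coset_zero_iff[OF Z_vs boundaries_cycles, of x i] by (simp add: homology_def)

lemma cls_eqI:
  assumes "x \<in> cycles L br i" "y \<in> cls i x"
  shows "y \<in> cycles L br i" "cls i y = cls i x"
  using coset_mem[OF Z_vs boundaries_cycles, of x i y] assms by simp_all

lemma cls_self: "x \<in> carrier (L i) \<Longrightarrow> x \<in> cls i x"
  using boundaries_submodule[of i] by (force simp: a_r_coset_eq submodule_iff[OF V] vs_l_zero[OF V] image_iff)

lemma trunc_lt_vs: "graded_vs (trunc_lt L br m)"
  unfolding graded_vs_def trunc_lt_def
  using V submodule_is_vs[OF V zero_submodule[OF V]] submodule_is_vs[OF V boundaries_submodule] by simp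

lemma E_vs: "graded_vs E"
  unfolding trunc_lt_hom_def by (intro graded_vs_dsum graded_vs_conc trunc_lt_vs H_vs)

lemma p_lt_linear: "graded_linear L (trunc_lt L br m) (p_lt L br m)"
  unfolding graded_linear_def
proof
  fix i
  have "linear_on (L m) (L (m - 1)) (d m)" by (rule d_lin)
  then have "linear_on (L m) ((L (m - 1))\<lparr>carrier := boundaries L br (m - 1)\<rparr>) (d m)"
    by (auto simp: linear_on_def boundaries_def)
  moreover have "linear_on (L i) ((L i)\<lparr>carrier := {\<zero>\<^bsub>L i\<^esub>}\<rparr>) (\<lambda>_. \<zero>\<^bsub>L i\<^esub>)"
    by (simp add: linear_on_def vs_simps[OF V])
  ultimately show "linear_on (L i) (trunc_lt L br m i) (p_lt L br m i)"
    using linear_on_id[of "L i"] by (simp add: trunc_lt_def p_lt_def[abs_def])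
qed

lemma p_lt_surj: "p_lt L br m i ` carrier (L i) = carrier (trunc_lt L br m i)"
  using V[THEN vs_zero_closed, of i] by (auto simp: trunc_lt_def p_lt_def boundaries_def)

text \<open>A linear \<open>r : L\<^sub>m \<rightarrow> H\<^sub>m\<close> extending the projection from the cycles yields the isomorphism
  \<open>(d, r)\<close> of \<open>L\<^sub>m / im d\<close> with \<open>im d \<oplus> H\<^sub>m\<close>.\<close>

definition retraction where
  "retraction r \<longleftrightarrow> linear_on (L m) (H m) r \<and> (\<forall>x\<in>cycles L br m. r x = cls m x)"

text \<open>Defined on \<open>L\<close> itself, so that kernel and image can be computed before
  passing to the quotient.\<close>

definition split_map where
  "split_map r i x = (p_lt L br m i x, if i = m then r x else \<zero>\<^bsub>H i\<^esub>)"

definition split_iso where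
  "split_iso r i y = split_map r i (lift (L i) (p i) y)"

lemma split_map_linear:
  assumes r: "retraction r"
  shows "graded_linear L E (split_map r)"
proof -
  have "linear_on (L i) (conc m H i) (\<lambda>x. if i = m then r x else \<zero>\<^bsub>H i\<^esub>)" for i
    using r vs_simps[OF graded_vsD[OF H_vs]]
    by (auto simp: retraction_def conc_def linear_on_def)
  then show ?thesis
    using p_lt_linear
    by (auto simp: graded_linear_def trunc_lt_hom_def dsum_def linear_on_def split_map_def)
qed

text \<open>In degree \<open>m\<close>, \<open>d x = 0\<close> makes \<open>x\<close> a cycle, on
  which \<open>r\<close> is the homology class; if that vanishes too, \<open>x\<close> is a
  boundary. In other degrees the kernel of \<open>p_lt\<close> is already \<open>K\<close>.\<close>

lemma split_map_zero_iff:
  assumes r: "retraction r" and x: "x \<in> carrier (L i)"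
  shows "split_map r i x = \<zero>\<^bsub>E i\<^esub> \<longleftrightarrow> x \<in> K i"
proof -
  have z: "\<zero>\<^bsub>E i\<^esub> = (\<zero>\<^bsub>trunc_lt L br m i\<^esub>, \<zero>\<^bsub>H i\<^esub>)"
    by (simp add: trunc_lt_hom_def dsum_def conc_def)
  consider "i < m" | "i = m" | "i > m" by linarith
  then show ?thesis
  proof cases
    case 1
    then show ?thesis by (simp add: z split_map_def p_lt_def trunc_le_ker_def trunc_lt_def)
  next
    case 2
    have b: "x \<in> cycles L br m" if "x \<in> boundaries L br m"
      using that boundaries_cycles[of m] by (auto simp: submodule_iff[OF Z_vs])
    have c: "x \<in> cycles L br m \<longleftrightarrow> d m x = \<zero>\<^bsub>L (m - 1)\<^esub>" using x 2 by (simp add: cycles_def)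
    show ?thesis
      unfolding z using 2 b c r cls_zero_iff[of x m]
      by (auto simp: split_map_def p_lt_def trunc_le_ker_def trunc_lt_def retraction_def)
  next
    case 3
    then show ?thesis using x by (simp add: z split_map_def p_lt_def trunc_le_ker_def trunc_lt_def)
  qed
qed

text \<open>In degree \<open>m\<close>, lift the first coordinate through \<open>d\<close> and then
  add a cycle representing the defect in the second; this corrects \<open>r\<close> and leaves
  \<open>d\<close> unchanged.\<close>

lemma split_map_surj:
  assumes r: "retraction r"
  shows "split_map r i ` carrier (L i) = carrier (E i)"
proof
  show "split_map r i ` carrier (L i) \<subseteq> carrier (E i)"
    using linear_onD(1)[OF graded_linearD[OF split_map_linear[OF r]]] by auto
  show "carrier (E i) \<subseteq> split_map r i ` carrier (L i)"
  proof
    fix e assume "e \<in> carrier (E i)"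
    then obtain a h where e: "e = (a, h)" and a: "a \<in> carrier (trunc_lt L br m i)" and h: "h \<in> carrier (conc m H i)"
      by (auto simp: trunc_lt_hom_def dsum_def)
    obtain x where x: "x \<in> carrier (L i)" "a = p_lt L br m i x" using a p_lt_surj by blast
    show "e \<in> split_map r i ` carrier (L i)"
    proof (cases "i = m")
      case False
      then have "e = split_map r i x" using e x h by (simp add: split_map_def conc_def)
      then show ?thesis using x by blast
    next
      case True
      note rl = r[unfolded retraction_def]
      have Hm: "is_vs (H m)" by (rule graded_vsD[OF H_vs])
      have hm: "h \<in> carrier (H m)" "x \<in> carrier (L m)" using h x True by (auto simp: conc_def)
      have rx: "r x \<in> carrier (H m)" using rl hm by (auto simp: linear_on_def)
      have "h \<oplus>\<^bsub>H m\<^esub> (-1) \<odot>\<^bsub>H m\<^esub> r x \<in> carrier (H m)" using hm rx by (simp add: vs_closed[OF Hm])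
      then obtain c where c: "c \<in> cycles L br m" "h \<oplus>\<^bsub>H m\<^esub> (-1) \<odot>\<^bsub>H m\<^esub> r x = cls m c" using cls_surj by blast
      have cL: "c \<in> carrier (L m)" "d m c = \<zero>\<^bsub>L (m - 1)\<^esub>" using c by (auto simp: cycles_def)
      have rc: "r c = cls m c" "r c \<in> carrier (H m)" using rl c cL by (auto simp: linear_on_def)
      have "r (c \<oplus>\<^bsub>L m\<^esub> x) = r c \<oplus>\<^bsub>H m\<^esub> r x" using rl cL hm by (auto simp: linear_on_def)
      also have "\<dots> = h" using vs_add_eq_iff[OF Hm hm(1) rx rc(2)] c rc by simp
      finally have "r (c \<oplus>\<^bsub>L m\<^esub> x) = h" .
      moreover have "d m (c \<oplus>\<^bsub>L m\<^esub> x) = d m x"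
        using linear_onD(2)[OF d_lin cL(1) hm(2)] cL(2) d_closed[OF hm(2)] by (simp add: vs_l_zero[OF V])
      ultimately have "e = split_map r m (c \<oplus>\<^bsub>L m\<^esub> x)"
        using e x True by (simp add: split_map_def p_lt_def)
      then show ?thesis using True cL hm by (auto simp: vs_closed[OF V])
    qed
  qed
qed

lemma split_iso_p:
  assumes r: "retraction r" and x: "x \<in> carrier (L i)"
  shows "split_iso r i (p i x) = split_map r i x"
  unfolding split_iso_def
  by (rule lift_factor[OF V graded_vsD[OF T_vs] graded_vsD[OF E_vs] graded_linearD[OF p_linear]
        graded_linearD[OF split_map_linear[OF r]] _ x])
    (simp add: p_zero_iff split_map_zero_iff[OF r])

lemma split_iso_linear:
  assumes r: "retraction r"
  shows "graded_linear T E (split_iso r)"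
  unfolding graded_linear_def
  by (intro allI linear_on_factor[OF V p_surj graded_linearD[OF p_linear] graded_linearD[OF split_map_linear[OF r]]]
      split_iso_p[OF r])

lemma split_iso_bij:
  assumes r: "retraction r"
  shows "bij_betw (split_iso r i) (carrier (T i)) (carrier (E i))"
  unfolding bij_betw_def
proof
  show "split_iso r i ` carrier (T i) = carrier (E i)"
    unfolding p_surj[symmetric] split_map_surj[OF r, symmetric] image_image
    by (rule image_cong[OF refl split_iso_p[OF r]])
  note lin = graded_linearD[OF split_iso_linear[OF r], of i]
  note VT = graded_vsD[OF T_vs, of i] and VE = graded_vsD[OF E_vs, of i]
  show "inj_on (split_iso r i) (carrier (T i))"
  proof (rule inj_onI)
    fix y y' assume y: "y \<in> carrier (T i)" "y' \<in> carrier (T i)" "split_iso r i y = split_iso r i y'"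
    have m: "(-1) \<odot>\<^bsub>T i\<^esub> y' \<in> carrier (T i)" using y by (simp add: vs_closed[OF VT])
    then have "y \<oplus>\<^bsub>T i\<^esub> (-1) \<odot>\<^bsub>T i\<^esub> y' \<in> carrier (T i)" using y by (simp add: vs_closed[OF VT])
    then obtain x where x: "x \<in> carrier (L i)" "y \<oplus>\<^bsub>T i\<^esub> (-1) \<odot>\<^bsub>T i\<^esub> y' = p i x" using p_surj by blast
    have "split_map r i x = split_iso r i (y \<oplus>\<^bsub>T i\<^esub> (-1) \<odot>\<^bsub>T i\<^esub> y')" using x split_iso_p[OF r] by simp
    also have "\<dots> = \<zero>\<^bsub>E i\<^esub>"
      using y m linear_onD(1)[OF lin] by (simp add: linear_onD(2,3)[OF lin] vs_r_neg[OF VE])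
    finally have "p i x = \<zero>\<^bsub>T i\<^esub>" using x by (simp add: split_map_zero_iff[OF r] p_zero_iff)
    then show "y = y'" using x y by (simp add: vs_diff_eq_zero[OF VT])
  qed
qed

text \<open>Transport of structure, chosen so that \<open>split_iso\<close> alone is a strict
  morphism.\<close>

definition split_bracket where
  "split_bracket r w = split_iso r (out_deg (-2) w)
     (trunc_le_bracket L br m (map_letters (\<lambda>i. inv_into (carrier (T i)) (split_iso r i)) w))"

text \<open>A bijection is in particular a surjection, so the descent results also perform the
  transport of structure.\<close>

lemma strict_surj_split:
  assumes r: "retraction r"
  shows "strict_surj T (trunc_le_bracket L br m) E (split_bracket r) (linear_family E (split_iso r))"
  unfolding strict_surj_def lin_linear_family
proof (intro conjI ballI allI strict_linear_family split_iso_linear[OF r])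
  show "split_iso r i ` carrier (T i) = carrier (E i)" for i
    using split_iso_bij[OF r, of i] by (simp add: bij_betw_def)
  fix w assume "w \<in> words T"
  then have "map_letters (\<lambda>i. inv_into (carrier (T i)) (split_iso r i)) (map_letters (split_iso r) w) = w"
    unfolding map_letters_comp
    by (intro map_letters_id[of _ T] inv_into_f_f[OF bij_betw_imp_inj_on[OF split_iso_bij[OF r]]])
      (simp_all add: words_iff)
  then show "split_bracket r (map_letters (split_iso r) w) =
      split_iso r (out_deg (-2) w) (trunc_le_bracket L br m w)"
    by (simp add: split_bracket_def)
qed

lemma E_alg: "retraction r \<Longrightarrow> Linf_algebra E (split_bracket r)"
  by (rule Linf_algebra_quot(1)[OF T_alg E_vs strict_surj_split])

lemma split_Linf_iso:
  "retraction r \<Longrightarrow> Linf_iso T (trunc_le_bracket L br m) E (split_bracket r) (linear_family E (split_iso r))"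
  unfolding Linf_iso_def
  using Linf_algebra_quot(2)[OF T_alg E_vs strict_surj_split] split_iso_bij
  by (simp add: linear_family_def)

text \<open>\<open>linear_extension\<close> with the zero space as \<open>H'\<close>, which makes
  the lifting condition void.\<close>

lemma retraction_exists:
  obtains r where "retraction r"
proof -
  let ?O = "(H m)\<lparr>carrier := {\<zero>\<^bsub>H m\<^esub>}\<rparr>"
  note Hm = graded_vsD[OF H_vs, of m]
  have O: "is_vs ?O" by (rule submodule_is_vs[OF Hm zero_submodule[OF Hm]])
  have "linear_on (H m) ?O (\<lambda>_. \<zero>\<^bsub>H m\<^esub>)" "linear_on (L m) ?O (\<lambda>_. \<zero>\<^bsub>H m\<^esub>)"
    by (auto simp: linear_on_def vs_simps[OF Hm])
  moreover have "(\<lambda>_. \<zero>\<^bsub>H m\<^esub>) ` carrier (H m) = carrier ?O" using vs_zero_closed[OF Hm] by auto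
  ultimately obtain r where "linear_on (L m) (H m) r" "\<And>x. x \<in> cycles L br m \<Longrightarrow> r x = cls m x"
    using linear_extension[OF V Hm O cycles_submodule cls_linear, of "\<lambda>_. \<zero>\<^bsub>H m\<^esub>" "\<lambda>_. \<zero>\<^bsub>H m\<^esub>"] by metis
  then show ?thesis by (intro that[of r]) (simp add: retraction_def)
qed

end

section \<open>The maps induced by a strict morphism\<close>

locale strict_morphism_nonneg = A: nonneg_Linf L br m + B: nonneg_Linf L' br' m
  for L :: "('k::field_char_0, 'v) graded" and br and L' :: "('k, 'w) graded" and br' and m +
  fixes f :: "'v word \<Rightarrow> 'w"
  assumes mor: "Linf_morphism L br L' br' f" and strict: "strict_family L L' f"
begin

lemma lin_f: "graded_linear L L' (lin f)"
  using mor by (intro skew_family_lin) (simp add: Linf_morphism_def)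

lemmas f_lin = graded_linearD[OF lin_f]
lemmas f_closed = linear_onD(1)[OF f_lin]

lemma f_zero: "lin f i \<zero>\<^bsub>L i\<^esub> = \<zero>\<^bsub>L' i\<^esub>"
  by (rule linear_on_zero[OF A.V B.V f_lin])

lemma chain: "x \<in> carrier (L i) \<Longrightarrow> lin f (i - 1) (br [(i, x)]) = br' [(i, lin f i x)]"
  using strict_chain_map[OF mor strict] by (simp add: lin_def)

lemma f_boundaries:
  assumes "z \<in> boundaries L br i"
  shows "lin f i z \<in> boundaries L' br' i"
proof -
  obtain y where y: "y \<in> carrier (L (i + 1))" "z = br [(i + 1, y)]" using assms by (auto simp: boundaries_def)
  then show ?thesis using chain[OF y(1)] f_closed[OF y(1)] by (auto simp: boundaries_def)
qed

lemma f_cycles: "x \<in> cycles L br i \<Longrightarrow> lin f i x \<in> cycles L' br' i"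
  using chain[of x i, symmetric] f_closed f_zero by (auto simp: cycles_def)

lemma f_K: "x \<in> A.K i \<Longrightarrow> lin f i x \<in> B.K i"
  using f_zero f_boundaries f_closed by (auto simp: trunc_le_ker_def split: if_splits)

abbreviation "\<tau>f \<equiv> trunc_le_mor L br L' br' m f"
abbreviation "g \<equiv> trunc_lt_hom_mor L br L' br' m f"

lemma \<tau>f_p:
  assumes x: "x \<in> carrier (L i)"
  shows "lin \<tau>f i (A.p i x) = B.p i (lin f i x)"
proof -
  have "B.p i (lin f i (lift (L i) (A.p i) (A.p i x))) = B.p i (lin f i x)"
    by (rule lift_factor[OF A.V graded_vsD[OF A.T_vs] graded_vsD[OF B.T_vs] graded_linearD[OF A.p_linear]
          linear_on_comp[OF f_lin graded_linearD[OF B.p_linear]] _ x])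
      (simp add: A.p_zero_iff B.p_zero_iff f_closed f_K)
  then show ?thesis
    by (simp add: lin_def trunc_le_mor_def induced_family_lift out_deg_def)
qed

lemma \<tau>f_linear: "graded_linear A.T B.T (lin \<tau>f)"
  unfolding graded_linear_def
  by (intro allI linear_on_factor[OF A.V A.p_surj graded_linearD[OF A.p_linear]
        linear_on_comp[OF f_lin graded_linearD[OF B.p_linear]]] \<tau>f_p)

lemma \<tau>f_strict: "strict_family A.T B.T \<tau>f"
  unfolding strict_family_def
proof (intro ballI impI)
  fix w assume w: "w \<in> words A.T" "2 \<le> length w"
  have "f (map_letters (\<lambda>i. lift (L i) (A.p i)) w) = \<zero>\<^bsub>L' (out_deg (-1) w)\<^esub>"
    using strict A.lift_letters[OF w(1)] w(2) by (simp add: strict_family_def)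
  then show "\<tau>f w = \<zero>\<^bsub>B.T (out_deg (- 1) w)\<^esub>"
    using linear_on_zero[OF B.V graded_vsD[OF B.T_vs] graded_linearD[OF B.p_linear]]
    by (simp add: trunc_le_mor_def induced_family_lift)
qed

lemma \<tau>f_morphism: "Linf_morphism A.T (trunc_le_bracket L br m) B.T (trunc_le_bracket L' br' m) \<tau>f"
  by (rule Linf_morphism_quot[OF mor strict A.T_vs B.T_vs A.strict_surj_p B.strict_surj_p \<tau>f_linear \<tau>f_strict])
    (simp add: \<tau>f_p)

text \<open>All members of the union in \<open>homology_map\<close> coincide, because
  \<open>f\<close> takes boundaries to boundaries.\<close>

lemma homology_map_cls:
  assumes x: "x \<in> cycles L br i"
  shows "homology_map L' br' f i (A.cls i x) = B.cls i (lin f i x)"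
proof -
  have xc: "x \<in> carrier (L i)" using x by (simp add: cycles_def)
  have "B.cls i (f [(i, y)]) = B.cls i (lin f i x)" if "y \<in> A.cls i x" for y
  proof -
    obtain h where h: "h \<in> boundaries L br i" "y = h \<oplus>\<^bsub>L i\<^esub> x" using \<open>y \<in> _\<close> by (auto simp: a_r_coset_eq)
    have "h \<in> carrier (L i)" using h A.boundaries_submodule[of i] by (auto simp: submodule_iff[OF A.V])
    then have "lin f i y \<in> B.cls i (lin f i x)"
      using h xc f_boundaries[OF h(1)] by (simp add: linear_onD(2)[OF f_lin] a_r_coset_eq)
    then show ?thesis using B.cls_eqI(2)[OF f_cycles[OF x]] by (simp add: lin_def)
  qed
  then show ?thesis using A.cls_self[OF xc] unfolding homology_map_def by blast
qed

lemma homology_map_linear: "linear_on (A.H i) (B.H i) (homology_map L' br' f i)"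
proof (rule linear_on_factor[OF A.Z_vs _ A.cls_linear])
  have "linear_on ((L i)\<lparr>carrier := cycles L br i\<rparr>) ((L' i)\<lparr>carrier := cycles L' br' i\<rparr>) (lin f i)"
    using f_lin[of i] f_cycles by (auto simp: linear_on_def cycles_def)
  then show "linear_on ((L i)\<lparr>carrier := cycles L br i\<rparr>) (B.H i) (\<lambda>x. B.cls i (lin f i x))"
    by (rule linear_on_comp[OF _ B.cls_linear])
qed (simp_all add: A.cls_surj homology_map_cls)

text \<open>The compatibility that \<open>linear_extension\<close> requires on cycles is naturality:
  \<open>H(f)\<close> of the class of \<open>x\<close> and \<open>r' (f x)\<close> are both the
  class of \<open>f x\<close>.\<close>

lemma compatible_retractions:
  assumes surj: "homology_map L' br' f m ` carrier (homology L br m) = carrier (homology L' br' m)"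
  obtains r r' where "A.retraction r" "B.retraction r'"
    "\<And>x. x \<in> carrier (L m) \<Longrightarrow> homology_map L' br' f m (r x) = r' (lin f m x)"
proof -
  obtain r' where r': "B.retraction r'" by (rule B.retraction_exists)
  have r'l: "linear_on (L' m) (B.H m) r'" "\<And>x. x \<in> cycles L' br' m \<Longrightarrow> r' x = B.cls m x"
    using r' by (auto simp: B.retraction_def)
  obtain r where "linear_on (L m) (A.H m) r" "\<And>x. x \<in> cycles L br m \<Longrightarrow> r x = A.cls m x"
    "\<And>x. x \<in> carrier (L m) \<Longrightarrow> homology_map L' br' f m (r x) = r' (lin f m x)"
    by (rule linear_extension[OF A.V graded_vsD[OF A.H_vs] graded_vsD[OF B.H_vs] A.cycles_submodule A.cls_linear
          homology_map_linear surj linear_on_comp[OF f_lin r'l(1)]])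
      (simp_all add: homology_map_cls r'l(2) f_cycles)
  then show ?thesis using r' by (intro that[of r r']) (simp_all add: A.retraction_def)
qed

text \<open>In degree \<open>m\<close> the chosen preimage has the same differential as
  \<open>x\<close>, and the chain map property carries this over to their images under
  \<open>f\<close>.\<close>

lemma p_lt_f:
  assumes x: "x \<in> carrier (L i)"
  shows "lin (trunc_lt_mor L br L' br' m f) i (p_lt L br m i x) = p_lt L' br' m i (lin f i x)"
proof -
  let ?y = "lift (L i) (p_lt L br m i) (p_lt L br m i x)"
  have y: "?y \<in> carrier (L i)" "p_lt L br m i ?y = p_lt L br m i x"
    using lift_props[of "p_lt L br m i x" "p_lt L br m i" "L i"] x by auto
  have "p_lt L' br' m i (lin f i ?y) = p_lt L' br' m i (lin f i x)"
    using y(2) chain[of ?y m] chain[of x m] y(1) x by (auto simp: p_lt_def split: if_splits)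
  then show ?thesis
    by (simp add: lin_def trunc_lt_mor_def induced_family_lift out_deg_def)
qed

text \<open>The square before passing to the quotient. Its first coordinate is
  \<open>p_lt_f\<close>, its second the compatibility of the two retractions.\<close>

lemma g_split_map:
  assumes r: "A.retraction r" "B.retraction r'"
    and rr: "\<And>x. x \<in> carrier (L m) \<Longrightarrow> homology_map L' br' f m (r x) = r' (lin f m x)"
    and x: "x \<in> carrier (L i)"
  shows "lin g i (A.split_map r i x) = B.split_map r' i (lin f i x)"
proof -
  have "homology_map L' br' f i (if i = m then r x else \<zero>\<^bsub>A.H i\<^esub>) = (if i = m then r' (lin f i x) else \<zero>\<^bsub>B.H i\<^esub>)"
    using rr x linear_on_zero[OF graded_vsD[OF A.H_vs] graded_vsD[OF B.H_vs] homology_map_linear] by auto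
  then show ?thesis
    using p_lt_f[OF x]
    by (simp add: A.split_map_def B.split_map_def lin_def trunc_lt_hom_mor_def dsum_family_def linear_family_def)
qed

lemma g_split_iso:
  assumes r: "A.retraction r" "B.retraction r'"
    and rr: "\<And>x. x \<in> carrier (L m) \<Longrightarrow> homology_map L' br' f m (r x) = r' (lin f m x)"
    and y: "y \<in> carrier (A.T i)"
  shows "lin g i (A.split_iso r i y) = B.split_iso r' i (lin \<tau>f i y)"
proof -
  obtain x where x: "x \<in> carrier (L i)" "y = A.p i x" using y A.p_surj by blast
  then show ?thesis
    using g_split_map[OF r rr x(1)] by (simp add: A.split_iso_p[OF r(1)] B.split_iso_p[OF r(2)] \<tau>f_p f_closed)
qed

lemma g_linear:
  assumes r: "A.retraction r" "B.retraction r'"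
    and rr: "\<And>x. x \<in> carrier (L m) \<Longrightarrow> homology_map L' br' f m (r x) = r' (lin f m x)"
  shows "graded_linear A.E B.E (lin g)"
  unfolding graded_linear_def
  by (intro allI linear_on_factor[OF A.V A.split_map_surj[OF r(1)] graded_linearD[OF A.split_map_linear[OF r(1)]]
        linear_on_comp[OF f_lin graded_linearD[OF B.split_map_linear[OF r(2)]]]] g_split_map[OF r rr])

lemma g_strict: "strict_family A.E B.E g"
  unfolding strict_family_def
proof (intro ballI impI)
  fix w assume w: "w \<in> words A.E" "2 \<le> length w"
  let ?a = "map (\<lambda>(i, x, y). (i, x)) w" and ?b = "map (\<lambda>(i, x, y). (i, y)) w" and ?D = "out_deg (-1) w"
  let ?c = "map_letters (\<lambda>i. lift (L i) (p_lt L br m i)) ?a"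
  have d: "out_deg (-1) ?a = ?D" "out_deg (-1) ?b = ?D"
    by (simp_all add: out_deg_def wdeg_def case_prod_unfold comp_def)
  have "?a \<in> letters (trunc_lt L br m)"
    using w by (force simp: words_iff letters_def trunc_lt_hom_def dsum_def)
  then have "?c \<in> letters L"
    by (rule map_letters_closed[rotated]) (rule lift_props(1), simp add: A.p_lt_surj)
  then have "?c \<in> words L" using w by (auto simp: words_iff map_letters_def)
  then have "f ?c = \<zero>\<^bsub>L' ?D\<^esub>" using strict w(2) d(1) by (simp add: strict_family_def)
  then have "trunc_lt_mor L br L' br' m f ?a = \<zero>\<^bsub>trunc_lt L' br' m ?D\<^esub>"
    using linear_on_zero[OF B.V graded_vsD[OF B.trunc_lt_vs] graded_linearD[OF B.p_lt_linear]]
    by (simp add: trunc_lt_mor_def induced_family_lift d)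
  moreover have "linear_family (conc m B.H) (homology_map L' br' f) ?b = \<zero>\<^bsub>conc m B.H ?D\<^esub>"
    using w(2) d(2) unfolding linear_family_def by (auto split: list.splits)
  ultimately show "g w = \<zero>\<^bsub>B.E ?D\<^esub>"
    by (simp add: trunc_lt_hom_mor_def dsum_family_def trunc_lt_hom_def dsum_def)
qed

text \<open>Along the two isomorphisms \<open>\<tau>f\<close> turns into \<open>g\<close>, so no
  computation with the transported brackets is required.\<close>

lemma g_morphism:
  assumes r: "A.retraction r" "B.retraction r'"
    and rr: "\<And>x. x \<in> carrier (L m) \<Longrightarrow> homology_map L' br' f m (r x) = r' (lin f m x)"
  shows "Linf_morphism A.E (A.split_bracket r) B.E (B.split_bracket r') g"
proof (rule Linf_morphism_quot[OF \<tau>f_morphism \<tau>f_strict A.E_vs B.E_vs A.strict_surj_split[OF r(1)]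
      B.strict_surj_split[OF r(2)] g_linear[OF r rr] g_strict])
  fix i y assume y: "y \<in> carrier (A.T i)"
  show "lin g i (lin (linear_family A.E (A.split_iso r)) i y)
      = lin (linear_family B.E (B.split_iso r')) i (lin \<tau>f i y)"
    using g_split_iso[OF r rr y] by simp
qed

text \<open>All four maps are strict, so both composites are induced by degreewise linear maps, and
  these agree by \<open>g_split_iso\<close>.\<close>

lemma square_commutes:
  assumes r: "A.retraction r" "B.retraction r'"
    and rr: "\<And>x. x \<in> carrier (L m) \<Longrightarrow> homology_map L' br' f m (r x) = r' (lin f m x)"
    and Z: "Z \<in> carrier (Sym (susp A.T))"
  shows "comor_of B.T B.E (linear_family B.E (B.split_iso r')) (comor_of A.T B.T \<tau>f Z)
    = comor_of A.E B.E g (comor_of A.T A.E (linear_family A.E (A.split_iso r)) Z)"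
proof -
  note q = A.split_iso_linear[OF r(1)] and q' = B.split_iso_linear[OF r(2)] and gl = g_linear[OF r rr]
  let ?q = "linear_family A.E (A.split_iso r)" and ?q' = "linear_family B.E (B.split_iso r')"
  note gT = graded_vs_susp[OF A.T_vs] and gT' = graded_vs_susp[OF B.T_vs]
  note gE = graded_vs_susp[OF A.E_vs] and gE' = graded_vs_susp[OF B.E_vs]
  note sq = graded_linear_susp[OF q] and sq' = graded_linear_susp[OF q']
  note s\<tau> = graded_linear_susp[OF \<tau>f_linear] and sgl = graded_linear_susp[OF gl]
  let ?h = "\<lambda>i x. B.split_iso r' i (lin \<tau>f i x)"
  have "graded_linear A.T B.E ?h"
    unfolding graded_linear_def by (intro allI linear_on_comp[OF graded_linearD[OF \<tau>f_linear] graded_linearD[OF q']])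
  note h = graded_linear_susp[OF this]
  have \<tau>: "comor_of A.T B.T \<tau>f Z = Sym_map (susp B.T) (susp_map (lin \<tau>f)) Z"
    by (rule comor_of_strict[OF A.T_vs B.T_vs \<tau>f_linear \<tau>f_strict Z])
  have qZ: "comor_of A.T A.E ?q Z = Sym_map (susp A.E) (susp_map (A.split_iso r)) Z"
    using comor_of_strict[OF A.T_vs A.E_vs _ strict_linear_family Z, of "A.split_iso r"] q by simp
  have "comor_of B.T B.E ?q' (comor_of A.T B.T \<tau>f Z)
      = Sym_map (susp B.E) (susp_map (B.split_iso r')) (Sym_map (susp B.T) (susp_map (lin \<tau>f)) Z)"
    unfolding \<tau>
    using comor_of_strict[OF B.T_vs B.E_vs _ strict_linear_family linear_onD(1)[OF Sym_map_linear[OF gT gT' s\<tau>] Z],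
        of "B.split_iso r'"] q' by simp
  also have "\<dots> = Sym_map (susp B.E) (susp_map ?h) Z"
    by (rule Sym_map_comp[OF gT gT' gE' s\<tau> sq' h _ Z]) (simp add: susp_map_def)
  also have "\<dots> = Sym_map (susp B.E) (susp_map (lin g)) (Sym_map (susp A.E) (susp_map (A.split_iso r)) Z)"
  proof (rule Sym_map_comp[OF gT gE gE' sq sgl h _ Z, symmetric])
    fix i y assume "y \<in> carrier (susp A.T i)"
    then have y: "y \<in> carrier (A.T (i - 1))" by (simp add: susp_def)
    show "susp_map (lin g) i (susp_map (A.split_iso r) i y) = susp_map ?h i y"
      using g_split_iso[OF r rr y] by (simp add: susp_map_def)
  qed
  also have "\<dots> = comor_of A.E B.E g (comor_of A.T A.E ?q Z)"
    unfolding qZ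
    by (rule comor_of_strict[OF A.E_vs B.E_vs gl g_strict linear_onD(1)[OF Sym_map_linear[OF gT gE sq] Z], symmetric])
  finally show ?thesis .
qed

end

section \<open>The commuting square of truncations\<close>

theorem proposition7p6:
  fixes n :: enat and m :: int
    and L :: "('k::field_char_0, 'v) graded" and br :: "'v word \<Rightarrow> 'v"
    and L' :: "('k, 'w) graded" and br' :: "'w word \<Rightarrow> 'w"
    and f :: "'v word \<Rightarrow> 'w"
  assumes "m \<ge> 1"
    and "Lie_n_algebra n L br" and "Lie_n_algebra n L' br'"
    and "Linf_epi L br L' br' f" and "strict_family L L' f"
    and "homology_map L' br' f m ` carrier (homology L br m) = carrier (homology L' br' m)"
  shows "\<exists>(brh :: ('v \<times> 'v set) word \<Rightarrow> 'v \<times> 'v set) (brh' :: ('w \<times> 'w set) word \<Rightarrow> 'w \<times> 'w set)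
      (q :: 'v set word \<Rightarrow> 'v \<times> 'v set) (q' :: 'w set word \<Rightarrow> 'w \<times> 'w set).
    let T = trunc_le L br m; T' = trunc_le L' br' m;
        \<tau>br = trunc_le_bracket L br m; \<tau>br' = trunc_le_bracket L' br' m;
        E = trunc_lt_hom L br m; E' = trunc_lt_hom L' br' m;
        \<tau>f = trunc_le_mor L br L' br' m f; g = trunc_lt_hom_mor L br L' br' m f
    in Linf_algebra E brh \<and> Linf_algebra E' brh' \<and>
       Linf_iso T \<tau>br E brh q \<and> strict_family T E q \<and>
       Linf_iso T' \<tau>br' E' brh' q' \<and> strict_family T' E' q' \<and>
       Linf_morphism T \<tau>br T' \<tau>br' \<tau>f \<and> strict_family T T' \<tau>f \<and>
       Linf_morphism E brh E' brh' g \<and> strict_family E E' g \<and>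
       (\<forall>Z\<in>carrier (Sym (susp T)).
          comor_of T' E' q' (comor_of T T' \<tau>f Z) = comor_of E E' g (comor_of T E q Z))"
proof -
  \<comment> \<open>For every \<open>n\<close>, finite or infinite, a negative degree fails the
    degree condition of \<open>Lie_n_algebra\<close>, so both algebras vanish there.\<close>
  interpret strict_morphism_nonneg L br L' br' m f
    using assms(1-5) by unfold_locales (auto simp: Lie_n_algebra_def Linf_epi_def)
  obtain r r' where r: "A.retraction r" "B.retraction r'"
    and rr: "\<And>x. x \<in> carrier (L m) \<Longrightarrow> homology_map L' br' f m (r x) = r' (lin f m x)"
    using compatible_retractions[OF assms(6)] by metis
  show ?thesis
    unfolding Let_def
    by (rule exI[of _ "A.split_bracket r"], rule exI[of _ "B.split_bracket r'"],
        rule exI[of _ "linear_family A.E (A.split_iso r)"], rule exI[of _ "linear_family B.E (B.split_iso r')"],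
        intro conjI ballI A.E_alg[OF r(1)] B.E_alg[OF r(2)] A.split_Linf_iso[OF r(1)] B.split_Linf_iso[OF r(2)]
          strict_linear_family strict_linear_family \<tau>f_morphism \<tau>f_strict g_morphism[OF r rr] g_strict
          square_commutes[OF r rr])
qed

end
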